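(* A velocity field of cellular type cannot be a universal mixer. That is: let $\tau>0$ be any time parameter, and let $u$ be a velocity field which, together with a corresponding solution $\rho$ of the continuity equation, forms a pair $(u,\rho)$ of $(\lambda,a,p,\theta,s)$-cellular type with time parameter $\tau$. Then $u$ is not a universal mixer.
   Context: Setting. $\mathcal{Q}=(-\frac12,\frac12)^2\subset\mathbb{R}^2$. All velocity fields are time-dependent, divergence-free, vanish on $\partial\mathcal{Q}$ and are identically zero outside $\mathcal{Q}$. Given a bounded initial datum $\bar\rho$ with $\bar\rho=0$ outside $\mathcal Q$ and $\int_{\mathcal Q}\bar\rho=0$ (mean-free), the corresponding solution $\rho$ (identically zero outside $\mathcal Q$) solves $\partial_t\rho+\operatorname{div}(u\rho)=0$ on $\mathbb{R}_+\times\mathbb{R}^2$, $\rho(0,\cdot)=\bar\rho$. The parameters $\kappa\in(0,1)$ and $\bar s\in(0,1)$ are fixed once and for all. Parameters: $\tau>0$, $\lambda>0$ with $\lambda^{-1}$ an integer $\ge2$, $0<\theta\le\frac12$, $a>0$, $1<p\le\infty$, $s>1$. Sobolev seminorms. For an integer $k$, $\|f\|_{\dot W^{k,p}}=\|\nabla^k f\|_{L^p(\mathbb{R}^2)}$. For $s=k+r$ with $k\ge1$ an integer and $r\in(0,1)$, $\|f\|^p_{\dot W^{s,p}(\mathbb{R}^2)}=\iint_{\mathbb{R}^2\times\mathbb{R}^2}\frac{|\nabla^kf(x)-\nabla^kf(y)|^p}{|x-y|^{2+rp}}\,dx\,dy$ (for $p=\infty$: the $r$-Hölder seminorm of $\nabla^k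 f$). $u\in L^\infty_t(\dot W^{s,p})$ means $\operatorname{ess\,sup}_t\|u(t,\cdot)\|_{\dot W^{s,p}(\mathbb{R}^2)}<\infty$. Mixing scales. For a bounded function $f$ on $\mathbb{R}^2$, the geometric mixing scale $\mathcal{G}(f)$ is the infimum of all $\epsilon>0$ such that for every $x\in\mathbb{R}^2$, $\left|\frac{1}{|B_\epsilon(x)|}\int_{B_\epsilon(x)}f(y)\,dy\right|\le\kappa\|f\|_\infty$. The functional mixing scale is $\|f\|_{\dot H^{-1}(\mathbb{R}^2)}=\sup\{\int_{\mathbb{R}^2}f\xi\,dx:\ \|\nabla\xi\|_{L^2(\mathbb{R}^2)}\le1\}$. Universal mixer. A divergence-free velocity field $u$ is a universal mixer if for every bounded, mean-free initial datum $\bar\rho$ the corresponding solution $\rho$ satisfies $\mathcal{G}(\rho(t,\cdot))\to0$ as well as $\|\rho(t,\cdot)\|_{\dot H^{-1}}\to0$ as $t\to\infty$. Tilings. For $\lambda>0$ with $\lambda^{-1}$ an integer $\ge2$ (and $\mathcal T_1=\{\mathcal Q\}$), $\mathcal{T}_\lambda$ is the family of the $\lambda^{-2}$ open squares $\{(x,y): -\frac12+k\lambda<x<-\frac12+(k+1)\lambda,\ -\frac12+h\lambda<y<-\frac12+(h+1)\lambda\}$, $k,h=0,\dots,\lambda^{-1}-1$. Characteristic length scale. For $A\subset E\subset\mathbb{R}^2$ with $A$ of positive measure, $LS_E(A)$ is the supremum of all $r>0$ for which there is a ball $B(x,r)\subset E$ with $\frac{|A\cap B(x,r)|}{|B(x,r)|}>1-\frac{1-\kappa}{2}\bar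 s$. Cellular basic building blocks. $\mathcal{B}_{\lambda,a,p,\theta,s}$ is the set of all pairs $(u_0,\rho_0)$ defined on the time interval $0\le t\le1$ such that: (i) $u_0\in L^\infty_t(\dot W^{s,p}_x)$ is divergence-free, $u_0=0$ on $\partial\mathcal{Q}$ and $u_0=0$ outside $\mathcal{Q}$; (ii) $\rho_0$ solves the continuity equation on $[0,1]$ with velocity $u_0$ and initial value equal to $1$ on a set $A\subset\mathcal{Q}$ and to a constant $c$ on $\mathcal{Q}\setminus A$ (and $0$ outside $\mathcal Q$), where $LS_{\mathcal{Q}}(A)\ge a$ and $|A|=\theta$ (the constant $c$ being such that $\int_{\mathcal{Q}}\rho_0(0,\cdot)=0$); (iii) $\int_Q\rho_0(1,x)\,dx=0$ for every $Q\in\mathcal{T}_\lambda$. Cellular type. Given $\tau>0$, let $T_0=0$ and $T_n=\sum_{i=0}^{n-1}\tau^i$. A pair $(u,\rho)$ of a velocity field and a corresponding solution of the continuity equation is of $(\lambda,a,p,\theta,s)$-cellular type if on any time interval $T_n\le t<T_{n+1}$ and for any tile $Q\in\mathcal{T}_{\lambda^n}$ there exists $(u_0,\rho_0)\in\mathcal{B}_{\lambda,a,p,\theta,s}$ (depending on $Q$ and $n$) such that for $x\in Q$ $$u(t,x)=\frac{\lambda^n}{\tau^n}u_0\Big(\frac{t-T_n}{\tau^n},\frac{x-r_Q}{\lambda^n}\Big),\qquad \rho(t,x)=\rho_0\Big(\frac{t-T_n}{\tau^n},\frac{x-r_Q}{\lambda^n}\Big),$$ where $r_Q$ is the center of $Q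$.
   Formalization: For τ<1 the stages fill only [0,1/(1−τ)) and the velocity field is additionally assumed to be zero from time 1/(1−τ) on; otherwise a universal mixer could be glued on after that time and the claim would fail. *)

theory Defs
  imports "HOL-Analysis.Analysis" "HOL-Probability.Essential_Supremum"
begin

section \<open>Test functions and Sobolev seminorms\<close>

text \<open>Iterated directional derivatives. Smoothness below is differentiability of all of them, which
  amounts to being of class C-infinity.\<close>

fun dirder :: "'a list \<Rightarrow> ('a::euclidean_space \<Rightarrow> real) \<Rightarrow> 'a \<Rightarrow> real" where
  "dirder [] f = f"
| "dirder (v # vs) f = (\<lambda>x. frechet_derivative (dirder vs f) (at x) v)"

definition smooth :: "('a::euclidean_space \<Rightarrow> real) \<Rightarrow> bool" where
  "smooth f \<longleftrightarrow> (\<forall>vs x. dirder vs f differentiable (at x))"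

definition tsupport :: "('a::euclidean_space \<Rightarrow> real) \<Rightarrow> 'a set" where
  "tsupport f = closure {x. f x \<noteq> 0}"

definition test_function :: "('a::euclidean_space \<Rightarrow> real) \<Rightarrow> bool" where
  "test_function f \<longleftrightarrow> smooth f \<and> compact (tsupport f)"

definition locally_integrable :: "('a::euclidean_space \<Rightarrow> 'b::euclidean_space) \<Rightarrow> bool" where
  "locally_integrable f \<longleftrightarrow> (\<forall>K. compact K \<longrightarrow> set_integrable lborel K f)"

definition weak_derivative ::
  "'a list \<Rightarrow> ('a::euclidean_space \<Rightarrow> 'b::euclidean_space) \<Rightarrow> ('a \<Rightarrow> 'b) \<Rightarrow> bool" where
  "weak_derivative vs f g \<longleftrightarrow> locally_integrable f \<and> locally_integrable g \<and>
     (\<forall>\<phi>. test_function \<phi> \<longrightarrow>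
        (LINT x|lborel. dirder vs \<phi> x *\<^sub>R f x) = (-1) ^ length vs *\<^sub>R (LINT x|lborel. \<phi> x *\<^sub>R g x))"

definition multi_indices :: "nat \<Rightarrow> 'a::euclidean_space list set" where
  "multi_indices k = {vs. set vs \<subseteq> Basis \<and> length vs = k}"

text \<open>The k-th gradient is the family of all weak partial derivatives of order k, indexed by the
  lists of k basis vectors; its pointwise size is the Euclidean norm of that family.\<close>

definition weak_gradient ::
  "nat \<Rightarrow> ('a::euclidean_space \<Rightarrow> 'b::euclidean_space) \<Rightarrow> ('a \<Rightarrow> 'a list \<Rightarrow> 'b) \<Rightarrow> bool" where
  "weak_gradient k f G \<longleftrightarrow> (\<forall>vs\<in>multi_indices k. weak_derivative vs f (\<lambda>x. G x vs))"

definition tensor_norm :: "nat \<Rightarrow> ('a::euclidean_space list \<Rightarrow> 'b::euclidean_space) \<Rightarrow> real" where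
  "tensor_norm k v = sqrt (\<Sum>vs\<in>multi_indices k. (norm (v vs))\<^sup>2)"

definition ennreal_root :: "real \<Rightarrow> ennreal \<Rightarrow> ennreal" where
  "ennreal_root p x = (if x = \<infinity> then \<infinity> else ennreal (enn2real x powr (1 / p)))"

definition Lp_norm_gradient ::
  "nat \<Rightarrow> ereal \<Rightarrow> ('a::euclidean_space \<Rightarrow> 'a list \<Rightarrow> 'b::euclidean_space) \<Rightarrow> ennreal" where
  "Lp_norm_gradient k p G =
     (if p = \<infinity> then esssup lborel (\<lambda>x. ennreal (tensor_norm k (G x)))
      else ennreal_root (real_of_ereal p)
             (\<integral>\<^sup>+x. ennreal (tensor_norm k (G x) powr real_of_ereal p) \<partial>lborel))"

definition fractional_seminorm_gradient ::
  "nat \<Rightarrow> real \<Rightarrow> ereal \<Rightarrow> ('a::euclidean_space \<Rightarrow> 'a list \<Rightarrow> 'b::euclidean_space) \<Rightarrow> ennreal" where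
  "fractional_seminorm_gradient k r p G =
     (if p = \<infinity> then
        (SUP (x, y) \<in> {(x, y). x \<noteq> y}.
           ennreal (tensor_norm k (\<lambda>vs. G x vs - G y vs) / norm (x - y) powr r))
      else ennreal_root (real_of_ereal p)
        (\<integral>\<^sup>+x. \<integral>\<^sup>+y. ennreal
             (tensor_norm k (\<lambda>vs. G x vs - G y vs) powr real_of_ereal p /
              norm (x - y) powr (real DIM('a) + r * real_of_ereal p)) \<partial>lborel \<partial>lborel))"

text \<open>Weak gradients are unique up to null sets, so the infimum ranges over versions of one
  gradient: it is infinite when there is none, and it is attained at the continuous version in the
  Hoelder case. All other expressions do not depend on the version.\<close>

definition sobolev_seminorm ::
  "real \<Rightarrow> ereal \<Rightarrow> ('a::euclidean_space \<Rightarrow> 'b::euclidean_space) \<Rightarrow> ennreal" where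
  "sobolev_seminorm s p f =
     (INF G \<in> {G. weak_gradient (nat \<lfloor>s\<rfloor>) f G}.
        if s \<in> \<int> then Lp_norm_gradient (nat \<lfloor>s\<rfloor>) p G
        else fractional_seminorm_gradient (nat \<lfloor>s\<rfloor>) (frac s) p G)"


section \<open>Velocity fields and the continuity equation\<close>

definition unit_square :: "(real^2) set" where
  "unit_square = {x. -1/2 < x $ 1 \<and> x $ 1 < 1/2 \<and> -1/2 < x $ 2 \<and> x $ 2 < 1/2}"

text \<open>The horizon is 1 for building blocks and infinity for evolutions on all of
  \<open>[0, \<infinity>)\<close>.\<close>

definition time_interval :: "ereal \<Rightarrow> real set" where
  "time_interval T = {t. 0 \<le> t \<and> ereal t \<le> T}"

text \<open>Local integrability is what gives \<open>div (u \<rho>)\<close> a meaning for bounded \<open>\<rho>\<close>.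
  The square is open, so vanishing off it includes the boundary condition.\<close>

definition velocity_field :: "ereal \<Rightarrow> (real \<Rightarrow> real^2 \<Rightarrow> real^2) \<Rightarrow> bool" where
  "velocity_field T u \<longleftrightarrow>
     (\<forall>N. set_integrable lborel ((time_interval T \<inter> {..N}) \<times> UNIV) (\<lambda>(t, x). u t x)) \<and>
     (\<forall>t\<in>time_interval T. \<forall>x. x \<notin> unit_square \<longrightarrow> u t x = 0) \<and>
     (AE t in lborel. t \<in> time_interval T \<longrightarrow>
        (\<forall>\<psi>. test_function \<psi> \<longrightarrow>
           (LINT x|lborel. frechet_derivative \<psi> (at x) (u t x)) = 0))"

definition initial_datum :: "(real^2 \<Rightarrow> real) \<Rightarrow> bool" where
  "initial_datum \<rho>0 \<longleftrightarrow> \<rho>0 \<in> borel_measurable borel \<and> (\<exists>C. \<forall>x. \<bar>\<rho>0 x\<bar> \<le> C) \<and>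
     (\<forall>x. x \<notin> unit_square \<longrightarrow> \<rho>0 x = 0) \<and> (LINT x|lborel. \<rho>0 x) = 0"

text \<open>Bounded distributional solutions. The Frechet derivative of \<open>\<phi>\<close> in the direction
  \<open>(1, u)\<close> is the derivative in time plus \<open>u\<close> times the gradient in space. Weak continuity in
  time singles out the version for which \<open>\<rho> t\<close> is meaningful at every single time.\<close>

definition continuity_solution ::
  "ereal \<Rightarrow> (real \<Rightarrow> real^2 \<Rightarrow> real^2) \<Rightarrow> (real^2 \<Rightarrow> real) \<Rightarrow> (real \<Rightarrow> real^2 \<Rightarrow> real) \<Rightarrow> bool" where
  "continuity_solution T u \<rho>0 \<rho> \<longleftrightarrow>
     set_borel_measurable lborel (time_interval T \<times> UNIV) (\<lambda>(t, x). \<rho> t x) \<and>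
     (\<exists>C. \<forall>t\<in>time_interval T. \<forall>x. \<bar>\<rho> t x\<bar> \<le> C) \<and>
     (\<forall>t\<in>time_interval T. \<forall>x. x \<notin> unit_square \<longrightarrow> \<rho> t x = 0) \<and>
     (\<forall>\<psi>. test_function \<psi> \<longrightarrow> continuous_on (time_interval T) (\<lambda>t. LINT x|lborel. \<rho> t x * \<psi> x)) \<and>
     (AE x in lborel. \<rho> 0 x = \<rho>0 x) \<and>
     (\<forall>\<phi>. test_function \<phi> \<and> tsupport \<phi> \<subseteq> {(t, x). ereal t < T} \<longrightarrow>
        (LINT (t, x):time_interval T \<times> UNIV|lborel.
            \<rho> t x * frechet_derivative \<phi> (at (t, x)) (1, u t x))
        + (LINT x|lborel. \<rho>0 x * \<phi> (0, x)) = 0)"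


section \<open>Mixing scales and universal mixers\<close>

definition geometric_mixing_scale :: "real \<Rightarrow> (real^2 \<Rightarrow> real) \<Rightarrow> ereal" where
  "geometric_mixing_scale \<kappa> f =
     (INF \<epsilon> \<in> {\<epsilon>. 0 < \<epsilon> \<and>
        (\<forall>x. ereal \<bar>(LINT y:ball x \<epsilon>|lborel. f y) / measure lborel (ball x \<epsilon>)\<bar>
              \<le> ereal \<kappa> * esssup lborel (\<lambda>y. ereal \<bar>f y\<bar>))}. ereal \<epsilon>)"

definition functional_mixing_scale :: "(real^2 \<Rightarrow> real) \<Rightarrow> ereal" where
  "functional_mixing_scale f =
     (SUP \<xi> \<in> {\<xi>. sobolev_seminorm 1 2 \<xi> \<le> 1}. ereal (LINT x|lborel. f x * \<xi> x))"

definition universal_mixer :: "real \<Rightarrow> (real \<Rightarrow> real^2 \<Rightarrow> real^2) \<Rightarrow> bool" where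
  "universal_mixer \<kappa> u \<longleftrightarrow> velocity_field \<infinity> u \<and>
     (\<forall>\<rho>0 \<rho>. initial_datum \<rho>0 \<and> continuity_solution \<infinity> u \<rho>0 \<rho> \<longrightarrow>
        ((\<lambda>t. geometric_mixing_scale \<kappa> (\<rho> t)) \<longlongrightarrow> 0) at_top \<and>
        ((\<lambda>t. functional_mixing_scale (\<rho> t)) \<longlongrightarrow> 0) at_top)"


section \<open>Cellular type\<close>

definition tile :: "real \<Rightarrow> nat \<Rightarrow> nat \<Rightarrow> (real^2) set" where
  "tile l k h = {x. -1/2 + real k * l < x $ 1 \<and> x $ 1 < -1/2 + (real k + 1) * l \<and>
                    -1/2 + real h * l < x $ 2 \<and> x $ 2 < -1/2 + (real h + 1) * l}"

definition tile_center :: "real \<Rightarrow> nat \<Rightarrow> nat \<Rightarrow> real^2" where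
  "tile_center l k h = vector [-1/2 + (real k + 1/2) * l, -1/2 + (real h + 1/2) * l]"

definition tile_indices :: "real \<Rightarrow> (nat \<times> nat) set" where
  "tile_indices l = {(k, h). real k \<le> 1 / l - 1 \<and> real h \<le> 1 / l - 1}"

definition length_scale :: "real \<Rightarrow> real \<Rightarrow> (real^2) set \<Rightarrow> (real^2) set \<Rightarrow> ereal" where
  "length_scale \<kappa> sbar E A =
     (SUP r \<in> {r. 0 < r \<and> (\<exists>x. ball x r \<subseteq> E \<and>
        measure lborel (A \<inter> ball x r) / measure lborel (ball x r) > 1 - (1 - \<kappa>) / 2 * sbar)}.
        ereal r)"

definition building_blocks ::
  "real \<Rightarrow> real \<Rightarrow> real \<Rightarrow> real \<Rightarrow> ereal \<Rightarrow> real \<Rightarrow> real \<Rightarrow>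
   ((real \<Rightarrow> real^2 \<Rightarrow> real^2) \<times> (real \<Rightarrow> real^2 \<Rightarrow> real)) set" where
  "building_blocks \<kappa> sbar l a p \<theta> s = {(u0, \<rho>0).
     velocity_field 1 u0 \<and>
     (\<exists>C::real. AE t in lborel. t \<in> {0..1} \<longrightarrow> sobolev_seminorm s p (u0 t) \<le> ennreal C) \<and>
     (\<exists>A c. A \<in> sets borel \<and> A \<subseteq> unit_square \<and>
        length_scale \<kappa> sbar unit_square A \<ge> ereal a \<and> measure lborel A = \<theta> \<and>
        (let datum = (\<lambda>x. if x \<in> A then 1 else if x \<in> unit_square then c else 0) in
          (LINT x:unit_square|lborel. datum x) = 0 \<and> continuity_solution 1 u0 datum \<rho>0)) \<and>
     (\<forall>(k, h) \<in> tile_indices l. (LINT x:tile l k h|lborel. \<rho>0 1 x) = 0)}"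

definition stage_time :: "real \<Rightarrow> nat \<Rightarrow> real" where
  "stage_time \<tau> n = (\<Sum>i<n. \<tau> ^ i)"

text \<open>For \<open>\<tau> < 1\<close> the stages only exhaust the bounded time interval \<open>[0, 1 / (1 - \<tau>))\<close>.
  The last clause then extends the velocity field by zero to all later times, where the rescaled
  building blocks do not define it; for \<open>\<tau> \<ge> 1\<close> that clause is void.\<close>

definition cellular_type ::
  "real \<Rightarrow> real \<Rightarrow> real \<Rightarrow> real \<Rightarrow> real \<Rightarrow> ereal \<Rightarrow> real \<Rightarrow> real \<Rightarrow>
   (real \<Rightarrow> real^2 \<Rightarrow> real^2) \<Rightarrow> (real \<Rightarrow> real^2 \<Rightarrow> real) \<Rightarrow> bool" where
  "cellular_type \<kappa> sbar \<tau> l a p \<theta> s u \<rho> \<longleftrightarrow>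
     velocity_field \<infinity> u \<and>
     (\<exists>\<rho>init. initial_datum \<rho>init \<and> continuity_solution \<infinity> u \<rho>init \<rho>) \<and>
     (\<forall>n. \<forall>(k, h) \<in> tile_indices (l ^ n). \<exists>(u0, \<rho>0) \<in> building_blocks \<kappa> sbar l a p \<theta> s.
        \<forall>t \<in> {stage_time \<tau> n ..< stage_time \<tau> (Suc n)}. \<forall>x \<in> tile (l ^ n) k h.
          u t x = (l ^ n / \<tau> ^ n) *\<^sub>R
             u0 ((t - stage_time \<tau> n) / \<tau> ^ n) ((x - tile_center (l ^ n) k h) /\<^sub>R l ^ n) \<and>
          \<rho> t x = \<rho>0 ((t - stage_time \<tau> n) / \<tau> ^ n) ((x - tile_center (l ^ n) k h) /\<^sub>R l ^ n)) \<and>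
     (\<forall>t. (\<forall>n. stage_time \<tau> n \<le> t) \<longrightarrow> (\<forall>x. u t x = 0))"

end

theory Submission
  imports Defs
begin

text \<open>From time 1 on, a cellular field does not move mass across the boundaries of the tiles of side
  \<open>l\<close>, so a profile \<open>f\<close> that is constant on these tiles (here: on the first column of tiles and on its
  complement) is stationary and never gets mixed. It remains to find an initial datum that the field
  transports to \<open>f\<close> at time 1. The field is merely integrable, so no flow is used: for test
  functions that vanish at time 0 the energy estimate
  \<open>\<parallel>\<phi>(1)\<parallel> \<le> \<parallel>\<partial>\<phi>/\<partial>t + u \<sqdot> \<nabla>\<phi>\<parallel>\<close> in \<open>L\<^sup>1\<close> and the Hahn-Banach theorem yield a bounded
  distributional solution on \<open>[0, 1]\<close> with final value \<open>f\<close>. Its time averages converge weakly at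
  every single time, and a measurable form of Mazur's lemma turns these weak limits into a jointly
  measurable version that is weakly continuous in time.\<close>

section \<open>Measurable selection of weak limits\<close>

text \<open>One unmixed solution refutes universality, but it has to satisfy all of
  \<open>continuity_solution\<close>, including joint measurability and weak continuity at every
  single time. Duality only yields a class modulo null sets, so a version must be chosen. Time 1 is
  \<open>stage_time \<tau> 1\<close>. In stage 0 the only tile is the whole square, and mass may
  pass between columns; from stage 1 on every tile lies in a tile of side \<open>l\<close>. If
  \<open>\<tau> < 1\<close>, the stages accumulate at a finite time, after which the field is zero
  and the profile remains stationary. The energy estimate applies the chain rule to the smooth test
  function and never to the rough solution: the equation is multiplied by a smooth approximation of
  the sign of the test function, and the advection term integrates to zero since the field is
  divergence free. The profile is \<open>1 - l\<close> on the first column and \<open>- l\<close> on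
  the rest of the square. It has mean zero and, as \<open>l \<le> 1/2\<close>, attains its supremum
  on the whole column, which contains balls of every radius below \<open>l / 2\<close>. So the
  mixing scale stays at least \<open>l / 2\<close>.\<close>

datatype mix = Pure nat | Mid mix mix

instance mix :: countable
  by countable_datatype

text \<open>A term is an iterated midpoint, hence a convex combination with dyadic weights. There
  are only countably many terms, so a choice among them by enumeration stays measurable, and
  midpoints are all that the parallelogram law requires.\<close>

primrec mix_eval :: "(nat \<Rightarrow> real) \<Rightarrow> mix \<Rightarrow> real" where
  "mix_eval a (Pure n) = a n"
| "mix_eval a (Mid S T) = (mix_eval a S + mix_eval a T) / 2"

primrec mix_tail :: "nat \<Rightarrow> mix \<Rightarrow> bool" where
  "mix_tail j (Pure n) \<longleftrightarrow> j \<le> n"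
| "mix_tail j (Mid S T) \<longleftrightarrow> mix_tail j S \<and> mix_tail j T"

lemma mix_tail_mono: "mix_tail j T \<Longrightarrow> i \<le> j \<Longrightarrow> mix_tail i T"
  by (induction T) auto

lemma mix_eval_dist_le:
  "mix_tail k T \<Longrightarrow> (\<And>n. k \<le> n \<Longrightarrow> \<bar>a n - c\<bar> \<le> e) \<Longrightarrow> \<bar>mix_eval a T - c\<bar> \<le> e"
proof (induction T)
  case (Mid S T)
  have "\<bar>mix_eval a S - c\<bar> \<le> e" "\<bar>mix_eval a T - c\<bar> \<le> e"
    using Mid by auto
  then show ?case by (auto simp: abs_le_iff field_simps)
qed auto

lemma mix_eval_abs_le: "(\<And>n. \<bar>a n\<bar> \<le> e) \<Longrightarrow> \<bar>mix_eval a T\<bar> \<le> e"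
  by (induction T) (auto simp: abs_le_iff field_simps)

text \<open>Once all members of a tail are within \<open>r / 2\<close> of \<open>c\<close>, so are
  all their midpoints, however the combinations are chosen. This lets a sequence be replaced by
  combinations of its tails without changing its limits.\<close>

lemma mix_eval_tendsto:
  assumes "a \<longlonglongrightarrow> c" and "\<And>k. mix_tail k (T k)"
  shows "(\<lambda>k. mix_eval a (T k)) \<longlonglongrightarrow> c"
proof (rule LIMSEQ_I)
  fix r :: real assume "0 < r"
  then obtain N where N: "\<And>n. N \<le> n \<Longrightarrow> \<bar>a n - c\<bar> < r / 2"
    using LIMSEQ_D[OF assms(1), of "r/2"] by auto
  have "\<bar>mix_eval a (T k) - c\<bar> \<le> r / 2" if "N \<le> k" for k
    by (rule mix_eval_dist_le[OF assms(2)]) (use N that in \<open>auto intro!: less_imp_le\<close>)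
  then show "\<exists>N. \<forall>n\<ge>N. norm (mix_eval a (T n) - c) < r"
    using \<open>0 < r\<close> by (intro exI[of _ N]) fastforce
qed

lemma mix_eval_integral:
  assumes "\<And>n. integrable M (h n)"
  shows "integrable M (\<lambda>x. mix_eval (\<lambda>n. h n x) T)"
    and "(\<integral>x. mix_eval (\<lambda>n. h n x) T \<partial>M) = mix_eval (\<lambda>n. \<integral>x. h n x \<partial>M) T"
proof -
  have "integrable M (\<lambda>x. mix_eval (\<lambda>n. h n x) T) \<and>
    (\<integral>x. mix_eval (\<lambda>n. h n x) T \<partial>M) = mix_eval (\<lambda>n. \<integral>x. h n x \<partial>M) T"
    using assms by (induction T) auto
  then show "integrable M (\<lambda>x. mix_eval (\<lambda>n. h n x) T)"
    "(\<integral>x. mix_eval (\<lambda>n. h n x) T \<partial>M) = mix_eval (\<lambda>n. \<integral>x. h n x \<partial>M) T"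
    by auto
qed

lemma mix_eval_mult: "mix_eval (\<lambda>n. a n * c) T = mix_eval a T * c"
  by (induction T) (auto simp: field_simps)

text \<open>Geometric decay of the squared L2 distances makes the L1 distances summable, so the
  telescoping series converges absolutely almost everywhere.\<close>

lemma AE_convergent_of_square_bounds:
  fixes s :: "nat \<Rightarrow> 'a \<Rightarrow> real"
  assumes "finite_measure M"
    and [measurable]: "\<And>k. s k \<in> borel_measurable M"
    and bound: "\<And>k x. \<bar>s k x\<bar> \<le> B"
    and sq: "\<And>k. (\<integral>x. (s (Suc k) x - s k x)\<^sup>2 \<partial>M) \<le> C * (1/4) ^ k"
  shows "AE x in M. convergent (\<lambda>k. s k x)"
proof -
  interpret finite_measure M by fact
  have B: "0 \<le> B" using bound[of 0 undefined] by linarith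
  have int: "integrable M (\<lambda>x. \<bar>s (Suc k) x - s k x\<bar>)"
    "integrable M (\<lambda>x. (s (Suc k) x - s k x)\<^sup>2)" for k
  proof -
    have *: "\<bar>s (Suc k) x - s k x\<bar> \<le> 2 * B" for x
      using bound[of k x] bound[of "Suc k" x] by linarith
    show "integrable M (\<lambda>x. \<bar>s (Suc k) x - s k x\<bar>)"
      by (rule integrable_const_bound[where B="2 * B"]) (use * in auto)
    show "integrable M (\<lambda>x. (s (Suc k) x - s k x)\<^sup>2)"
    proof (rule integrable_const_bound[where B="(2 * B)\<^sup>2"])
      show "AE x in M. norm ((s (Suc k) x - s k x)\<^sup>2) \<le> (2 * B)\<^sup>2"
        using * B by (auto simp only: real_norm_def abs_power2 intro!: AE_I2 abs_le_square_iff[THEN iffD1]) auto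
    qed auto
  qed
  define K where "K = C + measure M (space M)"
  have L1: "(\<integral>x. \<bar>s (Suc k) x - s k x\<bar> \<partial>M) \<le> K * (1/2) ^ k" for k
  proof -
    have "(\<integral>x. \<bar>s (Suc k) x - s k x\<bar> \<partial>M) \<le>
        (\<integral>x. 2 ^ k * (s (Suc k) x - s k x)\<^sup>2 + (1/2) ^ k \<partial>M)"
    proof (rule integral_mono)
      fix x
      define d where "d = \<bar>s (Suc k) x - s k x\<bar>"
      \<comment> \<open>The weight \<open>2 ^ k\<close> balances the two terms: after integration
        the weighted square and the constant \<open>(1/2) ^ k\<close> are both of order
        \<open>(1/2) ^ k\<close>.\<close>
      have "0 \<le> (2 ^ k * d - 1)\<^sup>2" by simp
      then have "2 * 2 ^ k * d \<le> (2 ^ k * d)\<^sup>2 + 1"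
        by (simp add: power2_eq_square algebra_simps)
      moreover have "0 \<le> 2 ^ k * d" by (simp add: d_def)
      ultimately have "2 ^ k * d \<le> (2 ^ k * d)\<^sup>2 + 1" by linarith
      then have "(1/2) ^ k * (2 ^ k * d) \<le> (1/2) ^ k * ((2 ^ k * d)\<^sup>2 + 1)"
        by (intro mult_left_mono) auto
      then have "d \<le> 2 ^ k * d\<^sup>2 + (1/2) ^ k"
        by (simp add: power2_eq_square field_simps)
      then show "\<bar>s (Suc k) x - s k x\<bar> \<le> 2 ^ k * (s (Suc k) x - s k x)\<^sup>2 + (1/2) ^ k"
        by (simp add: d_def)
    qed (use int in auto)
    also have "\<dots> = 2 ^ k * (\<integral>x. (s (Suc k) x - s k x)\<^sup>2 \<partial>M) + (1/2) ^ k * measure M (space M)"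
      using int by simp
    also have "\<dots> \<le> 2 ^ k * (C * (1/4) ^ k) + (1/2) ^ k * measure M (space M)"
      using sq by (intro add_mono mult_left_mono) auto
    also have "\<dots> = K * (1/2) ^ k"
    proof -
      have "(2::real) ^ k * (1/4) ^ k = (1/2) ^ k"
        by (simp add: power_mult_distrib[symmetric])
      then show ?thesis by (simp add: K_def algebra_simps)
    qed
    finally show ?thesis .
  qed
  have sK: "summable (\<lambda>k. K * (1/2::real) ^ k)"
    by (intro summable_mult summable_geometric) auto
  have sI: "summable (\<lambda>k. \<integral>x. \<bar>s (Suc k) x - s k x\<bar> \<partial>M)"
    by (rule summable_comparison_test'[OF sK, of 0]) (use L1 in \<open>auto\<close>)
  have "(\<integral>\<^sup>+x. (\<Sum>k. ennreal \<bar>s (Suc k) x - s k x\<bar>) \<partial>M) =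
      (\<Sum>k. ennreal (\<integral>x. \<bar>s (Suc k) x - s k x\<bar> \<partial>M))"
    by (subst nn_integral_suminf) (auto simp: nn_integral_eq_integral int)
  also have "\<dots> \<noteq> \<infinity>"
    using sI by (simp add: suminf_ennreal2 )
  finally have "AE x in M. (\<Sum>k. ennreal \<bar>s (Suc k) x - s k x\<bar>) \<noteq> \<infinity>"
    by (intro nn_integral_PInf_AE) auto
  then show ?thesis
  proof eventually_elim
    case (elim x)
    then have "summable (\<lambda>k. \<bar>s (Suc k) x - s k x\<bar>)"
      by (intro summable_suminf_not_top) auto
    then have "summable (\<lambda>k. s (Suc k) x - s k x)"
      by (rule summable_rabs_cancel)
    then have "convergent (\<lambda>n. s n x - s 0 x)"
      using sum_lessThan_telescope[of "\<lambda>n. s n x"] by (simp add: summable_iff_convergent)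
    then show ?case
      by (simp add: convergent_diff_const_right_iff)
  qed
qed

text \<open>Mazur's lemma with measurable dependence on a parameter: among the dyadic convex combinations of
  a tail of the sequence, the first one (in a fixed enumeration) whose square norm is close to the
  limit of the infima is chosen, and the parallelogram law makes these choices a Cauchy sequence.\<close>

lemma measurable_mazur:
  fixes h :: "nat \<Rightarrow> 'p \<Rightarrow> 'a \<Rightarrow> real"
  assumes "finite_measure M"
    and hm: "\<And>n. (\<lambda>(p, x). h n p x) \<in> borel_measurable (N \<Otimes>\<^sub>M M)"
    and bound: "\<And>n p x. \<bar>h n p x\<bar> \<le> 1"
  obtains g T where "(\<lambda>(p, x). g p x) \<in> borel_measurable (N \<Otimes>\<^sub>M M)"
    and "\<And>p x. \<bar>g p x\<bar> \<le> (1::real)"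
    and "\<And>k p. p \<in> space N \<Longrightarrow> mix_tail k (T k p)"
    and "\<And>p. p \<in> space N \<Longrightarrow> AE x in M. (\<lambda>k. mix_eval (\<lambda>n. h n p x) (T k p)) \<longlonglongrightarrow> g p x"
proof -
  interpret finite_measure M by fact
  define w where "w S p x = mix_eval (\<lambda>n. h n p x) S" for S p x
  have w_Mid: "w (Mid S T) p x = (w S p x + w T p x) / 2" for S T p x
    by (simp add: w_def)
  have wb: "\<bar>w S p x\<bar> \<le> 1" for S p x
    unfolding w_def by (rule mix_eval_abs_le) (rule bound)
  have w2: "(w S p x)\<^sup>2 \<le> 1" for S p x
    using wb[of S p x] by (simp add: abs_square_le_1)
  have wm[measurable]: "(\<lambda>(p, x). w S p x) \<in> borel_measurable (N \<Otimes>\<^sub>M M)" for S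
  proof (induction S)
    case (Pure n)
    then show ?case using hm by (simp add: w_def)
  next
    case (Mid S T)
    then have [measurable]: "(\<lambda>(p, x). w S p x) \<in> borel_measurable (N \<Otimes>\<^sub>M M)"
      "(\<lambda>(p, x). w T p x) \<in> borel_measurable (N \<Otimes>\<^sub>M M)" by auto
    show ?case unfolding w_Mid by measurable
  qed
  have wmx: "(\<lambda>x. w S p x) \<in> borel_measurable M" if "p \<in> space N" for S p
    using measurable_compose_Pair1[OF that wm[of S]] by simp
  define q where "q S p = (\<integral>x. (w S p x)\<^sup>2 \<partial>M)" for S p
  have [measurable]: "(\<lambda>p. q S p) \<in> borel_measurable N" for S
    unfolding q_def by measurable
  define B where "B = measure M (space M)"
  have int2: "integrable M (\<lambda>x. (w S p x)\<^sup>2)" if "p \<in> space N" for S p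
    by (rule integrable_const_bound[where B=1]) (use wmx[OF that] w2 in auto)
  have q0: "0 \<le> q S p" for S p
    unfolding q_def by simp
  have qB: "q S p \<le> B" for S p
  proof (cases "integrable M (\<lambda>x. (w S p x)\<^sup>2)")
    case True
    then have "q S p \<le> (\<integral>x. 1 \<partial>M)"
      unfolding q_def by (intro integral_mono) (auto intro: w2)
    then show ?thesis by (simp add: B_def)
  next
    case False
    then show ?thesis by (simp add: q_def not_integrable_integral_eq B_def)
  qed
  define A where "A j = {S. mix_tail j S}" for j
  have Ane: "A j \<noteq> {}" for j
    unfolding A_def using mix_tail.simps(1)[of j j] by blast
  define G where "G j p = (INF S\<in>A j. q S p)" for j p
  have bddA: "bdd_below ((\<lambda>S. q S p) ` A j)" for j p
    by (rule bdd_belowI[of _ 0]) (use q0 in auto)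
  have [measurable]: "G j \<in> borel_measurable N" for j
    unfolding G_def by (rule borel_measurable_cINF) (auto simp: bddA countableI_type)
  have Gle: "G j p \<le> q S p" if "mix_tail j S" for j p S
    unfolding G_def using bddA that by (intro cINF_lower) (auto simp: A_def)
  have GB: "G j p \<le> B" for j p
    using Gle[of j "Pure j" p] qB[of "Pure j" p] by simp
  define e where "e p = (SUP j. G j p)" for p
  have bddG: "bdd_above (range (\<lambda>j. G j p))" for p
    by (rule bdd_aboveI[of _ B]) (use GB in auto)
  have [measurable]: "e \<in> borel_measurable N"
    unfolding e_def by (rule borel_measurable_cSUP) (auto simp: bddG)
  have Ge: "G j p \<le> e p" for j p
    unfolding e_def using bddG by (intro cSUP_upper) auto
  have Gmono: "G i p \<le> G j p" if "i \<le> j" for i j p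
    unfolding G_def using that Ane bddA
    by (intro cINF_superset_mono) (auto simp: A_def intro: mix_tail_mono)
  \<comment> \<open>The index \<open>j\<close> may have to exceed \<open>k\<close>: \<open>S\<close>
    is taken from a tail so late that the infimum over it is already within \<open>(1/4)^k\<close>
    of its limit \<open>e p\<close>. Such an \<open>S\<close> is nearly minimal, and midpoints with
    other choices cannot do much better.\<close>
  define P where "P k p S \<longleftrightarrow> (\<exists>j. k \<le> j \<and> mix_tail j S \<and> e p - (1/4)^k \<le> G j p \<and> q S p \<le> e p + (1/4)^k)"
    for k p S
  have Pex: "\<exists>S. P k p S" for k p
  proof -
    have "e p - (1/4)^k < e p" by simp
    then obtain i where i: "e p - (1/4)^k < G i p"
      unfolding e_def by (subst (asm) less_cSUP_iff) (auto simp: bddG)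
    define j where "j = max i k"
    have "G j p < e p + (1/4)^k"
      using Ge[of j p] by (simp add: add_strict_increasing2 order_le_less_trans)
    then obtain S where "mix_tail j S" "q S p < e p + (1/4)^k"
      unfolding G_def by (subst (asm) cINF_less_iff) (auto simp: bddA Ane, auto simp: A_def)
    moreover have "e p - (1/4)^k \<le> G j p"
      using i Gmono[of i j p] by (simp add: j_def)
    ultimately show ?thesis
      unfolding P_def by (intro exI[of _ S] exI[of _ j]) (auto simp: j_def)
  qed
  define T where "T k p = (from_nat (LEAST i. P k p (from_nat i)) :: mix)" for k p
  have PT: "P k p (T k p)" for k p
  proof -
    obtain S where "P k p S" using Pex by blast
    then have "P k p (from_nat (to_nat S))" by simp
    then show ?thesis unfolding T_def by (rule LeastI)
  qed
  have T_tail: "mix_tail k (T k p)" for k p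
    using PT[of k p] mix_tail_mono unfolding P_def by blast
  \<comment> \<open>For each fixed term and index, \<open>P\<close> compares measurable functions of
    \<open>p\<close>, and only countably many terms and indices occur.\<close>
  have Tm[measurable]: "T k \<in> measurable N (count_space UNIV)" for k
    unfolding T_def P_def by measurable
  define s where "s k p x = w (T k p) p x" for k p x
  have sm[measurable]: "(\<lambda>(p, x). s k p x) \<in> borel_measurable (N \<Otimes>\<^sub>M M)" for k
  proof -
    have "(\<lambda>z. (\<lambda>S z. w S (fst z) (snd z)) (T k (fst z)) z) \<in> borel_measurable (N \<Otimes>\<^sub>M M)"
      by (rule measurable_compose_countable) (use wm in \<open>auto simp: case_prod_beta'\<close>)
    then show ?thesis by (simp add: s_def case_prod_beta')
  qed
  have near: "(\<integral>x. (s (Suc k) p x - s k p x)\<^sup>2 \<partial>M) \<le> 8 * (1/4)^k" if p: "p \<in> space N" for k p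
  proof -
    define U V where "U = T (Suc k) p" and "V = T k p"
    obtain i where i: "mix_tail i U" "e p - (1/4)^Suc k \<le> G i p" "q U p \<le> e p + (1/4)^Suc k"
      using PT[of "Suc k" p] unfolding P_def U_def by blast
    obtain j where j: "mix_tail j V" "e p - (1/4)^k \<le> G j p" "q V p \<le> e p + (1/4)^k"
      using PT[of k p] unfolding P_def V_def by blast
    have le: "(1/4::real)^Suc k \<le> (1/4)^k" by simp
    \<comment> \<open>The midpoint still belongs to the earlier of the two tails, so its square norm
      is at least the infimum over that tail.\<close>
    have mid: "e p - (1/4)^k \<le> q (Mid U V) p"
    proof -
      have "e p - (1/4)^k \<le> G (min i j) p"
        using order_trans[OF diff_left_mono[OF le] i(2)] j(2) by (cases "i \<le> j") (auto simp: min_def)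
      also have "\<dots> \<le> q (Mid U V) p"
        by (rule Gle) (use i(1) j(1) in \<open>auto intro: mix_tail_mono\<close>)
      finally show ?thesis .
    qed
    \<comment> \<open>Parallelogram law: twice the two nearly minimal norms less four times the norm
      of the midpoint leaves only error terms, together at most \<open>8 * (1/4)^k\<close>.\<close>
    have "(s (Suc k) p x - s k p x)\<^sup>2 = 2 * (w U p x)\<^sup>2 + 2 * (w V p x)\<^sup>2 - 4 * (w (Mid U V) p x)\<^sup>2" for x
      by (simp add: s_def U_def V_def w_Mid power2_eq_square field_simps)
    then have "(\<integral>x. (s (Suc k) p x - s k p x)\<^sup>2 \<partial>M) = 2 * q U p + 2 * q V p - 4 * q (Mid U V) p"
      using int2[OF p] by (simp add: q_def)
    then show ?thesis using i(3) j(3) mid le by linarith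
  qed
  \<comment> \<open>Clamping keeps the bound 1 also at points where the sequence diverges and
    \<open>lim\<close> is arbitrary; where it converges, nothing changes.\<close>
  define g where "g p x = max (-1) (min 1 (lim (\<lambda>k. s k p x)))" for p x
  have "(\<lambda>(p, x). g p x) \<in> borel_measurable (N \<Otimes>\<^sub>M M)"
    unfolding g_def case_prod_beta'
    by (intro borel_measurable_max borel_measurable_min borel_measurable_lim_metric borel_measurable_const)
       (use sm in \<open>simp add: case_prod_beta'\<close>)
  moreover have "\<bar>g p x\<bar> \<le> 1" for p x
    by (auto simp: g_def)
  moreover have "AE x in M. (\<lambda>k. mix_eval (\<lambda>n. h n p x) (T k p)) \<longlonglongrightarrow> g p x" if p: "p \<in> space N" for p
  proof -
    have "AE x in M. convergent (\<lambda>k. s k p x)"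
      by (rule AE_convergent_of_square_bounds[where B=1 and C=8])
        (use near p wb wmx in \<open>auto simp: s_def intro: finite_measure_axioms\<close>)
    then show ?thesis
    proof eventually_elim
      case (elim x)
      then have lim: "(\<lambda>k. s k p x) \<longlonglongrightarrow> lim (\<lambda>k. s k p x)"
        by (simp add: convergent_LIMSEQ_iff)
      have sb: "\<bar>s k p x\<bar> \<le> 1" for k by (simp add: s_def wb)
      have "lim (\<lambda>k. s k p x) \<le> 1"
        by (rule LIMSEQ_le_const2[OF lim]) (use sb in \<open>auto simp: abs_le_iff\<close>)
      moreover have "-1 \<le> lim (\<lambda>k. s k p x)"
      proof (rule LIMSEQ_le_const[OF lim])
        show "\<exists>N. \<forall>n\<ge>N. - 1 \<le> s n p x" using sb by (metis abs_le_D2 minus_le_iff)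
      qed
      ultimately have "g p x = lim (\<lambda>k. s k p x)" by (simp add: g_def)
      then show ?case using lim by (simp add: s_def w_def)
    qed
  qed
  ultimately show thesis
    using T_tail that by blast
qed

section \<open>Bounded solutions from an a priori estimate\<close>

definition function_space :: "('a \<Rightarrow> real) set \<Rightarrow> bool" where
  "function_space V \<longleftrightarrow> (\<lambda>x. 0) \<in> V \<and> (\<forall>f\<in>V. \<forall>g\<in>V. (\<lambda>x. f x + g x) \<in> V) \<and>
     (\<forall>f\<in>V. \<forall>a. (\<lambda>x. a * f x) \<in> V)"

text \<open>Homogeneity is demanded only as an inequality, which is easier to verify for infima;
  applying it to \<open>inverse a\<close> as well gives the equality in
  \<open>sublinear_on_scale\<close>.\<close>

definition sublinear_on :: "('a \<Rightarrow> real) set \<Rightarrow> (('a \<Rightarrow> real) \<Rightarrow> real) \<Rightarrow> bool" where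
  "sublinear_on V p \<longleftrightarrow> p (\<lambda>x. 0) = 0 \<and> (\<forall>f\<in>V. \<forall>g\<in>V. p (\<lambda>x. f x + g x) \<le> p f + p g) \<and>
     (\<forall>f\<in>V. \<forall>a>0. p (\<lambda>x. a * f x) \<le> a * p f)"

lemma sublinear_on_scale:
  assumes V: "function_space V" and p: "sublinear_on V p" and f: "f \<in> V" and a: "0 \<le> a"
  shows "p (\<lambda>x. a * f x) = a * p f"
proof (cases "a = 0")
  case True
  then show ?thesis using p by (simp add: sublinear_on_def)
next
  case False
  then have a: "0 < a" using assms by simp
  have "(\<lambda>x. a * f x) \<in> V" using V f by (simp add: function_space_def)
  then have "p (\<lambda>x. inverse a * (a * f x)) \<le> inverse a * p (\<lambda>x. a * f x)"
    using p a unfolding sublinear_on_def by (metis positive_imp_inverse_positive)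
  moreover have "(\<lambda>x. inverse a * (a * f x)) = f" using a by (auto simp: field_simps)
  ultimately have "a * p f \<le> p (\<lambda>x. a * f x)" using a by (simp add: field_simps)
  moreover have "p (\<lambda>x. a * f x) \<le> a * p f" using p f a by (simp add: sublinear_on_def)
  ultimately show ?thesis by simp
qed

text \<open>Subadditivity, applied to a sum in which one function cancels. The resulting lower
  bounds are what keeps the infima below finite.\<close>

lemma sublinear_on_lower:
  assumes V: "function_space V" and p: "sublinear_on V p" and f: "f \<in> V" and g: "g \<in> V"
  shows "- p (\<lambda>x. - f x) \<le> p f" and "p f - p (\<lambda>x. - g x) \<le> p (\<lambda>x. f x + g x)"
proof -
  have neg: "(\<lambda>x. - h x) \<in> V" if "h \<in> V" for h
    using V that unfolding function_space_def by (metis (no_types, lifting) ext mult_minus1)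
  have padd: "p (\<lambda>x. h x + k x) \<le> p h + p k" if "h \<in> V" "k \<in> V" for h k
    using p that by (simp add: sublinear_on_def)
  have "p (\<lambda>x. f x + - f x) \<le> p f + p (\<lambda>x. - f x)"
    by (rule padd[OF f neg[OF f]])
  then show "- p (\<lambda>x. - f x) \<le> p f" using p by (simp add: sublinear_on_def)
  have "(\<lambda>x. f x + g x) \<in> V" using V f g by (simp add: function_space_def)
  then have "p (\<lambda>x. (f x + g x) + - g x) \<le> p (\<lambda>x. f x + g x) + p (\<lambda>x. - g x)"
    by (rule padd[OF _ neg[OF g]])
  then show "p f - p (\<lambda>x. - g x) \<le> p (\<lambda>x. f x + g x)" by simp
qed

text \<open>A functional that is minimal among the sublinear ones below \<open>p\<close> is linear: lowering it along
  any direction must leave it unchanged.\<close>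

lemma linear_below_sublinear:
  assumes V: "function_space V" and p: "sublinear_on V p"
  obtains F where "\<And>f g. f \<in> V \<Longrightarrow> g \<in> V \<Longrightarrow> F (\<lambda>x. f x + g x) = F f + F g"
    and "\<And>f a. f \<in> V \<Longrightarrow> F (\<lambda>x. a * f x) = a * F f"
    and "\<And>f. f \<in> V \<Longrightarrow> F f \<le> (p f :: real)"
proof -
  have V0: "(\<lambda>x. 0) \<in> V" and Vadd: "\<And>f g. f \<in> V \<Longrightarrow> g \<in> V \<Longrightarrow> (\<lambda>x. f x + g x) \<in> V"
    and Vsc: "\<And>f a. f \<in> V \<Longrightarrow> (\<lambda>x. a * f x) \<in> V"
    using V by (auto simp: function_space_def)
  have Vneg: "(\<lambda>x. - f x) \<in> V" if "f \<in> V" for f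
    using Vsc[OF that, of "-1"] by simp
  \<comment> \<open>Fixing the value 0 off \<open>V\<close> reduces every comparison in the
    pointwise order to \<open>V\<close> and keeps infima of chains finite elsewhere.\<close>
  define A where "A = {q. sublinear_on V q \<and> (\<forall>f\<in>V. q f \<le> p f) \<and> (\<forall>f. f \<notin> V \<longrightarrow> q f = 0)}"
  have A_low: "- p (\<lambda>x. - f x) \<le> q f" if "q \<in> A" "f \<in> V" for q f
  proof -
    have "- q (\<lambda>x. - f x) \<le> q f"
      using sublinear_on_lower(1)[OF V _ that(2) that(2)] that by (simp add: A_def)
    moreover have "q (\<lambda>x. - f x) \<le> p (\<lambda>x. - f x)" using that Vneg by (simp add: A_def)
    ultimately show ?thesis by linarith
  qed
  \<comment> \<open>The order is reversed, so that the maximal element supplied by Zorn's lemma is a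
    minimal functional.\<close>
  define P where "P q r \<longleftrightarrow> (\<forall>f. (r::('a \<Rightarrow> real) \<Rightarrow> real) f \<le> q f)" for q r
  have "\<exists>m\<in>A. \<forall>q\<in>A. P m q \<longrightarrow> q = m"
  proof (rule predicate_Zorn)
    show "partial_order_on A (relation_of P A)"
      by (rule partial_order_on_relation_ofI) (auto simp: P_def intro: order_trans intro!: ext antisym)
    fix C assume C: "C \<in> Chains (relation_of P A)"
    then have CA: "C \<subseteq> A" and chain: "\<And>q r. q \<in> C \<Longrightarrow> r \<in> C \<Longrightarrow> P q r \<or> P r q"
      by (auto simp: Chains_def relation_of_def)
    show "\<exists>u\<in>A. \<forall>q\<in>C. P q u"
    proof (cases "C = {}")
      case True
      have "(\<lambda>f. if f \<in> V then p f else 0) \<in> A"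
        using p V0 Vadd Vsc by (auto simp: A_def sublinear_on_def)
      then show ?thesis using True by blast
    next
      case False
      define u where "u f = (INF q\<in>C. q f)" for f
      have bdd: "bdd_below ((\<lambda>q. q f) ` C)" for f
      proof (cases "f \<in> V")
        case True
        then show ?thesis
          by (intro bdd_belowI[of _ "- p (\<lambda>x. - f x)"]) (use CA A_low in auto)
      next
        case nV: False
        then show ?thesis using CA by (intro bdd_belowI[of _ 0]) (auto simp: A_def)
      qed
      have ule: "u f \<le> q f" if "q \<in> C" for q f
        unfolding u_def by (intro cINF_lower bdd that)
      have uge: "c \<le> u f" if "\<And>q. q \<in> C \<Longrightarrow> c \<le> q f" for c f
        unfolding u_def by (intro cINF_greatest False that)
      have const: "u f = c" if "\<And>q. q \<in> C \<Longrightarrow> q f = c" for f c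
      proof -
        obtain q where "q \<in> C" using False by blast
        then have "u f \<le> c" using ule[of q f] that by simp
        moreover have "c \<le> u f" by (rule uge) (use that in simp)
        ultimately show ?thesis by simp
      qed
      have "u \<in> A"
        unfolding A_def sublinear_on_def mem_Collect_eq
      proof (intro conjI ballI allI impI)
        show "u (\<lambda>x. 0) = 0" by (rule const) (use CA in \<open>auto simp: A_def sublinear_on_def\<close>)
        show "u f = 0" if "f \<notin> V" for f by (rule const) (use CA that in \<open>auto simp: A_def\<close>)
        fix f assume f: "f \<in> V"
        obtain q where "q \<in> C" using False by blast
        then show "u f \<le> p f" using ule[of q f] CA f by (force simp: A_def)
        fix g assume g: "g \<in> V"
        \<comment> \<open>Two different functionals bound the two summands; the smaller of them,
          which exists in a chain, may serve for both.\<close>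
        have "u (\<lambda>x. f x + g x) \<le> q f + r g" if q: "q \<in> C" and r: "r \<in> C" for q r
        proof -
          have *: "s (\<lambda>x. f x + g x) \<le> s f + s g" if "s \<in> C" for s
            using CA that f g by (auto simp: A_def sublinear_on_def)
          consider "P q r" | "P r q" using chain[OF q r] by blast
          then show ?thesis
          proof cases
            case 1
            then have "r f \<le> q f" by (simp add: P_def)
            then show ?thesis using *[OF r] ule[OF r, of "\<lambda>x. f x + g x"] by linarith
          next
            case 2
            then have "q g \<le> r g" by (simp add: P_def)
            then show ?thesis using *[OF q] ule[OF q, of "\<lambda>x. f x + g x"] by linarith
          qed
        qed
        then have "u (\<lambda>x. f x + g x) - r g \<le> u f" if "r \<in> C" for r
          using that by (intro uge) (force simp: field_simps)
        then have "u (\<lambda>x. f x + g x) - u f \<le> u g"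
          by (intro uge) (force simp: field_simps)
        then show "u (\<lambda>x. f x + g x) \<le> u f + u g" by simp
      next
        fix f and a :: real assume f: "f \<in> V" and a: "0 < a"
        have "u (\<lambda>x. a * f x) / a \<le> u f"
        proof (rule uge)
          fix q assume q: "q \<in> C"
          have "u (\<lambda>x. a * f x) \<le> a * q f"
            using ule[OF q, of "\<lambda>x. a * f x"] q CA f a by (force simp: A_def sublinear_on_def)
          then show "u (\<lambda>x. a * f x) / a \<le> q f" using a by (simp add: field_simps)
        qed
        then show "u (\<lambda>x. a * f x) \<le> a * u f" using a by (simp add: field_simps)
      qed
      moreover have "\<forall>q\<in>C. P q u" using ule by (simp add: P_def)
      ultimately show ?thesis by blast
    qed
  qed
  then obtain m where mA: "m \<in> A" and min: "\<And>q. q \<in> A \<Longrightarrow> P m q \<Longrightarrow> q = m" by blast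
  have m: "sublinear_on V m" using mA by (simp add: A_def)
  have madd: "m (\<lambda>x. f x + g x) \<le> m f + m g" if "f \<in> V" "g \<in> V" for f g
    using m that by (simp add: sublinear_on_def)
  note msc = sublinear_on_scale[OF V m]
  have mneg: "m (\<lambda>x. - y x) = - m y" if y: "y \<in> V" for y
  proof -
    \<comment> \<open>The result of lowering \<open>m\<close> along \<open>y\<close>. It is
      sublinear and below \<open>m\<close>, and \<open>t = 1\<close> bounds its value at the
      negative of \<open>y\<close> by \<open>- m y\<close>. Minimality turns this into a bound for
      \<open>m\<close> itself.\<close>
    define w where "w f = (if f \<in> V then INF t\<in>{0..}. m (\<lambda>x. f x + t * y x) - t * m y else 0)" for f
    have low: "- m (\<lambda>x. - f x) \<le> m (\<lambda>x. f x + t * y x) - t * m y" if "f \<in> V" "0 \<le> t" for f t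
    proof -
      have "m (\<lambda>x. t * y x) - m (\<lambda>x. - f x) \<le> m (\<lambda>x. t * y x + f x)"
        by (rule sublinear_on_lower(2)[OF V m Vsc[OF y] that(1)])
      then show ?thesis using msc[OF y that(2)] by (simp add: add.commute)
    qed
    have wle: "w f \<le> m (\<lambda>x. f x + t * y x) - t * m y" if "f \<in> V" "0 \<le> t" for f t
    proof -
      have "bdd_below ((\<lambda>t. m (\<lambda>x. f x + t * y x) - t * m y) ` {0..})"
        by (rule bdd_belowI[of _ "- m (\<lambda>x. - f x)"]) (use low[OF that(1)] in auto)
      then show ?thesis using that unfolding w_def by (auto intro: cINF_lower)
    qed
    have wge: "c \<le> w f" if "f \<in> V" "\<And>t. 0 \<le> t \<Longrightarrow> c \<le> m (\<lambda>x. f x + t * y x) - t * m y" for f c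
      using that unfolding w_def by (auto intro!: cINF_greatest)
    have wm: "w f \<le> m f" if "f \<in> V" for f using wle[OF that, of 0] by simp
    have "w \<in> A"
      unfolding A_def sublinear_on_def mem_Collect_eq
    proof (intro conjI ballI allI impI)
      show "w f = 0" if "f \<notin> V" for f using that by (simp add: w_def)
      have "0 \<le> w (\<lambda>x. 0)"
        by (rule wge[OF V0]) (use msc[OF y] in simp)
      then show "w (\<lambda>x. 0) = 0" using wm[OF V0] m by (simp add: sublinear_on_def)
      fix f assume f: "f \<in> V"
      show "w f \<le> p f" using wm[OF f] mA f by (force simp: A_def)
      fix g assume g: "g \<in> V"
      have "w (\<lambda>x. f x + g x) \<le> (m (\<lambda>x. f x + t * y x) - t * m y) + (m (\<lambda>x. g x + s * y x) - s * m y)"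
        if "0 \<le> t" "0 \<le> s" for s t
      proof -
        have "w (\<lambda>x. f x + g x) \<le> m (\<lambda>x. (f x + g x) + (t + s) * y x) - (t + s) * m y"
          using that by (intro wle Vadd f g) auto
        also have "(\<lambda>x. (f x + g x) + (t + s) * y x) = (\<lambda>x. (f x + t * y x) + (g x + s * y x))"
          by (auto simp: algebra_simps)
        also have "m \<dots> \<le> m (\<lambda>x. f x + t * y x) + m (\<lambda>x. g x + s * y x)"
          by (intro madd Vadd f g Vsc y)
        finally show ?thesis by (simp add: algebra_simps)
      qed
      then have "w (\<lambda>x. f x + g x) - (m (\<lambda>x. g x + s * y x) - s * m y) \<le> w f" if "0 \<le> s" for s
        using that by (intro wge f) (force simp: field_simps)
      then have "w (\<lambda>x. f x + g x) - w f \<le> w g"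
        by (intro wge g) (force simp: field_simps)
      then show "w (\<lambda>x. f x + g x) \<le> w f + w g" by simp
    next
      fix f and a :: real assume f: "f \<in> V" and a: "0 < a"
      have "w (\<lambda>x. a * f x) / a \<le> w f"
      proof (rule wge[OF f])
        fix t :: real assume t: "0 \<le> t"
        have "w (\<lambda>x. a * f x) \<le> m (\<lambda>x. a * f x + (a * t) * y x) - (a * t) * m y"
          using a t by (intro wle Vsc f) auto
        also have "(\<lambda>x. a * f x + (a * t) * y x) = (\<lambda>x. a * (f x + t * y x))"
          by (auto simp: algebra_simps)
        also have "m \<dots> = a * m (\<lambda>x. f x + t * y x)"
          using a by (intro msc Vadd Vsc f y) auto
        finally show "w (\<lambda>x. a * f x) / a \<le> m (\<lambda>x. f x + t * y x) - t * m y"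
          using a by (simp add: field_simps)
      qed
      then show "w (\<lambda>x. a * f x) \<le> a * w f" using a by (simp add: field_simps)
    qed
    moreover have "P m w"
      unfolding P_def
    proof
      fix f show "w f \<le> m f"
        using wm[of f] mA by (cases "f \<in> V") (auto simp: w_def A_def)
    qed
    ultimately have "w = m" by (rule min)
    then have "m (\<lambda>x. - y x) \<le> m (\<lambda>x. - y x + 1 * y x) - 1 * m y"
      using wle[OF Vneg[OF y], of 1] by simp
    also have "(\<lambda>x. - y x + 1 * y x) = (\<lambda>x. 0)" by simp
    finally have "m (\<lambda>x. - y x) \<le> - m y" using m by (simp add: sublinear_on_def)
    then show ?thesis using sublinear_on_lower(1)[OF V m y y] by simp
  qed
  show thesis
  proof (rule that[of m])
    show "m (\<lambda>x. f x + g x) = m f + m g" if f: "f \<in> V" and g: "g \<in> V" for f g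
      using sublinear_on_lower(2)[OF V m f g] mneg[OF g] madd[OF f g] by simp
    show "m f \<le> p f" if "f \<in> V" for f using mA that by (simp add: A_def)
    show "m (\<lambda>x. a * f x) = a * m f" if f: "f \<in> V" for f a
    proof (cases "0 \<le> a")
      case True
      then show ?thesis by (rule msc[OF f])
    next
      case False
      then have "m (\<lambda>x. - a * f x) = - a * m f" by (intro msc[OF f]) simp
      then show ?thesis using mneg[OF Vsc[OF f], of a] by simp
    qed
  qed
qed

text \<open>The functional to be extended is given by its graph, since it will be indexed by test
  functions and different ones may share the same \<open>h\<close>. The infimum \<open>w\<close>
  builds the prescribed values into the bound: a linear functional below \<open>w\<close> satisfies
  \<open>c \<le> F h\<close> on \<open>L\<close>, and the reverse inequality comes from the opposite
  pair.\<close>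

lemma hahn_banach_extension:
  assumes V: "function_space V" and p: "sublinear_on V p"
    and LV: "\<And>h c. (h, c) \<in> L \<Longrightarrow> h \<in> V"
    and Lp: "\<And>h c. (h, c) \<in> L \<Longrightarrow> c \<le> (p h :: real)"
    and L0: "(\<lambda>x. 0, 0) \<in> L"
    and Ladd: "\<And>h c k d. (h, c) \<in> L \<Longrightarrow> (k, d) \<in> L \<Longrightarrow> (\<lambda>x. h x + k x, c + d) \<in> L"
    and Lsc: "\<And>h c a. (h, c) \<in> L \<Longrightarrow> (\<lambda>x. a * h x, a * c) \<in> L"
  obtains F where "\<And>f g. f \<in> V \<Longrightarrow> g \<in> V \<Longrightarrow> F (\<lambda>x. f x + g x) = F f + F g"
    and "\<And>f a. f \<in> V \<Longrightarrow> F (\<lambda>x. a * f x) = a * F f"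
    and "\<And>f. f \<in> V \<Longrightarrow> F f \<le> (p f :: real)"
    and "\<And>h c. (h, c) \<in> L \<Longrightarrow> F h = c"
proof -
  have V0: "(\<lambda>x. 0) \<in> V" and Vadd: "\<And>f g. f \<in> V \<Longrightarrow> g \<in> V \<Longrightarrow> (\<lambda>x. f x + g x) \<in> V"
    and Vsc: "\<And>f a. f \<in> V \<Longrightarrow> (\<lambda>x. a * f x) \<in> V"
    using V by (auto simp: function_space_def)
  define w where "w f = (INF (h, c)\<in>L. p (\<lambda>x. f x + h x) - c)" for f
  have Vneg: "(\<lambda>x. - f x) \<in> V" if "f \<in> V" for f
    using Vsc[OF that, of "-1"] by simp
  have low: "- p (\<lambda>x. - f x) \<le> p (\<lambda>x. f x + h x) - c" if "f \<in> V" "(h, c) \<in> L" for f h c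
    using sublinear_on_lower(2)[OF V p LV[OF that(2)] that(1)] Lp[OF that(2)]
    by (simp add: add.commute)
  have wle: "w f \<le> p (\<lambda>x. f x + h x) - c" if "f \<in> V" "(h, c) \<in> L" for f h c
  proof -
    have "bdd_below ((\<lambda>(h, c). p (\<lambda>x. f x + h x) - c) ` L)"
      by (rule bdd_belowI[of _ "- p (\<lambda>x. - f x)"]) (use low[OF that(1)] in auto)
    from cINF_lower[OF this that(2)] show ?thesis by (simp add: w_def)
  qed
  have wge: "b \<le> w f" if "\<And>h c. (h, c) \<in> L \<Longrightarrow> b \<le> p (\<lambda>x. f x + h x) - c" for f b
    using that L0 unfolding w_def by (intro cINF_greatest) auto
  have wp: "w f \<le> p f" if "f \<in> V" for f using wle[OF that L0] by simp
  have "sublinear_on V w"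
    unfolding sublinear_on_def
  proof (intro conjI ballI allI impI)
    have "0 \<le> w (\<lambda>x. 0)" by (rule wge) (use Lp in simp)
    then show "w (\<lambda>x. 0) = 0" using wp[OF V0] p by (simp add: sublinear_on_def)
    fix f g assume f: "f \<in> V" and g: "g \<in> V"
    have "w (\<lambda>x. f x + g x) \<le> (p (\<lambda>x. f x + h x) - c) + (p (\<lambda>x. g x + k x) - d)"
      if "(h, c) \<in> L" "(k, d) \<in> L" for h c k d
    proof -
      have "w (\<lambda>x. f x + g x) \<le> p (\<lambda>x. (f x + g x) + (h x + k x)) - (c + d)"
        by (intro wle Vadd f g Ladd that)
      also have "(\<lambda>x. (f x + g x) + (h x + k x)) = (\<lambda>x. (f x + h x) + (g x + k x))"
        by (auto simp: algebra_simps)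
      also have "p \<dots> \<le> p (\<lambda>x. f x + h x) + p (\<lambda>x. g x + k x)"
        using p Vadd[OF f LV[OF that(1)]] Vadd[OF g LV[OF that(2)]] by (simp add: sublinear_on_def)
      finally show ?thesis by simp
    qed
    then have "w (\<lambda>x. f x + g x) - (p (\<lambda>x. g x + k x) - d) \<le> w f" if "(k, d) \<in> L" for k d
      using that by (intro wge) (force simp: field_simps)
    then have "w (\<lambda>x. f x + g x) - w f \<le> w g"
      by (intro wge) (force simp: field_simps)
    then show "w (\<lambda>x. f x + g x) \<le> w f + w g" by simp
  next
    fix f and a :: real assume f: "f \<in> V" and a: "0 < a"
    have "w (\<lambda>x. a * f x) / a \<le> w f"
    proof (rule wge)
      fix h c assume hc: "(h, c) \<in> L"
      have "w (\<lambda>x. a * f x) \<le> p (\<lambda>x. a * f x + a * h x) - a * c"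
        by (intro wle Vsc f Lsc hc)
      also have "(\<lambda>x. a * f x + a * h x) = (\<lambda>x. a * (f x + h x))"
        by (auto simp: algebra_simps)
      also have "p \<dots> = a * p (\<lambda>x. f x + h x)"
        using a by (intro sublinear_on_scale[OF V p] Vadd f LV[OF hc]) auto
      finally show "w (\<lambda>x. a * f x) / a \<le> p (\<lambda>x. f x + h x) - c"
        using a by (simp add: field_simps)
    qed
    then show "w (\<lambda>x. a * f x) \<le> a * w f" using a by (simp add: field_simps)
  qed
  from linear_below_sublinear[OF V this] obtain F
    where F: "\<And>f g. f \<in> V \<Longrightarrow> g \<in> V \<Longrightarrow> F (\<lambda>x. f x + g x) = F f + F g"
      "\<And>f a. f \<in> V \<Longrightarrow> F (\<lambda>x. a * f x) = a * F f" "\<And>f. f \<in> V \<Longrightarrow> F f \<le> w f"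
    by blast
  have ge: "c \<le> F h" if "(h, c) \<in> L" for h c
  proof -
    have "F (\<lambda>x. - 1 * h x) \<le> p (\<lambda>x. - 1 * h x + h x) - c"
      using F(3)[OF Vsc[OF LV[OF that]], of "-1"] wle[OF Vsc[OF LV[OF that]] that, of "-1"] by linarith
    then show ?thesis using F(2)[OF LV[OF that], of "-1"] p by (simp add: sublinear_on_def)
  qed
  show thesis
  proof (rule that[OF F(1,2)])
    show "F f \<le> p f" if "f \<in> V" for f using F(3)[OF that] wp[OF that] by linarith
    show "F h = c" if "(h, c) \<in> L" for h c
      using ge[OF that] ge[OF Lsc[OF that, of "-1"]] F(2)[OF LV[OF that], of "-1"] by simp
  qed
qed

section \<open>Bounded functionals on integrable functions\<close>

lemma function_space_integrable: "function_space {f. integrable M f}"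
  by (auto simp: function_space_def)

text \<open>Adding the measure itself to \<open>F\<close> on indicators gives a nonnegative set
  function, so the Radon-Nikodym theorem for positive measures applies; subtracting 1 from the
  density undoes the shift. The formula passes from indicators to all integrable functions because
  both sides are continuous along dominated sequences.\<close>

lemma (in finite_measure) L1_functional_representation:
  fixes F :: "('a \<Rightarrow> real) \<Rightarrow> real"
  assumes add: "\<And>f g. integrable M f \<Longrightarrow> integrable M g \<Longrightarrow> F (\<lambda>x. f x + g x) = F f + F g"
    and scale: "\<And>f a. integrable M f \<Longrightarrow> F (\<lambda>x. a * f x) = a * F f"
    and bound: "\<And>f. integrable M f \<Longrightarrow> F f \<le> (\<integral>x. \<bar>f x\<bar> \<partial>M)"
  obtains \<rho> where "\<rho> \<in> borel_measurable M" and "\<And>x. \<bar>\<rho> x\<bar> \<le> 1"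
    and "\<And>f. integrable M f \<Longrightarrow> F f = (\<integral>x. \<rho> x * f x \<partial>M)"
proof -
  have abs: "\<bar>F f\<bar> \<le> (\<integral>x. \<bar>f x\<bar> \<partial>M)" if "integrable M f" for f
    using bound[OF that] bound[of "\<lambda>x. - 1 * f x"] scale[OF that, of "-1"] that by (simp add: abs_le_iff)
  have int_ind: "integrable M (indicator A :: 'a \<Rightarrow> real)" if "A \<in> sets M" for A
    using that by (simp add: emeasure_finite less_top[symmetric])
  have int_indA: "(\<integral>x. \<bar>indicator A x :: real\<bar> \<partial>M) = measure M A" if "A \<in> sets M" for A
    using that sets.sets_into_space[OF that] by (simp add: Int_absorb2)
  define v where "v A = F (indicator A) + measure M A" for A
  have v0: "0 \<le> v A" and v2: "v A \<le> 2 * measure M A" if "A \<in> sets M" for A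
    using abs[OF int_ind[OF that]] int_indA[OF that] by (auto simp: v_def)
  have v_add: "v (A \<union> B) = v A + v B" if A: "A \<in> sets M" and B: "B \<in> sets M" and AB: "A \<inter> B = {}" for A B
  proof -
    have "(indicator (A \<union> B) :: 'a \<Rightarrow> real) = (\<lambda>x. indicator A x + indicator B x)"
      using AB by (auto simp: fun_eq_iff split: split_indicator)
    then have "F (indicator (A \<union> B)) = F (indicator A) + F (indicator B)"
      using add[OF int_ind[OF A] int_ind[OF B]] by simp
    then show ?thesis
      using finite_measure_Union[OF A B AB] by (simp add: v_def)
  qed
  define N where "N = measure_of (space M) (sets M) (\<lambda>A. ennreal (v A))"
  have pos: "positive (sets M) (\<lambda>A. ennreal (v A))"
    using v0[of "{}"] v2[of "{}"] by (simp add: positive_def)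
  \<comment> \<open>Continuity at the empty set follows from
    \<open>v A \<le> 2 * measure M A\<close>, so countable additivity is inherited from
    \<open>M\<close>.\<close>
  have ca: "countably_additive (sets M) (\<lambda>A. ennreal (v A))"
  proof (rule sets.empty_continuous_imp_countably_additive[OF pos])
    show "additive (sets M) (\<lambda>A. ennreal (v A))"
      using v_add v0 by (auto simp: additive_def)
    fix A :: "nat \<Rightarrow> 'a set" assume A: "range A \<subseteq> sets M" "decseq A" "(\<Inter>i. A i) = {}"
    have "(\<lambda>i. measure M (A i)) \<longlonglongrightarrow> measure M (\<Inter>i. A i)"
      by (rule finite_Lim_measure_decseq[OF A(1,2)])
    then have "(\<lambda>i. 2 * measure M (A i)) \<longlonglongrightarrow> 0"
      using A(3) by (auto intro!: tendsto_eq_intros)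
    then have "(\<lambda>i. v (A i)) \<longlonglongrightarrow> 0"
      by (rule tendsto_sandwich[OF _ _ tendsto_const, rotated 2])
        (use A(1) v0 v2 in \<open>auto intro!: always_eventually\<close>)
    then show "(\<lambda>i. ennreal (v (A i))) \<longlonglongrightarrow> 0"
      using tendsto_ennrealI by force
  qed auto
  have eN: "emeasure N A = ennreal (v A)" if "A \<in> sets M" for A
    unfolding N_def by (rule emeasure_measure_of_sigma[OF sets.sigma_algebra_axioms pos ca that])
  have sN[simp]: "sets N = sets M" unfolding N_def by simp
  have "absolutely_continuous M N"
    unfolding absolutely_continuous_def
  proof
    fix A assume "A \<in> null_sets M"
    then have "A \<in> sets M" "measure M A = 0" by (auto simp: measure_eq_0_null_sets)
    then show "A \<in> null_sets N" using v0[of A] v2[of A] eN[of A] by (simp add: null_sets_def)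
  qed
  from Radon_Nikodym[OF this sN] obtain d where d[measurable]: "d \<in> borel_measurable M"
    and dN: "density M d = N" by blast
  have dA: "(\<integral>\<^sup>+x. d x * indicator A x \<partial>M) = ennreal (v A)" if "A \<in> sets M" for A
    using emeasure_density[OF d that] eN[OF that] dN by simp
  have "(\<integral>\<^sup>+x. d x \<partial>M) = (\<integral>\<^sup>+x. d x * indicator (space M) x \<partial>M)"
    by (intro nn_integral_cong) (auto split: split_indicator)
  then have "(\<integral>\<^sup>+x. d x \<partial>M) \<noteq> \<infinity>" using dA[of "space M"] by simp
  from nn_integral_PInf_AE[OF d this] have dfin: "AE x in M. d x \<noteq> \<infinity>" .
  have dr: "has_bochner_integral M (\<lambda>x. enn2real (d x) * indicator A x) (v A)" if A: "A \<in> sets M" for A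
  proof (rule has_bochner_integral_nn_integral)
    have "(\<integral>\<^sup>+x. ennreal (enn2real (d x) * indicator A x) \<partial>M) = (\<integral>\<^sup>+x. d x * indicator A x \<partial>M)"
      using dfin by (intro nn_integral_cong_AE) (auto simp: ennreal_mult'' less_top split: split_indicator)
    then show "(\<integral>\<^sup>+x. ennreal (enn2real (d x) * indicator A x) \<partial>M) = ennreal (v A)"
      using dA[OF A] by simp
  qed (use A v0 in auto)
  define g where "g x = enn2real (d x) - 1" for x
  have [measurable]: "g \<in> borel_measurable M" unfolding g_def by measurable
  have "integrable M (\<lambda>x. enn2real (d x) * indicator (space M) x)"
    using dr[of "space M"] by (auto simp: has_bochner_integral_iff)
  then have "integrable M (\<lambda>x. enn2real (d x))"
    by (rule Bochner_Integration.integrable_cong[THEN iffD1, rotated -1]) auto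
  then have gi: "integrable M g" unfolding g_def by simp
  have gA: "(\<integral>x. g x * indicator A x \<partial>M) = F (indicator A)" if A: "A \<in> sets M" for A
  proof -
    have "(\<integral>x. g x * indicator A x \<partial>M) = (\<integral>x. enn2real (d x) * indicator A x - indicator A x \<partial>M)"
      by (simp add: g_def algebra_simps)
    also have "\<dots> = v A - measure M A"
      using dr[OF A] int_ind[OF A] A sets.sets_into_space[OF A]
      by (subst Bochner_Integration.integral_diff) (auto simp: has_bochner_integral_iff Int_absorb2)
    finally show ?thesis by (simp add: v_def)
  qed
  have gle: "\<bar>\<integral>x. g x * indicator A x \<partial>M\<bar> \<le> measure M A" if A: "A \<in> sets M" for A
    using gA[OF A] abs[OF int_ind[OF A]] int_indA[OF A] by simp
  have "AE x in M. 0 \<le> 1 - g x"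
  proof (rule density_nonneg)
    fix A assume A: "A \<in> sets M"
    have "(LINT x:A|M. 1 - g x) = (\<integral>x. indicator A x - g x * indicator A x \<partial>M)"
      by (simp add: set_lebesgue_integral_def algebra_simps)
    also have "\<dots> = measure M A - (\<integral>x. g x * indicator A x \<partial>M)"
      using int_ind[OF A] integrable_mult_indicator[OF A gi] A sets.sets_into_space[OF A]
      by (subst Bochner_Integration.integral_diff) (auto simp: Int_absorb2 mult.commute)
    finally show "0 \<le> (LINT x:A|M. 1 - g x)" using gle[OF A] by linarith
  qed (use gi in simp)
  moreover have "AE x in M. 0 \<le> 1 + g x"
  proof (rule density_nonneg)
    fix A assume A: "A \<in> sets M"
    have "(LINT x:A|M. 1 + g x) = (\<integral>x. indicator A x + g x * indicator A x \<partial>M)"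
      by (simp add: set_lebesgue_integral_def algebra_simps)
    also have "\<dots> = measure M A + (\<integral>x. g x * indicator A x \<partial>M)"
      using int_ind[OF A] integrable_mult_indicator[OF A gi] A sets.sets_into_space[OF A]
      by (subst Bochner_Integration.integral_add) (auto simp: Int_absorb2 mult.commute)
    finally show "0 \<le> (LINT x:A|M. 1 + g x)" using gle[OF A] by linarith
  qed (use gi in simp)
  ultimately have g1: "AE x in M. max (-1) (min 1 (g x)) = g x" by eventually_elim auto
  \<comment> \<open>The density lies in [-1, 1] only almost everywhere; the truncation makes the
    bound hold at every point.\<close>
  define \<rho> where "\<rho> x = max (-1) (min 1 (g x))" for x
  have \<rho>m[measurable]: "\<rho> \<in> borel_measurable M" unfolding \<rho>_def by measurable
  have \<rho>1: "\<bar>\<rho> x\<bar> \<le> 1" for x by (auto simp: \<rho>_def)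
  have \<rho>A: "(\<integral>x. \<rho> x * indicator A x \<partial>M) = F (indicator A)" if A: "A \<in> sets M" for A
    unfolding gA[OF A, symmetric] using g1 A by (intro integral_cong_AE) (auto simp: \<rho>_def)
  have int\<rho>: "integrable M (\<lambda>x. \<rho> x * f x)" if "integrable M f" for f
  proof (rule Bochner_Integration.integrable_bound[OF that])
    show "AE x in M. norm (\<rho> x * f x) \<le> norm (f x)"
      using \<rho>1 by (auto simp: abs_mult mult_left_le_one_le)
  qed (use that in auto)
  have "F f = (\<integral>x. \<rho> x * f x \<partial>M)" if "integrable M f" for f
    using that
  proof induction
    case (base A c)
    have "F (\<lambda>x. c * indicator A x) = c * (\<integral>x. \<rho> x * indicator A x \<partial>M)"
      using scale[OF int_ind[OF base(1)]] \<rho>A[OF base(1)] by simp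
    then show ?case
      by (simp add: mult.commute mult.left_commute flip: integral_mult_right_zero)
  next
    case (add f g)
    then show ?case using assms(1)[of f g] int\<rho> by (simp add: distrib_left)
  next
    case (lim f s)
    have si: "integrable M (s i)" for i by (rule lim)
    have fi: "integrable M f" by (rule lim)
    have conv: "(\<lambda>i. s i x) \<longlonglongrightarrow> f x" if "x \<in> space M" for x
      using that by (rule lim)
    have dom: "\<bar>s i x\<bar> \<le> 2 * \<bar>f x\<bar>" if "x \<in> space M" for i x
      using lim that by (metis real_norm_def)
    have IH: "F (s i) = (\<integral>x. \<rho> x * s i x \<partial>M)" for i by (rule lim)
    have "(\<lambda>i. \<integral>x. \<bar>s i x - f x\<bar> \<partial>M) \<longlonglongrightarrow> (\<integral>x. 0 \<partial>M)"
    proof (rule integral_dominated_convergence[where w="\<lambda>x. 3 * \<bar>f x\<bar>"])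
      show "AE x in M. (\<lambda>i. \<bar>s i x - f x\<bar>) \<longlonglongrightarrow> 0"
        by (intro AE_I2 tendsto_rabs_zero LIM_zero conv)
      show "AE x in M. norm \<bar>s i x - f x\<bar> \<le> 3 * \<bar>f x\<bar>" for i
        using dom[of _ i] by (intro AE_I2) (force simp: abs_le_iff)
    qed (use si fi in auto)
    then have L1: "(\<lambda>i. \<integral>x. \<bar>s i x - f x\<bar> \<partial>M) \<longlonglongrightarrow> 0" by simp
    have "(\<lambda>i. F (s i) - F f) \<longlonglongrightarrow> 0"
    proof (rule Lim_null_comparison[OF _ L1])
      have "F (s i) - F f = F (\<lambda>x. s i x + - 1 * f x)" for i
        using assms(1)[OF si, of "\<lambda>x. - 1 * f x" i] scale[OF fi, of "-1"] fi by simp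
      then have "\<bar>F (s i) - F f\<bar> \<le> (\<integral>x. \<bar>s i x - f x\<bar> \<partial>M)" for i
        using abs[of "\<lambda>x. s i x + - 1 * f x"] si[of i] fi by simp
      then show "\<forall>\<^sub>F i in sequentially. norm (F (s i) - F f) \<le> (\<integral>x. \<bar>s i x - f x\<bar> \<partial>M)"
        by simp
    qed
    then have "(\<lambda>i. F (s i)) \<longlonglongrightarrow> F f" by (rule LIM_zero_cancel)
    moreover have "(\<lambda>i. (\<integral>x. \<rho> x * s i x \<partial>M)) \<longlonglongrightarrow> (\<integral>x. \<rho> x * f x \<partial>M)"
    proof (rule integral_dominated_convergence[where w="\<lambda>x. 2 * \<bar>f x\<bar>"])
      show "AE x in M. (\<lambda>i. \<rho> x * s i x) \<longlonglongrightarrow> \<rho> x * f x"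
        by (intro AE_I2 tendsto_mult tendsto_const conv)
      show "AE x in M. norm (\<rho> x * s i x) \<le> 2 * \<bar>f x\<bar>" for i
      proof (rule AE_I2)
        fix x assume "x \<in> space M"
        then have "\<bar>s i x\<bar> \<le> 2 * \<bar>f x\<bar>" using dom by simp
        moreover have "\<bar>\<rho> x\<bar> * \<bar>s i x\<bar> \<le> \<bar>s i x\<bar>" using \<rho>1 by (simp add: mult_left_le_one_le)
        ultimately show "norm (\<rho> x * s i x) \<le> 2 * \<bar>f x\<bar>" by (simp add: abs_mult)
      qed
    qed (use si fi int\<rho> in auto)
    ultimately show ?case using IH LIMSEQ_unique by simp
  qed
  then show thesis using that[OF \<rho>m \<rho>1] by blast
qed

text \<open>Existence by duality: \<open>L\<close> pairs an operator applied to a test function with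
  the prescribed boundary term, and the L1 estimate makes this assignment a functional of norm at
  most 1, whose representing function is the solution. A one-sided bound suffices because
  \<open>L\<close> contains the opposite pairs.\<close>

lemma (in finite_measure) bounded_solution_of_a_priori_estimate:
  fixes L :: "(('a \<Rightarrow> real) \<times> real) set"
  assumes int: "\<And>h c. (h, c) \<in> L \<Longrightarrow> integrable M h"
    and est: "\<And>h c. (h, c) \<in> L \<Longrightarrow> c \<le> (\<integral>x. \<bar>h x\<bar> \<partial>M)"
    and L0: "(\<lambda>x. 0, 0) \<in> L"
    and Ladd: "\<And>h c k d. (h, c) \<in> L \<Longrightarrow> (k, d) \<in> L \<Longrightarrow> (\<lambda>x. h x + k x, c + d) \<in> L"
    and Lsc: "\<And>h c a. (h, c) \<in> L \<Longrightarrow> (\<lambda>x. a * h x, a * c) \<in> L"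
  obtains \<rho> where "\<rho> \<in> borel_measurable M" and "\<And>x. \<bar>\<rho> x\<bar> \<le> 1"
    and "\<And>h c. (h, c) \<in> L \<Longrightarrow> (\<integral>x. \<rho> x * h x \<partial>M) = c"
proof -
  have sub: "sublinear_on {f. integrable M f} (\<lambda>f. \<integral>x. \<bar>f x\<bar> \<partial>M)"
    unfolding sublinear_on_def
  proof (intro conjI ballI allI impI; clarsimp simp: abs_mult)
    fix f g :: "'a \<Rightarrow> real" assume "integrable M f" "integrable M g"
    then have "(\<integral>x. \<bar>f x + g x\<bar> \<partial>M) \<le> (\<integral>x. \<bar>f x\<bar> + \<bar>g x\<bar> \<partial>M)"
      by (intro integral_mono) auto
    then show "(\<integral>x. \<bar>f x + g x\<bar> \<partial>M) \<le> (\<integral>x. \<bar>f x\<bar> \<partial>M) + (\<integral>x. \<bar>g x\<bar> \<partial>M)"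
      using \<open>integrable M f\<close> \<open>integrable M g\<close> by simp
  qed
  obtain F where F: "\<And>f g. f \<in> {f. integrable M f} \<Longrightarrow> g \<in> {f. integrable M f} \<Longrightarrow> F (\<lambda>x. f x + g x) = F f + F g"
    "\<And>f a. f \<in> {f. integrable M f} \<Longrightarrow> F (\<lambda>x. a * f x) = a * F f"
    "\<And>f. f \<in> {f. integrable M f} \<Longrightarrow> F f \<le> (\<integral>x. \<bar>f x\<bar> \<partial>M)"
    "\<And>h c. (h, c) \<in> L \<Longrightarrow> F h = c"
    by (rule hahn_banach_extension[OF function_space_integrable sub, of L])
      (use int est L0 Ladd Lsc in auto)
  obtain \<rho> where \<rho>: "\<rho> \<in> borel_measurable M" "\<And>x. \<bar>\<rho> x\<bar> \<le> 1"
    "\<And>f. integrable M f \<Longrightarrow> F f = (\<integral>x. \<rho> x * f x \<partial>M)"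
    by (rule L1_functional_representation[of F]) (use F(1-3) in auto)
  show thesis
    by (rule that[OF \<rho>(1,2)]) (use \<rho>(3) int F(4) in \<open>metis\<close>)
qed

section \<open>Smooth functions\<close>

lemma dirder_append: "dirder (vs @ ws) f = dirder vs (dirder ws f)"
  by (induction vs) auto

text \<open>Iterated derivatives never leave \<open>F\<close>, so smoothness can be shown from first
  derivatives alone, without formulas for the higher ones.\<close>

lemma smooth_coinduct:
  assumes "f \<in> F" and "\<And>f x. f \<in> F \<Longrightarrow> f differentiable (at x)"
    and "\<And>f v. f \<in> F \<Longrightarrow> (\<lambda>x. frechet_derivative f (at x) v) \<in> F"
  shows "smooth f"
proof -
  have "dirder vs f \<in> F" for vs
    by (induction vs) (use assms in auto)
  then show ?thesis using assms(2) by (auto simp: smooth_def)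
qed

lemma smooth_differentiable: "smooth f \<Longrightarrow> f differentiable (at x)"
  unfolding smooth_def using dirder.simps(1) by metis

lemma smooth_derivative:
  assumes "smooth f" shows "smooth (\<lambda>x. frechet_derivative f (at x) v)"
proof -
  have "dirder vs (\<lambda>x. frechet_derivative f (at x) v) = dirder (vs @ [v]) f" for vs
    by (simp add: dirder_append)
  then show ?thesis using assms by (simp add: smooth_def)
qed

lemma smooth_has_derivative: "smooth f \<Longrightarrow> (f has_derivative frechet_derivative f (at x)) (at x)"
  using smooth_differentiable frechet_derivative_works by blast

lemma smooth_continuous: "smooth f \<Longrightarrow> continuous_on A f"
  by (meson continuous_at_imp_continuous_on differentiable_imp_continuous_within smooth_differentiable)

lemma smooth_borel: "smooth f \<Longrightarrow> f \<in> borel_measurable borel"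
  by (rule borel_measurable_continuous_onI) (rule smooth_continuous)

lemma frechet_derivative_eqI: "(f has_derivative f') (at x) \<Longrightarrow> frechet_derivative f (at x) = f'"
  using frechet_derivative_at by metis

inductive_set smooth_closure :: "('a::euclidean_space \<Rightarrow> real) \<Rightarrow> real \<Rightarrow> ('a \<Rightarrow> real) set" for g d where
  base: "smooth f \<Longrightarrow> f \<in> smooth_closure g d"
| pow: "(\<lambda>x. ((g x)\<^sup>2 + d\<^sup>2) powr a) \<in> smooth_closure g d"
| add: "f \<in> smooth_closure g d \<Longrightarrow> h \<in> smooth_closure g d \<Longrightarrow> (\<lambda>x. f x + h x) \<in> smooth_closure g d"
| mult: "f \<in> smooth_closure g d \<Longrightarrow> h \<in> smooth_closure g d \<Longrightarrow> (\<lambda>x. f x * h x) \<in> smooth_closure g d"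

lemma smooth_const: "smooth (\<lambda>x. c)"
  by (rule smooth_coinduct[where F="range (\<lambda>c x. c)"]) auto

lemma has_derivative_regularized_power:
  assumes "smooth g" "d \<noteq> 0"
  shows "((\<lambda>x. ((g x)\<^sup>2 + d\<^sup>2) powr a) has_derivative
    (\<lambda>v. 2 * a * ((((g x)\<^sup>2 + d\<^sup>2) powr (a - 1)) * (g x * frechet_derivative g (at x) v)))) (at x)"
proof -
  \<comment> \<open>The shift by \<open>d\<close> keeps the base away from 0, where the power need
    not be differentiable.\<close>
  have pos: "0 < (g x)\<^sup>2 + d\<^sup>2" using assms(2) by (simp add: add_nonneg_pos)
  have outer: "((\<lambda>z. z powr a) has_derivative (\<lambda>h. a * ((g x)\<^sup>2 + d\<^sup>2) powr (a - 1) * h)) (at ((g x)\<^sup>2 + d\<^sup>2))"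
    using has_real_derivative_powr[OF pos, of a] by (simp add: has_field_derivative_def)
  have inner: "((\<lambda>x. (g x)\<^sup>2 + d\<^sup>2) has_derivative (\<lambda>v. 2 * (g x * frechet_derivative g (at x) v))) (at x)"
    by (auto intro!: derivative_eq_intros smooth_has_derivative[OF assms(1)])
  show ?thesis
    by (rule has_derivative_eq_rhs[OF has_derivative_compose[OF inner outer]]) (simp add: fun_eq_iff)
qed

lemma smooth_closure_smooth:
  assumes g: "smooth g" and d: "d \<noteq> 0" and f: "f \<in> smooth_closure g d"
  shows "smooth f"
proof -
  have *: "(\<forall>x. f differentiable (at x)) \<and> (\<forall>v. (\<lambda>x. frechet_derivative f (at x) v) \<in> smooth_closure g d)"
    if "f \<in> smooth_closure g d" for f
    using that
  proof induction
    case (base f)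
    then show ?case using smooth_differentiable smooth_derivative smooth_closure.base by blast
  next
    case (pow a)
    note D = has_derivative_regularized_power[OF g d, of a]
    have "(\<lambda>x. frechet_derivative (\<lambda>x. ((g x)\<^sup>2 + d\<^sup>2) powr a) (at x) v) \<in> smooth_closure g d" for v
      unfolding frechet_derivative_eqI[OF D]
      by (intro smooth_closure.mult smooth_closure.pow smooth_closure.base smooth_const g smooth_derivative[OF g])
    then show ?case using D by (blast intro: differentiableI)
  next
    case (add f h)
    have D: "((\<lambda>x. f x + h x) has_derivative
        (\<lambda>v. frechet_derivative f (at x) v + frechet_derivative h (at x) v)) (at x)" for x
      using add.IH by (intro has_derivative_add) (auto simp: frechet_derivative_works[symmetric])
    have "(\<lambda>x. frechet_derivative (\<lambda>x. f x + h x) (at x) v) \<in> smooth_closure g d" for v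
      unfolding frechet_derivative_eqI[OF D] by (intro smooth_closure.add) (use add.IH in auto)
    then show ?case using D by (blast intro: differentiableI)
  next
    case (mult f h)
    have D: "((\<lambda>x. f x * h x) has_derivative
        (\<lambda>v. f x * frechet_derivative h (at x) v + frechet_derivative f (at x) v * h x)) (at x)" for x
      using mult.IH by (intro has_derivative_mult) (auto simp: frechet_derivative_works[symmetric])
    have "(\<lambda>x. frechet_derivative (\<lambda>x. f x * h x) (at x) v) \<in> smooth_closure g d" for v
      unfolding frechet_derivative_eqI[OF D]
      by (intro smooth_closure.add smooth_closure.mult mult.hyps) (use mult.IH in auto)
    then show ?case using D by (blast intro: differentiableI)
  qed
  show ?thesis
    by (rule smooth_coinduct[OF f]) (use * in auto)
qed

lemma smooth_add: "smooth f \<Longrightarrow> smooth g \<Longrightarrow> smooth (\<lambda>x. f x + g x)"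
  by (rule smooth_closure_smooth[of f 1, OF _ _ smooth_closure.add[OF smooth_closure.base smooth_closure.base]]) auto

lemma smooth_mult: "smooth f \<Longrightarrow> smooth g \<Longrightarrow> smooth (\<lambda>x. f x * g x)"
  by (rule smooth_closure_smooth[of f 1, OF _ _ smooth_closure.mult[OF smooth_closure.base smooth_closure.base]]) auto

lemma smooth_regularized_power: "smooth g \<Longrightarrow> d \<noteq> 0 \<Longrightarrow> smooth (\<lambda>x. ((g x)\<^sup>2 + d\<^sup>2) powr a)"
  by (rule smooth_closure_smooth[of g d, OF _ _ smooth_closure.pow])

lemma has_derivative_affine:
  fixes f :: "'a::euclidean_space \<Rightarrow> real"
  assumes "smooth f"
  shows "((\<lambda>x. f (r + c *\<^sub>R x)) has_derivative (\<lambda>v. c * frechet_derivative f (at (r + c *\<^sub>R x)) v)) (at x)"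
proof -
  have "((\<lambda>x. r + c *\<^sub>R x) has_derivative (\<lambda>v. c *\<^sub>R v)) (at x)"
    by (auto intro!: derivative_eq_intros)
  from has_derivative_compose[OF this smooth_has_derivative[OF assms]]
  show ?thesis
    using linear_frechet_derivative[OF smooth_differentiable[OF assms], of "r + c *\<^sub>R x"]
    by (simp add: linear_cmul)
qed

lemma smooth_affine:
  fixes f :: "'a::euclidean_space \<Rightarrow> real"
  assumes "smooth f"
  shows "smooth (\<lambda>x. f (r + c *\<^sub>R x))"
proof (rule smooth_coinduct[where F="{\<lambda>x. f (r + c *\<^sub>R x) | f. smooth f}"])
  fix g :: "'a \<Rightarrow> real" assume "g \<in> {\<lambda>x. f (r + c *\<^sub>R x) | f. smooth f}"
  then obtain f where f: "smooth f" and g: "g = (\<lambda>x. f (r + c *\<^sub>R x))" by blast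
  note D = has_derivative_affine[OF f, of r c]
  show "g differentiable (at x)" for x unfolding g using D by (blast intro: differentiableI)
  fix v
  have "smooth (\<lambda>x. c * frechet_derivative f (at x) v)"
    by (intro smooth_mult smooth_const smooth_derivative f)
  then show "(\<lambda>x. frechet_derivative g (at x) v) \<in> {\<lambda>x. f (r + c *\<^sub>R x) | f. smooth f}"
    unfolding g frechet_derivative_eqI[OF D] by auto
qed (use assms in blast)

lemma has_derivative_slice:
  fixes f :: "'a::euclidean_space \<times> 'b::euclidean_space \<Rightarrow> real"
  assumes "smooth f"
  shows "((\<lambda>x. f (t, x)) has_derivative (\<lambda>v. frechet_derivative f (at (t, x)) (0, v))) (at x)"
proof -
  have "((\<lambda>x. (t, x)) has_derivative (\<lambda>v. (0, v))) (at x)"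
    by (intro has_derivative_Pair has_derivative_const has_derivative_ident)
  from has_derivative_compose[OF this smooth_has_derivative[OF assms]] show ?thesis .
qed

lemma smooth_slice:
  fixes f :: "'a::euclidean_space \<times> 'b::euclidean_space \<Rightarrow> real"
  assumes "smooth f"
  shows "smooth (\<lambda>x. f (t, x))"
proof (rule smooth_coinduct[where F="{\<lambda>x. f (t, x) | f. smooth f}"])
  fix g :: "'b \<Rightarrow> real" assume "g \<in> {\<lambda>x. f (t, x) | f. smooth f}"
  then obtain f where f: "smooth f" and g: "g = (\<lambda>x. f (t, x))" by blast
  note D = has_derivative_slice[OF f, of t]
  show "g differentiable (at x)" for x unfolding g using D by (blast intro: differentiableI)
  fix v
  show "(\<lambda>x. frechet_derivative g (at x) v) \<in> {\<lambda>x. f (t, x) | f. smooth f}"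
    unfolding g frechet_derivative_eqI[OF D]
    by (intro CollectI exI[of _ "\<lambda>y. frechet_derivative f (at y) (0, v)"] conjI refl smooth_derivative f)
qed (use assms in blast)

lemma has_real_derivative_slice:
  fixes f :: "real \<times> 'b::euclidean_space \<Rightarrow> real"
  assumes "smooth f"
  shows "((\<lambda>t. f (t, x)) has_real_derivative frechet_derivative f (at (t, x)) (1, 0)) (at t)"
proof -
  have "((\<lambda>t. (t, x)) has_derivative (\<lambda>v. (v, 0))) (at t)"
    by (intro has_derivative_Pair has_derivative_const has_derivative_ident)
  from has_derivative_compose[OF this smooth_has_derivative[OF assms]]
  have D: "((\<lambda>t. f (t, x)) has_derivative (\<lambda>v. frechet_derivative f (at (t, x)) (v, 0))) (at t)" .
  have scale: "frechet_derivative f (at (t, x)) (v, 0) = v * frechet_derivative f (at (t, x)) (1, 0)" for v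
    using linear_cmul[OF linear_frechet_derivative[OF smooth_differentiable[OF assms], of "(t, x)"], of v "(1, 0)"]
    by simp
  show ?thesis
    unfolding has_field_derivative_def
    by (rule has_derivative_eq_rhs[OF D]) (subst scale, simp add: fun_eq_iff mult.commute)
qed

lemma frechet_derivative_space_time:
  fixes f :: "real \<times> 'b::euclidean_space \<Rightarrow> real"
  assumes "smooth f"
  shows "frechet_derivative f (at (t, x)) (1, v) =
    frechet_derivative f (at (t, x)) (1, 0) + frechet_derivative (\<lambda>x. f (t, x)) (at x) v"
  unfolding frechet_derivative_eqI[OF has_derivative_slice[OF assms]]
  using linear_add[OF linear_frechet_derivative[OF smooth_differentiable[OF assms], of "(t, x)"], of "(1, 0)" "(0, v)"]
  by simp

section \<open>Test functions and functions that are constant off a compact set\<close>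

lemma test_function_smooth: "test_function f \<Longrightarrow> smooth f"
  by (simp add: test_function_def)

lemma test_functionI:
  assumes "smooth f" and "compact K" and "\<And>x. x \<notin> K \<Longrightarrow> f x = 0"
  shows "test_function f"
proof -
  have "tsupport f \<subseteq> K"
    unfolding tsupport_def by (rule closure_minimal) (use assms in \<open>auto intro: compact_imp_closed\<close>)
  moreover have "closed (tsupport f)" by (simp add: tsupport_def)
  ultimately show ?thesis
    using assms unfolding test_function_def by (metis closed_Int_compact inf.absorb_iff1)
qed

lemma test_function_support:
  assumes "test_function f"
  obtains K where "compact K" "\<And>x. x \<notin> K \<Longrightarrow> f x = 0"
proof (rule that[of "tsupport f"])
  show "f x = 0" if "x \<notin> tsupport f" for x
    using that closure_subset[of "{x. f x \<noteq> 0}"] by (auto simp: tsupport_def)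
qed (use assms in \<open>simp add: test_function_def\<close>)

lemma test_function_affine:
  fixes f :: "'a::euclidean_space \<Rightarrow> real"
  assumes f: "test_function f" and c: "c \<noteq> 0"
  shows "test_function (\<lambda>x. f (r + c *\<^sub>R x))"
proof -
  obtain K where K: "compact K" "\<And>x. x \<notin> K \<Longrightarrow> f x = 0" using test_function_support[OF f] by blast
  show ?thesis
  proof (rule test_functionI)
    show "compact ((\<lambda>y. (1 / c) *\<^sub>R (y - r)) ` K)"
      by (intro compact_continuous_image continuous_intros K)
    fix x assume x: "x \<notin> (\<lambda>y. (1 / c) *\<^sub>R (y - r)) ` K"
    have "r + c *\<^sub>R x \<notin> K"
    proof
      assume "r + c *\<^sub>R x \<in> K"
      then have "(1 / c) *\<^sub>R ((r + c *\<^sub>R x) - r) \<in> (\<lambda>y. (1 / c) *\<^sub>R (y - r)) ` K" by blast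
      then show False using x c by simp
    qed
    then show "f (r + c *\<^sub>R x) = 0" by (rule K)
  qed (intro smooth_affine test_function_smooth f)
qed

lemma test_function_slice:
  fixes f :: "'a::euclidean_space \<times> 'b::euclidean_space \<Rightarrow> real"
  assumes f: "test_function f"
  shows "test_function (\<lambda>x. f (t, x))"
proof -
  obtain K where K: "compact K" "\<And>x. x \<notin> K \<Longrightarrow> f x = 0" using test_function_support[OF f] by blast
  show ?thesis
  proof (rule test_functionI)
    show "compact (snd ` K)" by (intro compact_continuous_image continuous_intros K)
    show "f (t, x) = 0" if "x \<notin> snd ` K" for x
      using that K(2)[of "(t, x)"] by force
  qed (intro smooth_slice test_function_smooth f)
qed

lemma frechet_derivative_outside_support:
  assumes "x \<notin> tsupport f"
  shows "frechet_derivative f (at x) v = 0"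
proof -
  have "(f has_derivative (\<lambda>v. 0)) (at x)"
  proof (rule has_derivative_transform_within_open[OF has_derivative_const])
    show "open (- tsupport f)" unfolding tsupport_def by (intro open_Compl closed_closure)
    show "x \<in> - tsupport f" using assms by simp
    show "0 = f y" if "y \<in> - tsupport f" for y
      using that closure_subset[of "{x. f x \<noteq> 0}"] by (auto simp: tsupport_def)
  qed
  then show ?thesis by (simp add: frechet_derivative_eqI)
qed

lemma test_function_derivative:
  assumes f: "test_function f"
  shows "test_function (\<lambda>x. frechet_derivative f (at x) v)"
proof (rule test_functionI)
  show "compact (tsupport f)" using f by (simp add: test_function_def)
qed (use smooth_derivative[OF test_function_smooth[OF f]] frechet_derivative_outside_support in auto)

lemma test_function_bounded:
  assumes "test_function f"
  obtains B where "\<And>x. \<bar>f x\<bar> \<le> B"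
proof -
  obtain K where K: "compact K" "\<And>x. x \<notin> K \<Longrightarrow> f x = 0" using test_function_support[OF assms] by blast
  have "bounded (f ` K)"
    using K smooth_continuous[OF test_function_smooth[OF assms]]
    by (intro compact_imp_bounded compact_continuous_image) auto
  then obtain B where "\<And>x. x \<in> K \<Longrightarrow> \<bar>f x\<bar> \<le> B" by (auto simp: bounded_iff)
  then have "\<bar>f x\<bar> \<le> max B 0" for x using K(2)[of x] by (cases "x \<in> K") (force simp: le_max_iff_disj)+
  then show thesis by (rule that)
qed

text \<open>Test functions are not stable under the regularized modulus, which takes a nonzero
  constant value off the support; admitting additive constants repairs this. The constant 1 is then
  also available and yields conservation of mass.\<close>

definition near_constant :: "('a::euclidean_space \<Rightarrow> real) \<Rightarrow> bool" where
  "near_constant f \<longleftrightarrow> (\<exists>c. test_function (\<lambda>x. f x - c))"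

lemma near_constantI: "smooth f \<Longrightarrow> compact K \<Longrightarrow> (\<And>x. x \<notin> K \<Longrightarrow> f x = c) \<Longrightarrow> near_constant f"
  unfolding near_constant_def
  using smooth_add[OF _ smooth_const[of "- c"], of f] by (intro exI[of _ c] test_functionI[of _ K]) auto

lemma near_constantE:
  assumes "near_constant f"
  obtains K c where "smooth f" "compact K" "\<And>x. x \<notin> K \<Longrightarrow> f x = c"
proof -
  obtain c where c: "test_function (\<lambda>x. f x - c)" using assms by (auto simp: near_constant_def)
  obtain K where K: "compact K" "\<And>x. x \<notin> K \<Longrightarrow> f x - c = 0" using test_function_support[OF c] by blast
  have "smooth (\<lambda>x. (f x - c) + c)" by (intro smooth_add smooth_const test_function_smooth c)
  then show thesis using that[of K c] K by simp
qed

lemma near_constant_smooth: "near_constant f \<Longrightarrow> smooth f"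
  by (auto elim: near_constantE)

lemma near_constant_test: "test_function f \<Longrightarrow> near_constant f"
  unfolding near_constant_def by (intro exI[of _ 0]) simp

lemma near_constant_const: "near_constant (\<lambda>x. c)"
  by (rule near_constantI[of _ "{}"]) (auto intro: smooth_const)

lemma near_constant_add:
  assumes "near_constant f" "near_constant g" shows "near_constant (\<lambda>x. f x + g x)"
proof -
  obtain K c where f: "smooth f" "compact K" "\<And>x. x \<notin> K \<Longrightarrow> f x = c" using near_constantE[OF assms(1)] by blast
  obtain J d where g: "smooth g" "compact J" "\<And>x. x \<notin> J \<Longrightarrow> g x = d" using near_constantE[OF assms(2)] by blast
  show ?thesis
    by (rule near_constantI[of _ "K \<union> J" "c + d"]) (use f g smooth_add[OF f(1) g(1)] in auto)
qed

lemma near_constant_cmult: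
  assumes "near_constant f" shows "near_constant (\<lambda>x. a * f x)"
proof -
  obtain K c where f: "smooth f" "compact K" "\<And>x. x \<notin> K \<Longrightarrow> f x = c" using near_constantE[OF assms(1)] by blast
  show ?thesis
    by (rule near_constantI[of _ K "a * c"]) (use f smooth_mult[OF smooth_const f(1)] in auto)
qed

lemma near_constant_regularized_power:
  assumes "near_constant f" "d \<noteq> 0" shows "near_constant (\<lambda>x. ((f x)\<^sup>2 + d\<^sup>2) powr a)"
proof -
  obtain K c where f: "smooth f" "compact K" "\<And>x. x \<notin> K \<Longrightarrow> f x = c" using near_constantE[OF assms(1)] by blast
  show ?thesis
    by (rule near_constantI[of _ K "(c\<^sup>2 + d\<^sup>2) powr a"]) (use f smooth_regularized_power[OF f(1) assms(2)] in auto)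
qed

text \<open>The derivative does not see the additive constant, so the divergence-free condition,
  stated for test functions, carries over to \<open>near_constant\<close> functions.\<close>

lemma frechet_derivative_near_constant_test:
  assumes "near_constant f"
  obtains g where "test_function g" "frechet_derivative g = frechet_derivative f"
proof -
  obtain c where c: "test_function (\<lambda>x. f x - c)" using assms by (auto simp: near_constant_def)
  have "((\<lambda>x. f x - c) has_derivative f') F \<longleftrightarrow> (f has_derivative f') F" for f' F
    using has_derivative_diff[of "\<lambda>x. f x" f' F "\<lambda>x. c" "\<lambda>x. 0"]
      has_derivative_add[of "\<lambda>x. f x - c" f' F "\<lambda>x. c" "\<lambda>x. 0"] by auto
  then have "frechet_derivative (\<lambda>x. f x - c) = frechet_derivative f"
    unfolding frechet_derivative_def by (intro ext) simp
  with c show thesis by (rule that)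
qed

section \<open>The energy estimate and backward solutions\<close>

definition slab :: "(real \<times> (real^2)) set" where
  "slab = {0..1} \<times> unit_square"

lemma unit_square_box: "unit_square = box (vector [-1/2, -1/2]) (vector [1/2, 1/2])"
  by (auto simp: unit_square_def mem_box_cart forall_2)

lemma unit_square_borel[measurable, simp]: "unit_square \<in> sets borel"
  by (simp add: unit_square_box)

lemma slab_borel[measurable, simp]: "slab \<in> sets borel"
  unfolding slab_def by (intro borel_Times) auto

lemma unit_square_finite: "emeasure lborel unit_square < \<infinity>"
  unfolding unit_square_box by (rule emeasure_bounded_finite) simp

lemma slab_finite: "emeasure lborel slab < \<infinity>"
proof (rule emeasure_bounded_finite)
  show "bounded slab" unfolding slab_def unit_square_box by (intro bounded_Times) auto
qed

lemma indicator_slab: "indicator slab (t, x) = (indicator {0..1} t * indicator unit_square x :: real)"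
  by (simp add: slab_def indicator_times)

text \<open>Separates the direction, which will be the value of a merely measurable field:
  measurability and bounds are then needed only for derivatives in finitely many fixed
  directions.\<close>

lemma frechet_derivative_expand:
  fixes f :: "'a::euclidean_space \<Rightarrow> real"
  assumes "f differentiable (at x)"
  shows "frechet_derivative f (at x) v = (\<Sum>b\<in>Basis. (v \<bullet> b) * frechet_derivative f (at x) b)"
proof -
  note lin = linear_frechet_derivative[OF assms]
  have "frechet_derivative f (at x) (\<Sum>b\<in>Basis. (v \<bullet> b) *\<^sub>R b) =
      (\<Sum>b\<in>Basis. (v \<bullet> b) *\<^sub>R frechet_derivative f (at x) b)"
    by (simp add: linear_sum[OF lin] linear_cmul[OF lin])
  then show ?thesis by (simp add: euclidean_representation)
qed

text \<open>Tailored to an integrable field: bounded, jointly measurable derivatives in each fixed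
  direction make the advection term integrable. Time enters only measurably, so cut-offs in time can
  be multiplied in.\<close>

definition space_regular :: "(real \<Rightarrow> real^2 \<Rightarrow> real) \<Rightarrow> bool" where
  "space_regular \<phi> \<longleftrightarrow> (\<forall>t. near_constant (\<phi> t)) \<and> (\<lambda>(t, x). \<phi> t x) \<in> borel_measurable borel \<and>
     (\<forall>b. (\<lambda>(t, x). frechet_derivative (\<phi> t) (at x) b) \<in> borel_measurable borel) \<and>
     (\<forall>b. \<exists>B. \<forall>t\<in>{0..1}. \<forall>x. \<bar>frechet_derivative (\<phi> t) (at x) b\<bar> \<le> B)"

text \<open>Continuous piecewise differentiable dependence on time is enough for the energy estimate, and it
  allows the ramps in time that produce time averages.\<close>

definition time_regular :: "(real \<Rightarrow> real^2 \<Rightarrow> real) \<Rightarrow> (real \<Rightarrow> real^2 \<Rightarrow> real) \<Rightarrow> bool" where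
  "time_regular \<phi> \<phi>' \<longleftrightarrow> (\<lambda>(t, x). \<phi>' t x) \<in> borel_measurable borel \<and>
     (\<exists>B. \<forall>t\<in>{0..1}. \<forall>x. \<bar>\<phi>' t x\<bar> \<le> B) \<and>
     (\<exists>S. finite S \<and> (\<forall>x. continuous_on {0..1} (\<lambda>t. \<phi> t x) \<and>
        (\<forall>t\<in>{0<..<1} - S. ((\<lambda>t. \<phi> t x) has_real_derivative \<phi>' t x) (at t))))"

section \<open>Calculus of time-dependent test functions\<close>

lemma near_constant_differentiable: "near_constant f \<Longrightarrow> f differentiable (at x)"
  by (intro smooth_differentiable near_constant_smooth)

lemma near_constant_derivative_bounded:
  assumes "near_constant f"
  shows "\<exists>B. \<forall>x. \<bar>frechet_derivative f (at x) b\<bar> \<le> B"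
proof -
  obtain g where g: "test_function g" "frechet_derivative g = frechet_derivative f"
    using frechet_derivative_near_constant_test[OF assms] by blast
  show ?thesis
    using test_function_bounded[OF test_function_derivative[OF g(1), of b]] g(2) by metis
qed

lemma frechet_derivative_add:
  assumes "near_constant f" "near_constant g"
  shows "frechet_derivative (\<lambda>x. f x + g x) (at x) v = frechet_derivative f (at x) v + frechet_derivative g (at x) v"
  using frechet_derivative_eqI[OF has_derivative_add[OF
      smooth_has_derivative[OF near_constant_smooth[OF assms(1)]]
      smooth_has_derivative[OF near_constant_smooth[OF assms(2)]]]] by simp

lemma frechet_derivative_cmult:
  fixes f :: "'a::euclidean_space \<Rightarrow> real"
  assumes "near_constant f"
  shows "frechet_derivative (\<lambda>x. c * f x) (at x) v = c * frechet_derivative f (at x) v"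
  using frechet_derivative_eqI[OF has_derivative_mult_right[OF
      smooth_has_derivative[OF near_constant_smooth[OF assms]]]] by simp

lemma space_regular_static:
  assumes "near_constant f" shows "space_regular (\<lambda>t. f)"
proof -
  have s: "smooth f" by (rule near_constant_smooth[OF assms])
  have [measurable]: "f \<in> borel_measurable borel" by (rule smooth_borel[OF s])
  have [measurable]: "(\<lambda>x. frechet_derivative f (at x) b) \<in> borel_measurable borel" for b
    by (rule smooth_borel[OF smooth_derivative[OF s]])
  have "(\<lambda>(t::real, x). f x) \<in> borel_measurable borel"
    "\<And>b. (\<lambda>(t::real, x). frechet_derivative f (at x) b) \<in> borel_measurable borel"
    unfolding borel_prod[symmetric] by measurable
  then show ?thesis
    using assms near_constant_derivative_bounded[OF assms] by (simp add: space_regular_def)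
qed

lemma space_regular_test:
  fixes f :: "real \<times> (real^2) \<Rightarrow> real"
  assumes "test_function f" shows "space_regular (\<lambda>t x. f (t, x))"
proof -
  have s: "smooth f" by (rule test_function_smooth[OF assms])
  have eq: "frechet_derivative (\<lambda>x. f (t, x)) (at x) b = frechet_derivative f (at (t, x)) (0, b)" for t x b
    using frechet_derivative_eqI[OF has_derivative_slice[OF s]] by simp
  have "(\<lambda>p. frechet_derivative f (at p) (0, b)) \<in> borel_measurable borel" for b
    by (rule smooth_borel[OF smooth_derivative[OF s]])
  moreover have "\<exists>B. \<forall>t\<in>{0..1}. \<forall>x. \<bar>frechet_derivative f (at (t, x)) (0, b)\<bar> \<le> B" for b
    using test_function_bounded[OF test_function_derivative[OF assms, of "(0, b)"]] by metis
  ultimately show ?thesis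
    unfolding space_regular_def eq
    using near_constant_test[OF test_function_slice[OF assms]] smooth_borel[OF s]
    by (auto simp: case_prod_beta')
qed

lemma space_regular_add:
  assumes "space_regular \<phi>" "space_regular \<psi>" shows "space_regular (\<lambda>t x. \<phi> t x + \<psi> t x)"
proof -
  have nc: "near_constant (\<phi> t)" "near_constant (\<psi> t)" for t using assms by (auto simp: space_regular_def)
  have "\<exists>B. \<forall>t\<in>{0..1}. \<forall>x. \<bar>frechet_derivative (\<phi> t) (at x) b + frechet_derivative (\<psi> t) (at x) b\<bar> \<le> B" for b
  proof -
    obtain B C where "\<And>t x. t \<in> {0..1} \<Longrightarrow> \<bar>frechet_derivative (\<phi> t) (at x) b\<bar> \<le> B"
      "\<And>t x. t \<in> {0..1} \<Longrightarrow> \<bar>frechet_derivative (\<psi> t) (at x) b\<bar> \<le> C"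
      using assms unfolding space_regular_def by meson
    then show ?thesis by (intro exI[of _ "B + C"]) (fastforce intro: order_trans[OF abs_triangle_ineq] add_mono)
  qed
  then show ?thesis
    unfolding space_regular_def frechet_derivative_add[OF nc]
    using assms nc by (auto simp: space_regular_def case_prod_beta' intro!: near_constant_add borel_measurable_add)
qed

lemma space_regular_cmult:
  assumes "space_regular \<phi>" and [measurable]: "\<theta> \<in> borel_measurable borel" and \<theta>: "\<And>t. t \<in> {0..1} \<Longrightarrow> \<bar>\<theta> t\<bar> \<le> C"
  shows "space_regular (\<lambda>t x. \<theta> t * \<phi> t x)"
proof -
  have nc: "near_constant (\<phi> t)" for t using assms by (auto simp: space_regular_def)
  have "\<exists>B. \<forall>t\<in>{0..1}. \<forall>x. \<bar>\<theta> t * frechet_derivative (\<phi> t) (at x) b\<bar> \<le> B" for b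
  proof -
    obtain B where B: "\<And>t x. t \<in> {0..1} \<Longrightarrow> \<bar>frechet_derivative (\<phi> t) (at x) b\<bar> \<le> B"
      using assms unfolding space_regular_def by meson
    have "\<bar>\<theta> t * frechet_derivative (\<phi> t) (at x) b\<bar> \<le> C * B" if "t \<in> {0..1}" for t x
      unfolding abs_mult using B[OF that, of x] \<theta>[OF that] by (intro mult_mono) auto
    then show ?thesis by blast
  qed
  moreover have "(\<lambda>p. \<theta> (fst p)) \<in> borel_measurable (borel :: (real \<times> (real^2)) measure)"
    unfolding borel_prod[symmetric] by measurable
  ultimately show ?thesis
    unfolding space_regular_def frechet_derivative_cmult[OF nc]
    using assms(1) nc by (auto simp: space_regular_def case_prod_beta' intro!: near_constant_cmult borel_measurable_times)
qed

lemma time_regular_add: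
  assumes "time_regular \<phi> \<phi>'" "time_regular \<psi> \<psi>'"
  shows "time_regular (\<lambda>t x. \<phi> t x + \<psi> t x) (\<lambda>t x. \<phi>' t x + \<psi>' t x)"
proof -
  obtain B C where B: "\<And>t x. t \<in> {0..1} \<Longrightarrow> \<bar>\<phi>' t x\<bar> \<le> B" and C: "\<And>t x. t \<in> {0..1} \<Longrightarrow> \<bar>\<psi>' t x\<bar> \<le> C"
    using assms unfolding time_regular_def by meson
  have bound: "\<bar>\<phi>' t x + \<psi>' t x\<bar> \<le> B + C" if "t \<in> {0..1}" for t x
    using B[OF that, of x] C[OF that, of x] by linarith
  obtain S T where S: "finite S" "\<And>x. continuous_on {0..1} (\<lambda>t. \<phi> t x)"
      "\<And>t x. t \<in> {0<..<1} - S \<Longrightarrow> ((\<lambda>t. \<phi> t x) has_real_derivative \<phi>' t x) (at t)"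
    and T: "finite T" "\<And>x. continuous_on {0..1} (\<lambda>t. \<psi> t x)"
      "\<And>t x. t \<in> {0<..<1} - T \<Longrightarrow> ((\<lambda>t. \<psi> t x) has_real_derivative \<psi>' t x) (at t)"
    using assms unfolding time_regular_def by meson
  then have ex: "\<exists>S. finite S \<and> (\<forall>x. continuous_on {0..1} (\<lambda>t. \<phi> t x + \<psi> t x) \<and>
      (\<forall>t\<in>{0<..<1} - S. ((\<lambda>t. \<phi> t x + \<psi> t x) has_real_derivative \<phi>' t x + \<psi>' t x) (at t)))"
    by (intro exI[of _ "S \<union> T"]) (auto intro!: continuous_intros DERIV_add)
  have "(\<lambda>(t, x). \<phi>' t x + \<psi>' t x) \<in> borel_measurable borel"
    using assms by (auto simp: time_regular_def case_prod_beta' intro!: borel_measurable_add)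
  with bound ex show ?thesis unfolding time_regular_def by blast
qed

lemma time_regular_cmult:
  assumes "time_regular \<phi> \<phi>'"
  shows "time_regular (\<lambda>t x. c * \<phi> t x) (\<lambda>t x. c * \<phi>' t x)"
proof -
  obtain B where B: "\<And>t x. t \<in> {0..1} \<Longrightarrow> \<bar>\<phi>' t x\<bar> \<le> B"
    using assms unfolding time_regular_def by meson
  have bound: "\<bar>c * \<phi>' t x\<bar> \<le> \<bar>c\<bar> * B" if "t \<in> {0..1}" for t x
    unfolding abs_mult using B[OF that, of x] by (intro mult_left_mono) auto
  obtain S where S: "finite S" "\<And>x. continuous_on {0..1} (\<lambda>t. \<phi> t x)"
      "\<And>t x. t \<in> {0<..<1} - S \<Longrightarrow> ((\<lambda>t. \<phi> t x) has_real_derivative \<phi>' t x) (at t)"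
    using assms unfolding time_regular_def by meson
  then have ex: "\<exists>S. finite S \<and> (\<forall>x. continuous_on {0..1} (\<lambda>t. c * \<phi> t x) \<and>
      (\<forall>t\<in>{0<..<1} - S. ((\<lambda>t. c * \<phi> t x) has_real_derivative c * \<phi>' t x) (at t)))"
    by (intro exI[of _ S]) (auto intro!: continuous_intros DERIV_cmult)
  have "(\<lambda>(t, x). c * \<phi>' t x) \<in> borel_measurable borel"
    using assms by (auto simp: time_regular_def case_prod_beta' intro!: borel_measurable_times)
  with bound ex show ?thesis unfolding time_regular_def by blast
qed

section \<open>Transport by an integrable divergence-free field on the unit time interval\<close>

locale transport_field =
  fixes u :: "real \<Rightarrow> real^2 \<Rightarrow> real^2"
  assumes u_integrable: "set_integrable lborel ({0..1} \<times> UNIV) (\<lambda>(t, x). u t x)"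
    and u_outside: "\<And>t x. t \<in> {0..1} \<Longrightarrow> x \<notin> unit_square \<Longrightarrow> u t x = 0"
    and u_divfree: "AE t in lborel. t \<in> {0..1} \<longrightarrow>
      (\<forall>\<psi>. test_function \<psi> \<longrightarrow> (LINT x|lborel. frechet_derivative \<psi> (at x) (u t x)) = 0)"
begin

definition advection :: "(real \<Rightarrow> real^2 \<Rightarrow> real) \<Rightarrow> real \<times> (real^2) \<Rightarrow> real" where
  "advection \<phi> = (\<lambda>(t, x). frechet_derivative (\<phi> t) (at x) (u t x))"

lemma u_slab_integrable: "integrable lborel (\<lambda>p. indicator slab p *\<^sub>R u (fst p) (snd p))"
proof -
  have "(\<lambda>p. indicator ({0..1} \<times> UNIV) p *\<^sub>R (case p of (t, x) \<Rightarrow> u t x)) = (\<lambda>p. indicator slab p *\<^sub>R u (fst p) (snd p))"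
    using u_outside by (auto simp: fun_eq_iff slab_def split: split_indicator)
  then show ?thesis using u_integrable by (simp add: set_integrable_def)
qed

lemma advection_expand:
  assumes "space_regular \<phi>"
  shows "indicator slab p * advection \<phi> p =
    (\<Sum>b\<in>Basis. ((indicator slab p *\<^sub>R u (fst p) (snd p)) \<bullet> b) * frechet_derivative (\<phi> (fst p)) (at (snd p)) b)"
proof -
  have "near_constant (\<phi> (fst p))" using assms by (simp add: space_regular_def)
  then show ?thesis
    using frechet_derivative_expand[OF near_constant_differentiable, of "\<phi> (fst p)" "snd p" "u (fst p) (snd p)"]
    by (simp add: advection_def case_prod_beta' sum_distrib_left mult.assoc)
qed

lemma advection_integrable:
  assumes "space_regular \<phi>"
  shows "integrable lborel (\<lambda>p. indicator slab p * advection \<phi> p)"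
  unfolding advection_expand[OF assms]
proof (rule Bochner_Integration.integrable_sum)
  fix b :: "real^2" assume b: "b \<in> Basis"
  obtain B where B: "\<And>t x. t \<in> {0..1} \<Longrightarrow> \<bar>frechet_derivative (\<phi> t) (at x) b\<bar> \<le> B"
    using assms unfolding space_regular_def by meson
  have [measurable]: "(\<lambda>p. frechet_derivative (\<phi> (fst p)) (at (snd p)) b) \<in> borel_measurable borel"
    using assms by (simp add: space_regular_def case_prod_beta')
  define w where "w p = indicator slab p *\<^sub>R u (fst p) (snd p)" for p
  have w_int: "integrable lborel w" using u_slab_integrable by (simp add: w_def[abs_def])
  then have [measurable]: "w \<in> borel_measurable borel" by auto
  show "integrable lborel (\<lambda>p. ((indicator slab p *\<^sub>R u (fst p) (snd p)) \<bullet> b) * frechet_derivative (\<phi> (fst p)) (at (snd p)) b)"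
    unfolding w_def[symmetric]
  proof (rule Bochner_Integration.integrable_bound[of _ "\<lambda>p. \<bar>B\<bar> * norm (w p)"])
    show "AE p in lborel. norm ((w p \<bullet> b) * frechet_derivative (\<phi> (fst p)) (at (snd p)) b) \<le> norm (\<bar>B\<bar> * norm (w p))"
    proof (rule AE_I2)
      fix p
      show "norm ((w p \<bullet> b) * frechet_derivative (\<phi> (fst p)) (at (snd p)) b) \<le> norm (\<bar>B\<bar> * norm (w p))"
      proof (cases "p \<in> slab")
        case True
        then have "fst p \<in> {0..1}" by (auto simp: slab_def)
        then have "\<bar>frechet_derivative (\<phi> (fst p)) (at (snd p)) b\<bar> \<le> \<bar>B\<bar>" using B by (meson abs_ge_self order_trans)
        moreover have "\<bar>w p \<bullet> b\<bar> \<le> norm (w p)" using Basis_le_norm[OF b] by blast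
        ultimately have "\<bar>w p \<bullet> b\<bar> * \<bar>frechet_derivative (\<phi> (fst p)) (at (snd p)) b\<bar> \<le> norm (w p) * \<bar>B\<bar>"
          by (intro mult_mono) auto
        then show ?thesis by (simp add: abs_mult mult.commute)
      qed (simp add: w_def)
    qed
  qed (use w_int in auto)
qed

lemma advection_add:
  assumes "space_regular \<phi>" "space_regular \<psi>"
  shows "advection (\<lambda>t x. \<phi> t x + \<psi> t x) p = advection \<phi> p + advection \<psi> p"
  using assms by (simp add: advection_def case_prod_beta' space_regular_def frechet_derivative_add)

lemma advection_cmult:
  assumes "space_regular \<phi>"
  shows "advection (\<lambda>t x. \<theta> t * \<phi> t x) p = \<theta> (fst p) * advection \<phi> p"
  using assms by (simp add: advection_def case_prod_beta' space_regular_def frechet_derivative_cmult)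

lemma divfree_near_constant:
  "AE t in lborel. t \<in> {0..1} \<longrightarrow> (\<forall>\<psi>. near_constant \<psi> \<longrightarrow>
     (\<integral>x. indicator unit_square x * frechet_derivative \<psi> (at x) (u t x) \<partial>lborel) = 0)"
  using u_divfree
proof eventually_elim
  case (elim t)
  show ?case
  proof (intro impI allI)
    fix \<psi> :: "real^2 \<Rightarrow> real" assume t: "t \<in> {0..1}" and \<psi>: "near_constant \<psi>"
    obtain g where g: "test_function g" "frechet_derivative g = frechet_derivative \<psi>"
      using frechet_derivative_near_constant_test[OF \<psi>] by blast
    have "indicator unit_square x * frechet_derivative \<psi> (at x) (u t x) = frechet_derivative g (at x) (u t x)" for x
    proof (cases "x \<in> unit_square")
      case False
      then have "u t x = 0" using u_outside t by blast
      moreover have "linear (frechet_derivative \<psi> (at x))"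
        by (intro linear_frechet_derivative near_constant_differentiable \<psi>)
      ultimately show ?thesis using g(2) by (simp add: linear_0)
    qed (simp add: g(2))
    then show "(\<integral>x. indicator unit_square x * frechet_derivative \<psi> (at x) (u t x) \<partial>lborel) = 0"
      using elim t g(1) by simp
  qed
qed

text \<open>The exceptional null set of times in \<open>divfree_near_constant\<close> does not
  depend on the test function, so for almost every \<open>t\<close> the slice
  \<open>\<phi> t\<close> itself may be inserted; Fubini does the rest.\<close>

lemma advection_integral_zero:
  assumes "space_regular \<phi>"
  shows "(\<integral>p. indicator slab p * advection \<phi> p \<partial>lborel) = 0"
proof -
  have int: "integrable (lborel \<Otimes>\<^sub>M lborel) (\<lambda>p. indicator slab p * advection \<phi> p)"
    using advection_integrable[OF assms] by (simp add: lborel_prod)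
  have "(\<integral>p. indicator slab p * advection \<phi> p \<partial>lborel) =
      (\<integral>t. (\<integral>x. indicator slab (t, x) * advection \<phi> (t, x) \<partial>lborel) \<partial>lborel)"
    using lborel_pair.integral_fst'[OF int] by (simp add: lborel_prod)
  also have "\<dots> = (\<integral>t. (0::real) \<partial>(lborel :: real measure))"
  proof (rule integral_cong_AE)
    show "AE t in lborel. (\<integral>x. indicator slab (t, x) * advection \<phi> (t, x) \<partial>lborel) = 0"
      using divfree_near_constant
    proof eventually_elim
      case (elim t)
      show ?case
      proof (cases "t \<in> {0..1}")
        case True
        then show ?thesis using elim assms by (simp add: advection_def indicator_slab space_regular_def)
      qed (auto simp: indicator_slab)
    qed
  qed (use lborel_pair.integrable_fst'[OF int] in auto)
  finally show ?thesis by simp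
qed

text \<open>Multiplication by a smooth approximation \<open>c\<close> of the sign of
  \<open>\<phi>\<close> turns the transport operator applied to \<open>\<phi>\<close> into the
  operator applied to an approximation \<open>H\<close> of the modulus. The advection of
  \<open>H\<close> integrates to zero and its time derivative to the difference of the end values.
  Since \<open>c\<close> is bounded by 1, letting \<open>d\<close> tend to 0 leaves the L1 norm on
  the right.\<close>

lemma energy_estimate:
  assumes sr: "space_regular \<phi>" and tr: "time_regular \<phi> \<phi>'" and \<phi>0: "\<And>x. \<phi> 0 x = 0"
  shows "integrable lborel (\<lambda>p. indicator slab p * (\<phi>' (fst p) (snd p) + advection \<phi> p))"
    and "integrable lborel (\<lambda>x. indicator unit_square x * \<phi> 1 x)"
    and "(\<integral>x. indicator unit_square x * \<bar>\<phi> 1 x\<bar> \<partial>lborel) \<le>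
      (\<integral>p. indicator slab p * \<bar>\<phi>' (fst p) (snd p) + advection \<phi> p\<bar> \<partial>lborel)"
proof -
  have nc: "near_constant (\<phi> t)" for t using sr by (simp add: space_regular_def)
  obtain B where B: "\<And>t x. t \<in> {0..1} \<Longrightarrow> \<bar>\<phi>' t x\<bar> \<le> B"
    using tr unfolding time_regular_def by meson
  obtain S where S: "finite S" "\<And>x. continuous_on {0..1} (\<lambda>t. \<phi> t x)"
      "\<And>t x. t \<in> {0<..<1} - S \<Longrightarrow> ((\<lambda>t. \<phi> t x) has_real_derivative \<phi>' t x) (at t)"
    using tr unfolding time_regular_def by meson
  have [measurable]: "(\<lambda>p. \<phi> (fst p) (snd p)) \<in> borel_measurable borel"
    "(\<lambda>p. \<phi>' (fst p) (snd p)) \<in> borel_measurable borel"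
    using sr tr by (auto simp: space_regular_def time_regular_def case_prod_beta')
  have slab_int: "integrable lborel (\<lambda>p. indicator slab p * h p)"
    if [measurable]: "h \<in> borel_measurable borel" and h: "\<And>p. p \<in> slab \<Longrightarrow> \<bar>h p\<bar> \<le> B" for h :: "_ \<Rightarrow> real"
  proof (rule Bochner_Integration.integrable_bound[of _ "\<lambda>p. \<bar>B\<bar> * indicator slab p"])
    show "AE p in lborel. norm (indicator slab p * h p) \<le> norm (\<bar>B\<bar> * indicator slab p)"
      using h by (intro AE_I2) (fastforce split: split_indicator)
  qed (use slab_finite in auto)
  have \<phi>'int: "integrable lborel (\<lambda>p. indicator slab p * \<phi>' (fst p) (snd p))"
    by (rule slab_int) (use B in \<open>auto simp: slab_def\<close>)
  then show int: "integrable lborel (\<lambda>p. indicator slab p * (\<phi>' (fst p) (snd p) + advection \<phi> p))"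
    using advection_integrable[OF sr] by (simp add: distrib_left)
  have sq_int: "integrable lborel (\<lambda>x. indicator unit_square x * f x)" if nc_f: "near_constant f" for f :: "real^2 \<Rightarrow> real"
  proof -
    obtain c where c: "test_function (\<lambda>x. f x - c)" using nc_f by (auto simp: near_constant_def)
    obtain C where C: "\<And>x. \<bar>f x - c\<bar> \<le> C" using test_function_bounded[OF c] by blast
    have [measurable]: "f \<in> borel_measurable borel" by (rule smooth_borel[OF near_constant_smooth[OF nc_f]])
    show ?thesis
    proof (rule Bochner_Integration.integrable_bound[of _ "\<lambda>x. (C + \<bar>c\<bar>) * indicator unit_square x"])
      have bd: "\<bar>f x\<bar> \<le> \<bar>C + \<bar>c\<bar>\<bar>" for x using C[of x] by linarith
      show "AE x in lborel. norm (indicator unit_square x * f x) \<le> norm ((C + \<bar>c\<bar>) * indicator unit_square x)"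
        using bd by (intro AE_I2) (simp add: abs_mult split: split_indicator)
    qed (use unit_square_finite in auto)
  qed
  show "integrable lborel (\<lambda>x. indicator unit_square x * \<phi> 1 x)" by (rule sq_int[OF nc])
  define R where "R = (\<integral>p. indicator slab p * \<bar>\<phi>' (fst p) (snd p) + advection \<phi> p\<bar> \<partial>lborel)"
  have est: "(\<integral>x. indicator unit_square x * \<bar>\<phi> 1 x\<bar> \<partial>lborel) \<le> R + d * measure lborel unit_square"
    if d: "0 < d" for d
  proof -
    \<comment> \<open>\<open>c\<close> is the derivative of \<open>H\<close> with respect to the
      value of \<open>\<phi>\<close>; both are written with \<open>powr\<close> so that the lemmas
      on regularized powers apply.\<close>
    define H where "H t x = ((\<phi> t x)\<^sup>2 + d\<^sup>2) powr (1/2)" for t x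
    define c where "c t x = ((\<phi> t x)\<^sup>2 + d\<^sup>2) powr (-1/2) * \<phi> t x" for t x
    have pos: "0 < (\<phi> t x)\<^sup>2 + d\<^sup>2" for t x using d by (simp add: add_nonneg_pos)
    have Hsqrt: "H t x = sqrt ((\<phi> t x)\<^sup>2 + d\<^sup>2)" for t x
      using pos[of t x] by (simp add: H_def powr_half_sqrt)
    have H_ge: "\<bar>\<phi> t x\<bar> \<le> H t x" for t x
      unfolding Hsqrt by (rule real_le_rsqrt) simp
    have c_eq: "c t x = \<phi> t x / H t x" for t x
    proof -
      have "((\<phi> t x)\<^sup>2 + d\<^sup>2) powr (-1/2) = inverse (sqrt ((\<phi> t x)\<^sup>2 + d\<^sup>2))"
        using powr_minus[of "(\<phi> t x)\<^sup>2 + d\<^sup>2" "1/2"] powr_half_sqrt[OF less_imp_le[OF pos[of t x]]] by simp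
      then show ?thesis unfolding c_def Hsqrt by (simp only: divide_inverse mult.commute)
    qed
    have Hpos: "0 < H t x" for t x unfolding Hsqrt using pos by simp
    have c1: "\<bar>c t x\<bar> \<le> 1" for t x
      unfolding c_eq using H_ge[of t x] Hpos[of t x] by (simp add: abs_divide)
    have [measurable]: "(\<lambda>p. c (fst p) (snd p)) \<in> borel_measurable borel"
      unfolding c_def by measurable
    have H_deriv: "(H t has_derivative (\<lambda>v. c t x * frechet_derivative (\<phi> t) (at x) v)) (at x)" for t x
      using has_derivative_regularized_power[OF near_constant_smooth[OF nc], of d t "1/2" x] d
      by (simp add: H_def[abs_def] c_def mult.assoc)
    have H_frechet: "frechet_derivative (H t) (at x) v = c t x * frechet_derivative (\<phi> t) (at x) v" for t x v
      using frechet_derivative_eqI[OF H_deriv] by simp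
    have H_nc: "near_constant (H t)" for t
      unfolding H_def[abs_def] using d by (intro near_constant_regularized_power nc) auto
    have "space_regular H"
      unfolding space_regular_def H_frechet
    proof (intro conjI allI H_nc)
      show "(\<lambda>(t, x). H t x) \<in> borel_measurable borel" unfolding H_def case_prod_beta' by measurable
      fix b
      have [measurable]: "(\<lambda>p. frechet_derivative (\<phi> (fst p)) (at (snd p)) b) \<in> borel_measurable borel"
        using sr by (simp add: space_regular_def case_prod_beta')
      show "(\<lambda>(t, x). c t x * frechet_derivative (\<phi> t) (at x) b) \<in> borel_measurable borel"
        unfolding case_prod_beta' by measurable
      obtain C where C: "\<And>t x. t \<in> {0..1} \<Longrightarrow> \<bar>frechet_derivative (\<phi> t) (at x) b\<bar> \<le> C"
        using sr unfolding space_regular_def by meson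
      have "\<bar>c t x * frechet_derivative (\<phi> t) (at x) b\<bar> \<le> C" if "t \<in> {0..1}" for t x
        using mult_mono[OF c1[of t x] C[OF that, of x]] by (simp add: abs_mult)
      then show "\<exists>B. \<forall>t\<in>{0..1}. \<forall>x. \<bar>c t x * frechet_derivative (\<phi> t) (at x) b\<bar> \<le> B" by blast
    qed
    note H_sr = this
    have adv_H: "advection H p = c (fst p) (snd p) * advection \<phi> p" for p
      by (simp add: advection_def case_prod_beta' H_frechet)
    have c\<phi>'int: "integrable lborel (\<lambda>p. indicator slab p * (c (fst p) (snd p) * \<phi>' (fst p) (snd p)))"
    proof (rule slab_int)
      fix p :: "real \<times> (real^2)" assume "p \<in> slab"
      then have "\<bar>\<phi>' (fst p) (snd p)\<bar> \<le> B" using B by (auto simp: slab_def)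
      then show "\<bar>c (fst p) (snd p) * \<phi>' (fst p) (snd p)\<bar> \<le> B"
        using mult_mono[OF c1[of "fst p" "snd p"]] by (fastforce simp: abs_mult)
    qed measurable
    have ftc: "(\<integral>t. indicator {0..1} t * (c t x * \<phi>' t x) \<partial>lborel) = H 1 x - d" for x
    proof -
      have "((\<lambda>t. c t x * \<phi>' t x) has_integral (H 1 x - H 0 x)) {0..1}"
      \<comment> \<open>The finitely many kinks in time are harmless because the function is
        continuous across them.\<close>
      proof (rule fundamental_theorem_of_calculus_interior_strong[OF S(1)])
        show "continuous_on {0..1} (\<lambda>t. H t x)"
          unfolding Hsqrt by (intro continuous_intros S)
        fix t assume t: "t \<in> {0<..<1} - S"
        have inner: "((\<lambda>t. (\<phi> t x)\<^sup>2 + d\<^sup>2) has_real_derivative 2 * \<phi> t x * \<phi>' t x) (at t)"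
          by (auto intro!: derivative_eq_intros S(3)[OF t])
        have "((\<lambda>t. H t x) has_real_derivative
            1/2 * ((\<phi> t x)\<^sup>2 + d\<^sup>2) powr (1/2 - 1) * (2 * \<phi> t x * \<phi>' t x)) (at t)"
          unfolding H_def by (rule DERIV_chain2[OF has_real_derivative_powr[OF pos] inner])
        moreover have "1/2 * ((\<phi> t x)\<^sup>2 + d\<^sup>2) powr (1/2 - 1) * (2 * \<phi> t x * \<phi>' t x) = c t x * \<phi>' t x"
          by (simp add: c_def)
        ultimately have "((\<lambda>t. H t x) has_real_derivative c t x * \<phi>' t x) (at t)" by (simp only:)
        then show "((\<lambda>t. H t x) has_vector_derivative c t x * \<phi>' t x) (at t)"
          by (simp add: has_real_derivative_iff_has_vector_derivative)
      qed simp
      moreover have "set_integrable lborel {0..1} (\<lambda>t. c t x * \<phi>' t x)"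
      proof -
        have "(\<lambda>t. (t, x)) \<in> borel \<rightarrow>\<^sub>M (borel :: (real \<times> (real^2)) measure)"
          unfolding borel_prod[symmetric] by measurable
        note slice = measurable_compose[OF this]
        have [measurable]: "(\<lambda>t. c t x) \<in> borel_measurable borel"
          using slice[of "\<lambda>p. c (fst p) (snd p)" borel] by simp
        have [measurable]: "(\<lambda>t. \<phi>' t x) \<in> borel_measurable borel"
          using slice[of "\<lambda>p. \<phi>' (fst p) (snd p)" borel] by simp
        show ?thesis
          unfolding set_integrable_def
        proof (rule Bochner_Integration.integrable_bound[of _ "\<lambda>t. B * indicator {0..1} t"])
          show "AE t in lborel. norm (indicat_real {0..1} t *\<^sub>R (c t x * \<phi>' t x)) \<le> norm (B * indicat_real {0..1} t)"
          proof (rule AE_I2)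
            fix t :: real
            have "\<bar>c t x\<bar> * \<bar>\<phi>' t x\<bar> \<le> \<bar>B\<bar>" if "t \<in> {0..1}"
              using mult_mono[OF c1[of t x] B[OF that, of x]] by simp
            then show "norm (indicat_real {0..1} t *\<^sub>R (c t x * \<phi>' t x)) \<le> norm (B * indicat_real {0..1} t)"
              by (auto simp: abs_mult split: split_indicator)
          qed
        qed auto
      qed
      ultimately have "(LINT t:{0..1}|lborel. c t x * \<phi>' t x) = H 1 x - H 0 x"
        by (metis set_borel_integral_eq_integral(2) integral_unique)
      \<comment> \<open>Where \<open>\<phi>\<close> vanishes, the regularization leaves
        \<open>d\<close>. Multiplied by the area of the square, this is the error that disappears in
        the limit.\<close>
      moreover have "H 0 x = d" using d by (simp add: Hsqrt \<phi>0)
      ultimately show ?thesis by (simp add: set_lebesgue_integral_def)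
    qed
    have "(\<integral>p. indicator slab p * (c (fst p) (snd p) * \<phi>' (fst p) (snd p)) \<partial>lborel) =
        (\<integral>x. (\<integral>t. indicator slab (t, x) * (c t x * \<phi>' t x) \<partial>lborel) \<partial>lborel)"
      using lborel_pair.integral_snd[of "\<lambda>t x. indicator slab (t, x) * (c t x * \<phi>' t x)"] c\<phi>'int
      by (simp add: lborel_prod case_prod_beta')
    also have "\<dots> = (\<integral>x. indicator unit_square x * (H 1 x - d) \<partial>lborel)"
    proof -
      have "(\<lambda>t. indicator slab (t, x) * (c t x * \<phi>' t x)) = (\<lambda>t. indicator unit_square x * (indicator {0..1} t * (c t x * \<phi>' t x)))" for x
        by (simp add: indicator_slab mult_ac)
      then show ?thesis by (simp add: ftc)
    qed
    also have "\<dots> = (\<integral>x. indicator unit_square x * H 1 x \<partial>lborel) - d * measure lborel unit_square"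
      using sq_int[OF H_nc, of 1] unit_square_finite by (simp add: right_diff_distrib mult.commute)
    finally have time: "(\<integral>x. indicator unit_square x * H 1 x \<partial>lborel) = d * measure lborel unit_square +
        (\<integral>p. indicator slab p * (c (fst p) (snd p) * \<phi>' (fst p) (snd p)) \<partial>lborel)"
      by simp
    have "(\<integral>x. indicator unit_square x * \<bar>\<phi> 1 x\<bar> \<partial>lborel) \<le> (\<integral>x. indicator unit_square x * H 1 x \<partial>lborel)"
    proof (rule integral_mono)
      have "integrable lborel (\<lambda>x. \<bar>indicator unit_square x * \<phi> 1 x\<bar>)"
        by (intro integrable_abs sq_int nc)
      then show "integrable lborel (\<lambda>x. indicator unit_square x * \<bar>\<phi> 1 x\<bar>)" by (simp add: abs_mult)
    qed (use sq_int[OF H_nc] H_ge in \<open>auto intro: mult_left_mono\<close>)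
    also have "\<dots> = d * measure lborel unit_square +
        (\<integral>p. indicator slab p * (c (fst p) (snd p) * \<phi>' (fst p) (snd p)) \<partial>lborel) +
        (\<integral>p. indicator slab p * advection H p \<partial>lborel)"
      by (simp add: time advection_integral_zero[OF H_sr])
    also have "\<dots> = d * measure lborel unit_square +
        (\<integral>p. indicator slab p * (c (fst p) (snd p) * (\<phi>' (fst p) (snd p) + advection \<phi> p)) \<partial>lborel)"
      using c\<phi>'int advection_integrable[OF H_sr]
      by (simp add: adv_H distrib_left mult.assoc flip: Bochner_Integration.integral_add)
    also have "\<dots> \<le> d * measure lborel unit_square + R"
      unfolding R_def
    proof (intro add_left_mono integral_mono)
      show "integrable lborel (\<lambda>p. indicator slab p * (c (fst p) (snd p) * (\<phi>' (fst p) (snd p) + advection \<phi> p)))"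
        using Bochner_Integration.integrable_add[OF c\<phi>'int advection_integrable[OF H_sr]]
        by (simp add: adv_H distrib_left mult.assoc)
      have "integrable lborel (\<lambda>p. \<bar>indicator slab p * (\<phi>' (fst p) (snd p) + advection \<phi> p)\<bar>)"
        by (intro integrable_abs int)
      then show "integrable lborel (\<lambda>p. indicator slab p * \<bar>\<phi>' (fst p) (snd p) + advection \<phi> p\<bar>)"
        by (simp add: abs_mult)
      fix p :: "real \<times> (real^2)"
      define z where "z = \<phi>' (fst p) (snd p) + advection \<phi> p"
      have "c (fst p) (snd p) * z \<le> \<bar>c (fst p) (snd p)\<bar> * \<bar>z\<bar>" by (metis abs_ge_self abs_mult)
      also have "\<dots> \<le> 1 * \<bar>z\<bar>" by (intro mult_right_mono c1) auto
      finally show "indicator slab p * (c (fst p) (snd p) * (\<phi>' (fst p) (snd p) + advection \<phi> p)) \<le>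
          indicator slab p * \<bar>\<phi>' (fst p) (snd p) + advection \<phi> p\<bar>"
        unfolding z_def[symmetric] by (intro mult_left_mono) auto
    qed
    finally show ?thesis by simp
  qed
  show "(\<integral>x. indicator unit_square x * \<bar>\<phi> 1 x\<bar> \<partial>lborel) \<le>
      (\<integral>p. indicator slab p * \<bar>\<phi>' (fst p) (snd p) + advection \<phi> p\<bar> \<partial>lborel)"
    unfolding R_def[symmetric]
  proof (rule field_le_epsilon)
    fix e :: real assume e: "0 < e"
    define m where "m = measure lborel unit_square"
    have m: "0 \<le> m" by (simp add: m_def)
    have "e / (m + 1) * m \<le> e" using e m by (simp add: field_simps)
    then show "(\<integral>x. indicator unit_square x * \<bar>\<phi> 1 x\<bar> \<partial>lborel) \<le> R + e"
      using est[of "e / (m + 1)"] e m by (simp add: m_def[symmetric])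
  qed
qed

text \<open>The test functions vanish at time 0, which leaves the initial value free, while the
  boundary term at time 1 prescribes \<open>f\<close>: the equation is solved backward in
  time.\<close>

lemma backward_solution:
  fixes f :: "real^2 \<Rightarrow> real"
  assumes [measurable]: "f \<in> borel_measurable borel" and f1: "\<And>x. \<bar>f x\<bar> \<le> 1"
  obtains \<rho> :: "real \<times> (real^2) \<Rightarrow> real" where "\<rho> \<in> borel_measurable borel" "\<And>p. \<bar>\<rho> p\<bar> \<le> 1"
    "\<And>p. p \<notin> slab \<Longrightarrow> \<rho> p = 0"
    "\<And>\<phi> \<phi>'. space_regular \<phi> \<Longrightarrow> time_regular \<phi> \<phi>' \<Longrightarrow> (\<And>x. \<phi> 0 x = 0) \<Longrightarrow>
      (\<integral>p. \<rho> p * (\<phi>' (fst p) (snd p) + advection \<phi> p) \<partial>lborel) =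
      (\<integral>x. indicator unit_square x * (f x * \<phi> 1 x) \<partial>lborel)"
proof -
  define M where "M = restrict_space lborel slab"
  interpret finite_measure M
    unfolding M_def using slab_finite
    by (intro finite_measureI) (simp add: space_restrict_space emeasure_restrict_space)
  \<comment> \<open>Since \<open>f\<close> is bounded by 1, the second component is at most the L1
    norm of \<open>\<phi> 1\<close> on the square, hence by the energy estimate at most the L1 norm
    of the first component.\<close>
  define L where "L = {(\<lambda>p. \<phi>' (fst p) (snd p) + advection \<phi> p, \<integral>x. indicator unit_square x * (f x * \<phi> 1 x) \<partial>lborel) |
      \<phi> \<phi>'. space_regular \<phi> \<and> time_regular \<phi> \<phi>' \<and> (\<forall>x. \<phi> 0 x = 0)}"
  have fint: "integrable lborel (\<lambda>x. indicator unit_square x * (f x * \<phi> 1 x))"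
    if "space_regular \<phi>" "time_regular \<phi> \<phi>'" "\<forall>x. \<phi> 0 x = 0" for \<phi> \<phi>'
  proof (rule Bochner_Integration.integrable_bound[OF energy_estimate(2)[of \<phi> \<phi>']])
    have [measurable]: "\<phi> 1 \<in> borel_measurable borel"
      using that(1) by (auto simp: space_regular_def intro: smooth_borel near_constant_smooth)
    show "(\<lambda>x. indicat_real unit_square x * (f x * \<phi> 1 x)) \<in> borel_measurable lborel" by measurable
    show "AE x in lborel. norm (indicat_real unit_square x * (f x * \<phi> 1 x)) \<le> norm (indicat_real unit_square x * \<phi> 1 x)"
      using f1 by (auto simp: abs_mult mult_left_le_one_le intro!: AE_I2 mult_left_mono)
  qed (use that in auto)
  obtain \<rho> where \<rho>: "\<rho> \<in> borel_measurable M" "\<And>x. \<bar>\<rho> x\<bar> \<le> 1"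
    "\<And>h c. (h, c) \<in> L \<Longrightarrow> (\<integral>p. \<rho> p * h p \<partial>M) = c"
  proof (rule bounded_solution_of_a_priori_estimate[of L])
    fix h c assume "(h, c) \<in> L"
    then obtain \<phi> \<phi>' where *: "space_regular \<phi>" "time_regular \<phi> \<phi>'" "\<forall>x. \<phi> 0 x = 0"
      and h: "h = (\<lambda>p. \<phi>' (fst p) (snd p) + advection \<phi> p)"
      and c: "c = (\<integral>x. indicator unit_square x * (f x * \<phi> 1 x) \<partial>lborel)" unfolding L_def by blast
    note E = energy_estimate[OF *(1,2) *(3)[rule_format]]
    show "integrable M h"
      unfolding M_def h using E(1) by (subst integrable_restrict_space) (auto simp: set_integrable_def)
    have "c \<le> (\<integral>x. indicator unit_square x * \<bar>\<phi> 1 x\<bar> \<partial>lborel)"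
      unfolding c
    proof (rule integral_mono[OF fint[OF *]])
      have "integrable lborel (\<lambda>x. \<bar>indicator unit_square x * \<phi> 1 x\<bar>)"
        by (intro integrable_abs E)
      then show "integrable lborel (\<lambda>x. indicator unit_square x * \<bar>\<phi> 1 x\<bar>)" by (simp add: abs_mult)
      fix x
      have "f x * \<phi> 1 x \<le> \<bar>f x\<bar> * \<bar>\<phi> 1 x\<bar>" by (metis abs_ge_self abs_mult)
      also have "\<dots> \<le> 1 * \<bar>\<phi> 1 x\<bar>" by (intro mult_right_mono f1) auto
      finally show "indicator unit_square x * (f x * \<phi> 1 x) \<le> indicator unit_square x * \<bar>\<phi> 1 x\<bar>"
        by (intro mult_left_mono) auto
    qed
    also have "\<dots> \<le> (\<integral>p. indicator slab p * \<bar>h p\<bar> \<partial>lborel)" using E(3) by (simp add: h)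
    also have "\<dots> = (\<integral>p. \<bar>h p\<bar> \<partial>M)"
      unfolding M_def by (subst integral_restrict_space) (auto simp: set_lebesgue_integral_def)
    finally show "c \<le> (\<integral>p. \<bar>h p\<bar> \<partial>M)" .
  next
    have "space_regular (\<lambda>t x. 0)" using space_regular_static[OF near_constant_const] .
    moreover have "time_regular (\<lambda>t x. 0) (\<lambda>t x. 0)"
      by (auto simp: time_regular_def case_prod_beta' intro!: exI[of _ 0] exI[of _ "{}"])
    moreover have "advection (\<lambda>t x. 0) p = 0" for p by (simp add: advection_def case_prod_beta')
    ultimately show "(\<lambda>x. 0, 0) \<in> L"
      unfolding L_def by (intro CollectI exI[of _ "\<lambda>t x. 0"]) auto
  next
    fix h c k d assume "(h, c) \<in> L" "(k, d) \<in> L"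
    then obtain \<phi> \<phi>' \<psi> \<psi>' where *: "space_regular \<phi>" "time_regular \<phi> \<phi>'" "\<forall>x. \<phi> 0 x = 0"
      and h: "h = (\<lambda>p. \<phi>' (fst p) (snd p) + advection \<phi> p)"
      and c: "c = (\<integral>x. indicator unit_square x * (f x * \<phi> 1 x) \<partial>lborel)"
      and **: "space_regular \<psi>" "time_regular \<psi> \<psi>'" "\<forall>x. \<psi> 0 x = 0"
      and k: "k = (\<lambda>p. \<psi>' (fst p) (snd p) + advection \<psi> p)"
      and d: "d = (\<integral>x. indicator unit_square x * (f x * \<psi> 1 x) \<partial>lborel)" unfolding L_def by blast
    have "(\<lambda>x. h x + k x) = (\<lambda>p. (\<phi>' (fst p) (snd p) + \<psi>' (fst p) (snd p)) + advection (\<lambda>t x. \<phi> t x + \<psi> t x) p)"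
      by (simp add: h k advection_add[OF *(1) **(1)] algebra_simps)
    moreover have "c + d = (\<integral>x. indicator unit_square x * (f x * (\<phi> 1 x + \<psi> 1 x)) \<partial>lborel)"
      using fint[OF *] fint[OF **] by (simp add: c d distrib_left)
    ultimately show "(\<lambda>x. h x + k x, c + d) \<in> L"
      using space_regular_add[OF *(1) **(1)] time_regular_add[OF *(2) **(2)] *(3) **(3)
      unfolding L_def
      by (intro CollectI exI[of _ "\<lambda>t x. \<phi> t x + \<psi> t x"] exI[of _ "\<lambda>t x. \<phi>' t x + \<psi>' t x"]) auto
  next
    fix h c a assume "(h, c) \<in> L"
    then obtain \<phi> \<phi>' where *: "space_regular \<phi>" "time_regular \<phi> \<phi>'" "\<forall>x. \<phi> 0 x = 0"
      and h: "h = (\<lambda>p. \<phi>' (fst p) (snd p) + advection \<phi> p)"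
      and c: "c = (\<integral>x. indicator unit_square x * (f x * \<phi> 1 x) \<partial>lborel)" unfolding L_def by blast
    have "(\<lambda>x. a * h x) = (\<lambda>p. a * \<phi>' (fst p) (snd p) + advection (\<lambda>t x. a * \<phi> t x) p)"
      by (simp add: h advection_cmult[OF *(1)] algebra_simps)
    moreover have "a * c = (\<integral>x. indicator unit_square x * (f x * (a * \<phi> 1 x)) \<partial>lborel)"
      by (simp add: c mult_ac flip: integral_mult_right_zero)
    ultimately show "(\<lambda>x. a * h x, a * c) \<in> L"
      using space_regular_cmult[OF *(1), of "\<lambda>t. a" "\<bar>a\<bar>"] time_regular_cmult[OF *(2)] *(3)
      unfolding L_def
      by (intro CollectI exI[of _ "\<lambda>t x. a * \<phi> t x"] exI[of _ "\<lambda>t x. a * \<phi>' t x"]) auto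
  next
    fix \<rho> assume "\<rho> \<in> borel_measurable M" "\<And>x. \<bar>\<rho> x\<bar> \<le> 1"
      "\<And>h c. (h, c) \<in> L \<Longrightarrow> (\<integral>p. \<rho> p * h p \<partial>M) = c"
    then show thesis by (rule that)
  qed
  show thesis
  \<comment> \<open>The representing function belongs to the restricted measure; extending it by 0
    turns integrals over the slab into integrals over space-time.\<close>
  proof (rule that[of "\<lambda>p. indicator slab p * \<rho> p"])
    show "(\<lambda>p. indicator slab p * \<rho> p) \<in> borel_measurable borel"
      using \<rho>(1) unfolding M_def by (subst (asm) borel_measurable_restrict_space_iff) auto
    show "\<bar>indicator slab p * \<rho> p\<bar> \<le> 1" for p using \<rho>(2)[of p] by (simp split: split_indicator)
    fix \<phi> \<phi>' assume *: "space_regular \<phi>" "time_regular \<phi> \<phi>'" "\<And>x. \<phi> 0 x = 0"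
    then have "(\<lambda>p. \<phi>' (fst p) (snd p) + advection \<phi> p, \<integral>x. indicator unit_square x * (f x * \<phi> 1 x) \<partial>lborel) \<in> L"
      unfolding L_def by blast
    from \<rho>(3)[OF this] show "(\<integral>p. indicator slab p * \<rho> p * (\<phi>' (fst p) (snd p) + advection \<phi> p) \<partial>lborel) =
      (\<integral>x. indicator unit_square x * (f x * \<phi> 1 x) \<partial>lborel)"
      unfolding M_def by (subst (asm) integral_restrict_space) (auto simp: set_lebesgue_integral_def mult.assoc)
  qed auto
qed

end

section \<open>The weakly continuous version\<close>

lemma near_constant_bounded:
  assumes "near_constant f" obtains B where "\<And>x. \<bar>f x\<bar> \<le> B"
proof -
  obtain c where c: "test_function (\<lambda>x. f x - c)" using assms by (auto simp: near_constant_def)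
  obtain C where C: "\<And>x. \<bar>f x - c\<bar> \<le> C" using test_function_bounded[OF c] by blast
  have "\<bar>f x\<bar> \<le> C + \<bar>c\<bar>" for x using C[of x] by linarith
  then show thesis by (rule that)
qed

lemma near_constant_borel: "near_constant f \<Longrightarrow> f \<in> borel_measurable borel"
  by (intro smooth_borel near_constant_smooth)

lemma AE_fst_neq: "AE p in lborel. fst (p :: real \<times> (real^2)) \<noteq> t"
proof -
  have "AE p in lborel \<Otimes>\<^sub>M lborel. fst (p :: real \<times> (real^2)) \<noteq> t"
  proof (rule lborel_pair.AE_pair_measure)
    show "AE x in lborel. AE y in lborel. fst (x, y :: real^2) \<noteq> t"
      using AE_lborel_singleton[of t] by eventually_elim simp
  qed measurable
  then show ?thesis unfolding lborel_prod .
qed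

lemma clamp_simps: "z \<le> 0 \<Longrightarrow> max 0 (min 1 z) = (0::real)" "1 \<le> z \<Longrightarrow> max 0 (min 1 z) = (1::real)"
  by auto

text \<open>Every ramp vanishes at \<open>s = t\<close>, hence the open half-line in the
  limit.\<close>

lemma ramp_tendsto:
  "(\<lambda>n. max 0 (min 1 ((s - t) / (1 / real (Suc n))))) \<longlonglongrightarrow> (indicator {t<..} s :: real)"
proof (cases "t < s")
  case True
  obtain N where N: "1 < real N * (s - t)" using ex_less_of_nat_mult[of "s - t" 1] True by auto
  have "max 0 (min 1 ((s - t) / (1 / real (Suc n)))) = (1::real)" if "N \<le> n" for n
  proof -
    have "real N * (s - t) \<le> real (Suc n) * (s - t)" using that True by (intro mult_right_mono) auto
    then have "1 \<le> (s - t) / (1 / real (Suc n))" using N by (simp add: mult.commute)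
    then show ?thesis by simp
  qed
  then have "eventually (\<lambda>n. max 0 (min 1 ((s - t) / (1 / real (Suc n)))) = (1::real)) sequentially"
    by (auto simp: eventually_sequentially)
  then show ?thesis using True by (simp add: tendsto_eventually)
next
  case False
  then have "(s - t) / (1 / real (Suc n)) \<le> 0" for n by (simp add: mult_nonpos_nonneg)
  then have "max 0 (min 1 ((s - t) / (1 / real (Suc n)))) = (0::real)" for n
    by (rule clamp_simps)
  then show ?thesis using False by simp
qed

text \<open>The derivative of a ramp is the normalized indicator of a time window; this is how the
  weak formulation comes to speak about time averages. The two kinks are the exceptional
  times.\<close>

lemma time_regular_ramp:
  assumes \<psi>: "near_constant \<psi>" and h: "0 < h"
  shows "time_regular (\<lambda>s x. max 0 (min 1 ((s - t) / h)) * \<psi> x) (\<lambda>s x. (indicator {t..t+h} s / h) * \<psi> x)"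
proof -
  obtain B where B: "\<And>x. \<bar>\<psi> x\<bar> \<le> B" using near_constant_bounded[OF \<psi>] by blast
  have [measurable]: "\<psi> \<in> borel_measurable borel" by (rule near_constant_borel[OF \<psi>])
  have "(\<lambda>p. (indicator {t..t+h} (fst p) / h) * \<psi> (snd p)) \<in> borel_measurable (borel \<Otimes>\<^sub>M borel)"
    by measurable
  then have meas: "(\<lambda>(s, x). (indicator {t..t+h} s / h) * \<psi> x) \<in> borel_measurable borel"
    by (simp add: borel_prod case_prod_beta')
  have bound: "\<bar>indicator {t..t+h} s / h * \<psi> x\<bar> \<le> 1 / h * B" for s x
    unfolding abs_mult using B[of x] h by (intro mult_mono) (auto split: split_indicator)
  have deriv: "((\<lambda>s. max 0 (min 1 ((s - t) / h)) * \<psi> x) has_real_derivative (indicator {t..t+h} s / h) * \<psi> x) (at s)"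
    if s: "s \<notin> {t, t + h}" for s x
  proof -
    have *: "((\<lambda>s. max 0 (min 1 ((s - t) / h))) has_real_derivative (indicator {t..t+h} s / h)) (at s)"
    proof -
      consider "s < t" | "t < s" "s < t + h" | "t + h < s" using s by force
      then show ?thesis
      proof cases
        case 1
        have "((\<lambda>s. 0) has_real_derivative (indicator {t..t+h} s / h)) (at s)" using 1 by simp
        then show ?thesis
          by (rule has_field_derivative_transform_within_open[where S="{..<t}"])
            (use 1 h in \<open>auto simp: max_def min_def field_simps\<close>)
      next
        case 2
        have "((\<lambda>s. (s - t) / h) has_real_derivative (indicator {t..t+h} s / h)) (at s)"
          using 2 h by (auto intro!: derivative_eq_intros)
        then show ?thesis
          by (rule has_field_derivative_transform_within_open[where S="{t<..<t+h}"])
            (use 2 h in \<open>auto simp: max_def min_def field_simps\<close>)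
      next
        case 3
        have "((\<lambda>s. 1) has_real_derivative (indicator {t..t+h} s / h)) (at s)" using 3 by simp
        then show ?thesis
          by (rule has_field_derivative_transform_within_open[where S="{t+h<..}"])
            (use 3 h in \<open>auto simp: max_def min_def field_simps\<close>)
      qed
    qed
    show ?thesis using DERIV_cmult_right[OF *] by simp
  qed
  have cont: "continuous_on {0..1} (\<lambda>s. max 0 (min 1 ((s - t) / h)) * \<psi> x)" for x
    using h by (intro continuous_intros) auto
  have "\<exists>S. finite S \<and> (\<forall>x. continuous_on {0..1} (\<lambda>s. max 0 (min 1 ((s - t) / h)) * \<psi> x) \<and>
      (\<forall>s\<in>{0<..<1} - S. ((\<lambda>s. max 0 (min 1 ((s - t) / h)) * \<psi> x) has_real_derivative (indicator {t..t+h} s / h) * \<psi> x) (at s)))"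
    by (intro exI[of _ "{t, t + h}"]) (use deriv cont in auto)
  then show ?thesis unfolding time_regular_def using meas bound by blast
qed

section \<open>Time averages of the backward solution\<close>

locale backward_transport = transport_field +
  fixes f :: "real^2 \<Rightarrow> real" and \<rho> :: "real \<times> (real^2) \<Rightarrow> real"
  assumes f_measurable[measurable]: "f \<in> borel_measurable borel" and f_bound: "\<And>x. \<bar>f x\<bar> \<le> 1"
    and \<rho>_measurable[measurable]: "\<rho> \<in> borel_measurable borel" and \<rho>_bound: "\<And>p. \<bar>\<rho> p\<bar> \<le> 1"
    and \<rho>_outside: "\<And>p. p \<notin> slab \<Longrightarrow> \<rho> p = 0"
    and \<rho>_weak: "\<And>\<phi> \<phi>'. space_regular \<phi> \<Longrightarrow> time_regular \<phi> \<phi>' \<Longrightarrow> (\<And>x. \<phi> 0 x = 0) \<Longrightarrow>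
      (\<integral>p. \<rho> p * (\<phi>' (fst p) (snd p) + advection \<phi> p) \<partial>lborel) =
      (\<integral>x. indicator unit_square x * (f x * \<phi> 1 x) \<partial>lborel)"
begin

text \<open>The value that the weak formulation forces on the integral of the solution at time
  \<open>t\<close> against \<open>\<psi>\<close>: the final pairing less the advection accumulated
  after \<open>t\<close>. It makes sense at every single time, although a solution obtained by
  duality is determined only almost everywhere.\<close>

definition pairing :: "(real^2 \<Rightarrow> real) \<Rightarrow> real \<Rightarrow> real" where
  "pairing \<psi> t = (\<integral>x. indicator unit_square x * (f x * \<psi> x) \<partial>lborel) -
     (\<integral>p. indicator {t<..} (fst p) * (\<rho> p * advection (\<lambda>_. \<psi>) p) \<partial>lborel)"

text \<open>The average looks forward from \<open>t\<close>, so that for \<open>0 \<le> t\<close>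
  the corresponding ramp vanishes at time 0, as the test functions in \<open>\<rho>_weak\<close>
  must.\<close>

definition time_average :: "nat \<Rightarrow> real \<Rightarrow> real^2 \<Rightarrow> real" where
  "time_average n t x = real (Suc n) * (\<integral>s. indicator {t..t + 1 / real (Suc n)} s * \<rho> (s, x) \<partial>lborel)"

lemma \<rho>_mult_integrable:
  assumes "integrable lborel (\<lambda>p. indicator slab p * g p)"
  shows "integrable lborel (\<lambda>p. \<rho> p * g p)"
proof (rule Bochner_Integration.integrable_bound[OF assms])
  have eq: "\<rho> p * g p = \<rho> p * (indicator slab p * g p)" for p
    using \<rho>_outside[of p] by (cases "p \<in> slab") auto
  have [measurable]: "(\<lambda>p. indicator slab p * g p) \<in> borel_measurable lborel" using assms by auto
  show "(\<lambda>p. \<rho> p * g p) \<in> borel_measurable lborel" unfolding eq by measurable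
  show "AE p in lborel. norm (\<rho> p * g p) \<le> norm (indicator slab p * g p)"
    unfolding eq using \<rho>_bound by (intro AE_I2) (simp add: abs_mult mult_left_le_one_le)
qed

lemma \<rho>_advection_integrable:
  "space_regular \<phi> \<Longrightarrow> integrable lborel (\<lambda>p. \<rho> p * advection \<phi> p)"
  by (intro \<rho>_mult_integrable advection_integrable)

lemma \<rho>_slice[measurable]: "(\<lambda>s. \<rho> (s, x)) \<in> borel_measurable borel" "(\<lambda>x. \<rho> (s, x)) \<in> borel_measurable borel"
proof -
  have "(\<lambda>s. (s, x)) \<in> borel \<rightarrow>\<^sub>M (borel :: (real \<times> (real^2)) measure)"
    "(\<lambda>x. (s, x)) \<in> borel \<rightarrow>\<^sub>M (borel :: (real \<times> (real^2)) measure)"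
    unfolding borel_prod[symmetric] by measurable
  then show "(\<lambda>s. \<rho> (s, x)) \<in> borel_measurable borel" "(\<lambda>x. \<rho> (s, x)) \<in> borel_measurable borel"
    using \<rho>_measurable by (auto intro: measurable_compose)
qed

lemma \<rho>_pair_measurable[measurable]: "\<rho> \<in> borel_measurable (borel \<Otimes>\<^sub>M borel)"
  using \<rho>_measurable by (simp add: borel_prod)

lemma time_average_measurable: "(\<lambda>(t, x). time_average n t x) \<in> borel_measurable (borel \<Otimes>\<^sub>M borel)"
proof -
  have "(\<lambda>z. (if fst (fst z) \<le> snd z \<and> snd z \<le> fst (fst z) + 1 / real (Suc n) then 1 else 0) * \<rho> (snd z, snd (fst z)))
      \<in> borel_measurable ((borel \<Otimes>\<^sub>M borel) \<Otimes>\<^sub>M lborel)"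
    by measurable
  then have *: "(\<lambda>y. \<integral>s. (if fst y \<le> s \<and> s \<le> fst y + 1 / real (Suc n) then 1 else 0) * \<rho> (s, snd y) \<partial>lborel)
      \<in> borel_measurable (borel \<Otimes>\<^sub>M borel)"
    by (intro lborel.borel_measurable_lebesgue_integral) (simp only: case_prod_beta')
  have ind: "(indicator {t..t + 1 / real (Suc n)} s :: real) = (if t \<le> s \<and> s \<le> t + 1 / real (Suc n) then 1 else 0)" for s t
    by simp
  show ?thesis
    unfolding time_average_def case_prod_beta' ind by (intro borel_measurable_times borel_measurable_const *)
qed

lemma time_average_slice[measurable]: "time_average n t \<in> borel_measurable borel"
  using measurable_compose_Pair1[of t borel, OF _ time_average_measurable[of n]] by simp

lemma time_average_bound: "\<bar>time_average n t x\<bar> \<le> 1"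
proof -
  have "\<bar>\<integral>s. indicator {t..t + 1 / real (Suc n)} s * \<rho> (s, x) \<partial>lborel\<bar> \<le>
      (\<integral>s. indicator {t..t + 1 / real (Suc n)} s \<partial>lborel)"
  proof (rule order_trans[OF integral_abs_bound integral_mono'])
    show "\<bar>indicator {t..t + 1 / real (Suc n)} s * \<rho> (s, x)\<bar> \<le> indicator {t..t + 1 / real (Suc n)} s" for s
      using \<rho>_bound[of "(s, x)"] by (auto split: split_indicator)
  qed auto
  also have "\<dots> = 1 / real (Suc n)" by simp
  finally have "\<bar>time_average n t x\<bar> \<le> real (Suc n) * (1 / real (Suc n))"
    unfolding time_average_def abs_mult by (intro mult_mono) auto
  then show ?thesis by simp
qed

lemma time_average_outside: "x \<notin> unit_square \<Longrightarrow> time_average n t x = 0"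
  unfolding time_average_def using \<rho>_outside by (simp add: slab_def)

lemma space_regular_ramp:
  assumes "near_constant \<psi>"
  shows "space_regular (\<lambda>s x. max 0 (min 1 ((s - t) / h)) * \<psi> x)"
  by (rule space_regular_cmult[OF space_regular_static[OF assms], of _ 1]) auto

text \<open>The test function is \<open>\<psi>\<close> times a ramp that is 0 up to \<open>t\<close>
  and 1 from \<open>t + h\<close> on; since \<open>t + h \<le> 1\<close>, the final value enters
  with full weight.\<close>

lemma window_average:
  assumes \<psi>: "near_constant \<psi>" and t: "0 \<le> t" and h: "0 < h" "t + h \<le> 1"
  shows "(\<integral>p. \<rho> p * (indicator {t..t+h} (fst p) / h * \<psi> (snd p)) \<partial>lborel) =
    (\<integral>x. indicator unit_square x * (f x * \<psi> x) \<partial>lborel) -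
    (\<integral>p. max 0 (min 1 ((fst p - t) / h)) * (\<rho> p * advection (\<lambda>_. \<psi>) p) \<partial>lborel)"
proof -
  define \<theta> where "\<theta> s = max 0 (min 1 ((s - t) / h))" for s
  have "1 \<le> (1 - t) / h" using h by (simp add: field_simps)
  then have \<theta>: "\<theta> 0 = 0" "\<theta> 1 = 1"
    using t h unfolding \<theta>_def by (auto intro!: clamp_simps divide_nonpos_pos)
  have sr: "space_regular (\<lambda>s x. \<theta> s * \<psi> x)" unfolding \<theta>_def by (rule space_regular_ramp[OF \<psi>])
  note tr = time_regular_ramp[OF \<psi> h(1), of t, folded \<theta>_def]
  have adv: "advection (\<lambda>s x. \<theta> s * \<psi> x) p = \<theta> (fst p) * advection (\<lambda>_. \<psi>) p" for p
    using advection_cmult[OF space_regular_static[OF \<psi>], of \<theta>] by simp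
  have "(\<integral>p. \<rho> p * (indicator {t..t+h} (fst p) / h * \<psi> (snd p) + advection (\<lambda>s x. \<theta> s * \<psi> x) p) \<partial>lborel) =
      (\<integral>x. indicator unit_square x * (f x * \<psi> x) \<partial>lborel)"
    using \<rho>_weak[OF sr tr] \<theta> by simp
  moreover have adv_int: "integrable lborel (\<lambda>p. \<rho> p * advection (\<lambda>s x. \<theta> s * \<psi> x) p)"
    by (rule \<rho>_advection_integrable[OF sr])
  moreover have "integrable lborel (\<lambda>p. \<rho> p * (indicator {t..t+h} (fst p) / h * \<psi> (snd p)))"
  proof -
    have "integrable lborel (\<lambda>p. \<rho> p * (indicator {t..t+h} (fst p) / h * \<psi> (snd p) + advection (\<lambda>s x. \<theta> s * \<psi> x) p))"
      using energy_estimate(1)[OF sr tr] \<theta> by (intro \<rho>_mult_integrable) simp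
    from Bochner_Integration.integrable_diff[OF this adv_int] show ?thesis by (simp add: distrib_left)
  qed
  ultimately show ?thesis
    unfolding adv by (simp add: distrib_left \<theta>_def mult_ac)
qed

lemma time_average_integrable:
  assumes \<psi>: "near_constant \<psi>"
  shows "integrable lborel (\<lambda>x. time_average n t x * \<psi> x)"
proof -
  obtain B where B: "\<And>x. \<bar>\<psi> x\<bar> \<le> B" using near_constant_bounded[OF \<psi>] by blast
  have [measurable]: "\<psi> \<in> borel_measurable borel" by (rule near_constant_borel[OF \<psi>])
  show ?thesis
  proof (rule Bochner_Integration.integrable_bound[of _ "\<lambda>x. B * indicator unit_square x"])
    show "AE x in lborel. norm (time_average n t x * \<psi> x) \<le> norm (B * indicat_real unit_square x)"
    proof (rule AE_I2)
      fix x
      have "\<bar>time_average n t x\<bar> * \<bar>\<psi> x\<bar> \<le> 1 * \<bar>B\<bar>"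
        using B[of x] by (intro mult_mono time_average_bound) auto
      then show "norm (time_average n t x * \<psi> x) \<le> norm (B * indicat_real unit_square x)"
        using time_average_outside[of x] by (auto simp: abs_mult split: split_indicator)
    qed
  qed (use unit_square_finite in auto)
qed

text \<open>Fubini reduces the integral to \<open>window_average\<close>; as the windows shrink, the
  ramps tend to the indicator of the times after \<open>t\<close>, dominated by the integrable
  function \<open>F\<close>. There are no exceptional times, which is what makes a version at every
  single time possible.\<close>

lemma time_average_pairing:
  assumes \<psi>: "near_constant \<psi>" and t: "0 \<le> t" "t < 1"
  shows "(\<lambda>n. \<integral>x. time_average n t x * \<psi> x \<partial>lborel) \<longlonglongrightarrow> pairing \<psi> t"
proof -
  obtain B where B: "\<And>x. \<bar>\<psi> x\<bar> \<le> B" using near_constant_bounded[OF \<psi>] by blast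
  have [measurable]: "\<psi> \<in> borel_measurable borel" by (rule near_constant_borel[OF \<psi>])
  define F where "F p = \<rho> p * advection (\<lambda>_. \<psi>) p" for p
  have F: "integrable lborel F"
    unfolding F_def by (rule \<rho>_advection_integrable[OF space_regular_static[OF \<psi>]])
  then have [measurable]: "F \<in> borel_measurable (borel \<Otimes>\<^sub>M borel)" by (simp add: borel_prod)
  have fub: "(\<integral>x. time_average n t x * \<psi> x \<partial>lborel) =
      (\<integral>p. \<rho> p * (indicator {t..t + 1 / real (Suc n)} (fst p) / (1 / real (Suc n)) * \<psi> (snd p)) \<partial>lborel)" for n
  proof -
    define G where "G s x = \<rho> (s, x) * (indicator {t..t + 1 / real (Suc n)} s / (1 / real (Suc n)) * \<psi> x)" for s x
    have "integrable lborel (case_prod G)"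
    proof (rule Bochner_Integration.integrable_bound[of _ "\<lambda>p. (real (Suc n) * B) * indicator slab p"])
      have "case_prod G \<in> borel_measurable (borel \<Otimes>\<^sub>M borel)" unfolding G_def by measurable
      then show "case_prod G \<in> borel_measurable lborel" by (simp add: borel_prod)
      show "AE p in lborel. norm (case_prod G p) \<le> norm ((real (Suc n) * B) * indicat_real slab p)"
      proof (rule AE_I2)
        fix p :: "real \<times> (real^2)"
        have "\<bar>\<rho> p\<bar> * \<bar>indicator {t..t + 1 / real (Suc n)} (fst p) / (1 / real (Suc n)) * \<psi> (snd p)\<bar> \<le> 1 * (real (Suc n) * \<bar>B\<bar>)"
          unfolding abs_mult using B[of "snd p"]
          by (intro mult_mono \<rho>_bound) (auto split: split_indicator)
        then show "norm (case_prod G p) \<le> norm ((real (Suc n) * B) * indicat_real slab p)"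
          using \<rho>_outside[of p] unfolding G_def case_prod_beta'
          by (cases "p \<in> slab") (simp_all add: abs_mult)
      qed
    qed (use slab_finite in auto)
    then have "(\<integral>x. (\<integral>s. G s x \<partial>lborel) \<partial>lborel) = (\<integral>p. case_prod G p \<partial>lborel)"
      using lborel_pair.integral_snd[of G] by (simp add: lborel_prod)
    moreover have "(\<integral>s. G s x \<partial>lborel) = time_average n t x * \<psi> x" for x
    proof -
      have "G s x = (real (Suc n) * \<psi> x) * (indicator {t..t + 1 / real (Suc n)} s * \<rho> (s, x))" for s
        by (simp add: G_def)
      then show ?thesis by (simp only: integral_mult_right_zero time_average_def mult_ac)
    qed
    ultimately show ?thesis by (simp add: G_def case_prod_beta')
  qed
  have "(\<lambda>n. \<integral>p. max 0 (min 1 ((fst p - t) / (1 / real (Suc n)))) * F p \<partial>lborel) \<longlonglongrightarrow>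
      (\<integral>p. indicator {t<..} (fst p) * F p \<partial>lborel)"
  proof (rule integral_dominated_convergence[where w="\<lambda>p. norm (F p)"])
    have "(\<lambda>p. indicator {t<..} (fst p) * F p) \<in> borel_measurable (borel \<Otimes>\<^sub>M borel)" by measurable
    then show "(\<lambda>p. indicator {t<..} (fst p) * F p) \<in> borel_measurable lborel" by (simp add: borel_prod)
    have "(\<lambda>p. max 0 (min 1 ((fst p - t) / (1 / real (Suc n)))) * F p) \<in> borel_measurable (borel \<Otimes>\<^sub>M borel)" for n by measurable
    then show "(\<lambda>p. max 0 (min 1 ((fst p - t) / (1 / real (Suc n)))) * F p) \<in> borel_measurable lborel" for n
      by (simp add: borel_prod)
    show "AE p in lborel. (\<lambda>n. max 0 (min 1 ((fst p - t) / (1 / real (Suc n)))) * F p) \<longlonglongrightarrow> indicator {t<..} (fst p) * F p"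
      by (intro AE_I2 tendsto_mult ramp_tendsto tendsto_const)
    show "AE p in lborel. norm (max 0 (min 1 ((fst p - t) / (1 / real (Suc n)))) * F p) \<le> norm (F p)" for n
    proof (rule AE_I2)
      fix p
      have "\<bar>max 0 (min 1 ((fst p - t) / (1 / real (Suc n))))\<bar> * \<bar>F p\<bar> \<le> 1 * \<bar>F p\<bar>"
        by (intro mult_right_mono) auto
      then show "norm (max 0 (min 1 ((fst p - t) / (1 / real (Suc n)))) * F p) \<le> norm (F p)"
        by (simp only: real_norm_def abs_mult mult_1)
    qed
  qed (use F in auto)
  then have lim: "(\<lambda>n. (\<integral>x. indicator unit_square x * (f x * \<psi> x) \<partial>lborel) -
      (\<integral>p. max 0 (min 1 ((fst p - t) / (1 / real (Suc n)))) * F p \<partial>lborel)) \<longlonglongrightarrow> pairing \<psi> t"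
    unfolding pairing_def F_def by (intro tendsto_diff tendsto_const)
  \<comment> \<open>From \<open>N\<close> on the window starting at \<open>t\<close> ends before the
    final time.\<close>
  obtain N where N: "1 / real (Suc N) < 1 - t" using t reals_Archimedean[of "1 - t"] by (auto simp: inverse_eq_divide)
  have eq: "(\<integral>x. time_average n t x * \<psi> x \<partial>lborel) = (\<integral>x. indicator unit_square x * (f x * \<psi> x) \<partial>lborel) -
      (\<integral>p. max 0 (min 1 ((fst p - t) / (1 / real (Suc n)))) * F p \<partial>lborel)" if "N \<le> n" for n
  proof -
    have "1 / real (Suc n) \<le> 1 / real (Suc N)" using that by (intro divide_left_mono) auto
    then have "t + 1 / real (Suc n) \<le> 1" using N by linarith
    then show ?thesis
      unfolding fub F_def by (intro window_average[OF \<psi> t(1)]) auto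
  qed
  have "eventually (\<lambda>n. (\<integral>x. indicator unit_square x * (f x * \<psi> x) \<partial>lborel) -
      (\<integral>p. max 0 (min 1 ((fst p - t) / (1 / real (Suc n)))) * F p \<partial>lborel) = (\<integral>x. time_average n t x * \<psi> x \<partial>lborel)) sequentially"
    unfolding eventually_sequentially using eq[symmetric] by blast
  from Lim_transform_eventually[OF lim this] show ?thesis .
qed

text \<open>Lebesgue differentiation along the time line of each fixed \<open>x\<close>. Exchanging
  the order of the two almost-everywhere quantifiers requires joint measurability of the set of
  convergence.\<close>

lemma time_average_AE: "AE p in lborel. (\<lambda>n. time_average n (fst p) (snd p)) \<longlonglongrightarrow> \<rho> p"
proof -
  have pointwise: "AE t in lborel. (\<lambda>n. time_average n t x) \<longlonglongrightarrow> \<rho> (t, x)" for x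
  proof -
    have int: "set_integrable lborel {a..b} (\<lambda>s. \<rho> (s, x))" for a b
      unfolding set_integrable_def
    proof (rule Bochner_Integration.integrable_bound[of _ "indicator {a..b} :: real \<Rightarrow> real"])
      show "AE s in lborel. norm (indicat_real {a..b} s *\<^sub>R \<rho> (s, x)) \<le> norm (indicat_real {a..b} s)"
        using \<rho>_bound by (intro AE_I2) (simp split: split_indicator)
    qed (auto simp: emeasure_lborel_Icc_eq)
    have "(\<lambda>s. \<rho> (s, x)) integrable_on cbox a b" for a b
      using set_borel_integral_eq_integral(1)[OF int] by simp
    then obtain N where N: "negligible N"
      "\<And>t e. \<lbrakk>t \<notin> N; 0 < e\<rbrakk> \<Longrightarrow> \<exists>d>0. \<forall>h. 0 < h \<and> h < d \<longrightarrow>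
          norm (integral (cbox t (t + h *\<^sub>R One)) (\<lambda>s. \<rho> (s, x)) /\<^sub>R h ^ DIM(real) - \<rho> (t, x)) < e"
      using integrable_ccontinuous_explicit[of "\<lambda>s. \<rho> (s, x)"] by metis
    have conv: "(\<lambda>n. time_average n t x) \<longlonglongrightarrow> \<rho> (t, x)" if tN: "t \<notin> N" for t
    proof (rule LIMSEQ_I)
      fix e :: real assume "0 < e"
      then obtain d where d: "0 < d" "\<And>h. 0 < h \<Longrightarrow> h < d \<Longrightarrow>
          \<bar>integral {t..t + h} (\<lambda>s. \<rho> (s, x)) / h - \<rho> (t, x)\<bar> < e"
        using N(2)[OF tN \<open>0 < e\<close>] by (auto simp: divide_inverse mult.commute)
      obtain k where k: "1 / real (Suc k) < d" using d(1) reals_Archimedean[of d] by (auto simp: inverse_eq_divide)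
      have "norm (time_average n t x - \<rho> (t, x)) < e" if "k \<le> n" for n
      proof -
        have "1 / real (Suc n) \<le> 1 / real (Suc k)" using that by (intro divide_left_mono) auto
        then have "\<bar>integral {t..t + 1 / real (Suc n)} (\<lambda>s. \<rho> (s, x)) / (1 / real (Suc n)) - \<rho> (t, x)\<bar> < e"
          using k by (intro d(2)) auto
        moreover have "integral {t..t + 1 / real (Suc n)} (\<lambda>s. \<rho> (s, x)) / (1 / real (Suc n)) = time_average n t x"
          using set_borel_integral_eq_integral(2)[OF int, of t "t + 1 / real (Suc n)"]
          by (simp add: time_average_def set_lebesgue_integral_def mult.commute)
        ultimately show ?thesis by simp
      qed
      then show "\<exists>k. \<forall>n\<ge>k. norm (time_average n t x - \<rho> (t, x)) < e" by blast
    qed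
    have "N \<in> null_sets lebesgue" using N(1) by (simp add: negligible_iff_null_sets)
    then have "AE t in lebesgue. t \<notin> N" by (rule AE_not_in)
    then have "AE t in lborel. t \<notin> N" by (simp add: AE_completion_iff)
    then show ?thesis by eventually_elim (rule conv)
  qed
  have meas: "{p \<in> space (lborel \<Otimes>\<^sub>M lborel). (\<lambda>n. time_average n (fst p) (snd p)) \<longlonglongrightarrow> \<rho> p} \<in> sets (lborel \<Otimes>\<^sub>M lborel)"
  proof -
    have [measurable]: "(\<lambda>p. time_average n (fst p) (snd p)) \<in> borel_measurable (borel \<Otimes>\<^sub>M borel)" for n
      using time_average_measurable[of n] by (simp add: case_prod_beta')
    have "Measurable.pred (borel \<Otimes>\<^sub>M borel) (\<lambda>p. (\<lambda>n. time_average n (fst p) (snd p)) \<longlonglongrightarrow> \<rho> p)"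
      by measurable
    then show ?thesis by (simp add: pred_def space_pair_measure cong: sets_pair_measure_cong)
  qed
  have "AE x in lborel. AE t in lborel. (\<lambda>n. time_average n t x) \<longlonglongrightarrow> \<rho> (t, x)"
    by (rule AE_I2) (rule pointwise)
  then have "AE t in lborel. AE x in lborel. (\<lambda>n. time_average n t x) \<longlonglongrightarrow> \<rho> (t, x)"
    using meas by (subst lborel_pair.AE_commute) auto
  then have "AE p in lborel \<Otimes>\<^sub>M lborel. (\<lambda>n. time_average n (fst p) (snd p)) \<longlonglongrightarrow> \<rho> p"
    using meas by (intro lborel_pair.AE_pair_measure) auto
  then show ?thesis unfolding lborel_prod .
qed

text \<open>At each time in [0, 1) the averages converge weakly, and convex combinations of their
  tails converge almost everywhere to a function \<open>R t\<close> with the same pairings. At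
  almost every point of space-time the averages converge to \<open>\<rho>\<close>, hence so do the
  combinations, and \<open>R\<close> is a version of \<open>\<rho>\<close>.\<close>

lemma weakly_continuous_version:
  obtains R where "(\<lambda>(t, x). R t x) \<in> borel_measurable borel" "\<And>t x. \<bar>R t x\<bar> \<le> 1"
    "\<And>t x. x \<notin> unit_square \<Longrightarrow> R t x = 0"
    "\<And>\<psi> t. near_constant \<psi> \<Longrightarrow> 0 \<le> t \<Longrightarrow> t < 1 \<Longrightarrow> (\<integral>x. R t x * \<psi> x \<partial>lborel) = pairing \<psi> t"
    "AE p in lborel. R (fst p) (snd p) = \<rho> p"
proof -
  \<comment> \<open>A density rather than a restriction keeps the whole plane as the underlying
    space: the measure becomes finite, while its measurable sets are still all Borel sets.\<close>
  define M where "M = density lborel (indicator unit_square :: real^2 \<Rightarrow> ennreal)"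
  have sets_M[simp]: "sets M = sets borel" and space_M[simp]: "space M = UNIV" by (simp_all add: M_def)
  have M_fin: "finite_measure M"
    unfolding M_def using unit_square_finite by (intro finite_measureI) (simp add: emeasure_density)
  have sets_pair: "sets (borel \<Otimes>\<^sub>M M) = sets (borel \<Otimes>\<^sub>M borel)" by (intro sets_pair_measure_cong) simp_all
  obtain g T where g: "(\<lambda>(t, x). g t x) \<in> borel_measurable ((borel :: real measure) \<Otimes>\<^sub>M M)" "\<And>t x. \<bar>g t x\<bar> \<le> (1::real)"
    and T: "\<And>k t. t \<in> space borel \<Longrightarrow> mix_tail k (T k t)"
    and lim: "\<And>t. t \<in> space borel \<Longrightarrow> AE x in M. (\<lambda>k. mix_eval (\<lambda>n. time_average n t x) (T k t)) \<longlonglongrightarrow> g t x"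
  proof (rule measurable_mazur[OF M_fin, of time_average "borel :: real measure"])
    show "(\<lambda>(t, x). time_average n t x) \<in> borel_measurable (borel \<Otimes>\<^sub>M M)" for n
      using time_average_measurable[of n] by (simp add: measurable_cong_sets[OF sets_pair refl])
  qed (auto intro: time_average_bound)
  define R where "R t x = indicator unit_square x * g t x" for t x
  have "(\<lambda>(t, x). g t x) \<in> borel_measurable (borel \<Otimes>\<^sub>M borel)"
    using g(1) by (simp add: measurable_cong_sets[OF sets_pair refl])
  then have [measurable]: "(\<lambda>p. g (fst p) (snd p)) \<in> borel_measurable (borel \<Otimes>\<^sub>M borel)"
    by (simp add: case_prod_beta')
  have Rm: "(\<lambda>p. R (fst p) (snd p)) \<in> borel_measurable (borel \<Otimes>\<^sub>M borel)"
    unfolding R_def by measurable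
  have Rslice[measurable]: "R t \<in> borel_measurable borel" for t
    using measurable_compose_Pair1[of t borel, OF _ Rm] by simp
  have R1: "\<bar>R t x\<bar> \<le> 1" for t x using g(2)[of t x] by (simp add: R_def split: split_indicator)
  have R0: "R t x = 0" if "x \<notin> unit_square" for t x using that by (simp add: R_def)
  have zero: "mix_eval (\<lambda>n. 0) S = 0" for S by (induction S) auto
  have limR: "AE x in lborel. (\<lambda>k. mix_eval (\<lambda>n. time_average n t x) (T k t)) \<longlonglongrightarrow> R t x" for t
  proof -
    have "AE x in lborel. 0 < (indicator unit_square x :: ennreal) \<longrightarrow>
        (\<lambda>k. mix_eval (\<lambda>n. time_average n t x) (T k t)) \<longlonglongrightarrow> g t x"
    proof -
      have "AE x in M. (\<lambda>k. mix_eval (\<lambda>n. time_average n t x) (T k t)) \<longlonglongrightarrow> g t x" by (rule lim) simp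
      then show ?thesis unfolding M_def by (subst (asm) AE_density) auto
    qed
    then show ?thesis
    proof eventually_elim
      case (elim x)
      show ?case
      proof (cases "x \<in> unit_square")
        case False
        then show ?thesis by (simp add: R_def time_average_outside zero)
      qed (use elim in \<open>simp add: R_def\<close>)
    qed
  qed
  have pair: "(\<integral>x. R t x * \<psi> x \<partial>lborel) = pairing \<psi> t" if \<psi>: "near_constant \<psi>" and t: "0 \<le> t" "t < 1" for \<psi> t
  proof -
    obtain B where B: "\<And>x. \<bar>\<psi> x\<bar> \<le> B" using near_constant_bounded[OF \<psi>] by blast
    have [measurable]: "\<psi> \<in> borel_measurable borel" by (rule near_constant_borel[OF \<psi>])
    note int = time_average_integrable[OF \<psi>]
    have "(\<lambda>k. \<integral>x. mix_eval (\<lambda>n. time_average n t x * \<psi> x) (T k t) \<partial>lborel) \<longlonglongrightarrow> (\<integral>x. R t x * \<psi> x \<partial>lborel)"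
    proof (rule integral_dominated_convergence[where w="\<lambda>x. \<bar>B\<bar> * indicator unit_square x"])
      show "(\<lambda>x. mix_eval (\<lambda>n. time_average n t x * \<psi> x) (T k t)) \<in> borel_measurable lborel" for k
        using mix_eval_integral(1)[of lborel "\<lambda>n x. time_average n t x * \<psi> x", OF int] by auto
      show "AE x in lborel. (\<lambda>k. mix_eval (\<lambda>n. time_average n t x * \<psi> x) (T k t)) \<longlonglongrightarrow> R t x * \<psi> x"
        unfolding mix_eval_mult using limR[of t] by eventually_elim (intro tendsto_mult tendsto_const)
      show "AE x in lborel. norm (mix_eval (\<lambda>n. time_average n t x * \<psi> x) (T k t)) \<le> \<bar>B\<bar> * indicator unit_square x" for k
      proof (rule AE_I2)
        fix x
        have "\<bar>mix_eval (\<lambda>n. time_average n t x) (T k t)\<bar> * \<bar>\<psi> x\<bar> \<le> 1 * \<bar>B\<bar>"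
          using B[of x] by (intro mult_mono mix_eval_abs_le time_average_bound) auto
        then show "norm (mix_eval (\<lambda>n. time_average n t x * \<psi> x) (T k t)) \<le> \<bar>B\<bar> * indicator unit_square x"
          unfolding mix_eval_mult
          by (cases "x \<in> unit_square") (simp_all add: abs_mult time_average_outside zero)
      qed
    qed (use unit_square_finite in auto)
    moreover have "(\<lambda>k. \<integral>x. mix_eval (\<lambda>n. time_average n t x * \<psi> x) (T k t) \<partial>lborel) \<longlonglongrightarrow> pairing \<psi> t"
      unfolding mix_eval_integral(2)[of lborel "\<lambda>n x. time_average n t x * \<psi> x", OF int]
      by (rule mix_eval_tendsto[OF time_average_pairing[OF \<psi> t] T]) simp
    ultimately show ?thesis using LIMSEQ_unique by blast
  qed
  have "AE p in lborel. R (fst p) (snd p) = \<rho> p"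
  proof -
    have "AE p in lborel \<Otimes>\<^sub>M lborel. (\<lambda>n. time_average n (fst p) (snd p)) \<longlonglongrightarrow> \<rho> p"
      using time_average_AE unfolding lborel_prod .
    from lborel_pair.AE_pair[OF this]
    have "AE t in lborel. AE x in lborel. R t x = \<rho> (t, x)"
    proof eventually_elim
      case (elim t)
      then show ?case using limR[of t]
      proof eventually_elim
        case (elim x)
        have "(\<lambda>k. mix_eval (\<lambda>n. time_average n t x) (T k t)) \<longlonglongrightarrow> \<rho> (t, x)"
          by (rule mix_eval_tendsto[OF _ T]) (use elim in auto)
        then show ?case using elim(2) LIMSEQ_unique by blast
      qed
    qed
    moreover have "{p \<in> space (lborel \<Otimes>\<^sub>M lborel). R (fst p) (snd p) = \<rho> p} \<in> sets (lborel \<Otimes>\<^sub>M lborel)"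
    proof -
      note Rm[measurable]
      have "Measurable.pred (borel \<Otimes>\<^sub>M borel) (\<lambda>p. R (fst p) (snd p) = \<rho> p)" by measurable
      then show ?thesis by (simp add: pred_def space_pair_measure cong: sets_pair_measure_cong)
    qed
    ultimately have "AE p in lborel \<Otimes>\<^sub>M lborel. R (fst p) (snd p) = \<rho> p"
      by (intro lborel_pair.AE_pair_measure) auto
    then show ?thesis unfolding lborel_prod .
  qed
  with Rm R1 R0 pair show thesis
    by (intro that[of R]) (auto simp: borel_prod case_prod_beta')
qed

text \<open>From time 1 on no advection is left, so \<open>pairing\<close> takes the value that
  belongs to \<open>f\<close>. Together with \<open>pairing_continuous\<close> this glues the two
  halves of the evolution continuously at time 1.\<close>

lemma pairing_end:
  assumes "1 \<le> t" shows "pairing \<psi> t = (\<integral>x. indicator unit_square x * (f x * \<psi> x) \<partial>lborel)"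
proof -
  have zero: "indicator {t<..} (fst p) * (\<rho> p * advection (\<lambda>_. \<psi>) p) = 0" for p
    using assms \<rho>_outside[of p] by (cases "p \<in> slab") (auto simp: slab_def split: split_indicator)
  show ?thesis unfolding pairing_def zero by simp
qed

text \<open>As the time bound varies, the integrands converge off one time slice, which is a null
  set, so dominated convergence applies.\<close>

lemma pairing_continuous:
  assumes \<psi>: "near_constant \<psi>" shows "continuous_on A (pairing \<psi>)"
proof -
  define F where "F p = \<rho> p * advection (\<lambda>_. \<psi>) p" for p
  have F: "integrable lborel F"
    unfolding F_def by (rule \<rho>_advection_integrable[OF space_regular_static[OF \<psi>]])
  then have [measurable]: "F \<in> borel_measurable (borel \<Otimes>\<^sub>M borel)" by (simp add: borel_prod)
  have "(\<lambda>n. \<integral>p. indicator {a n<..} (fst p) * F p \<partial>lborel) \<longlonglongrightarrow> (\<integral>p. indicator {t<..} (fst p) * F p \<partial>lborel)"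
    if a: "a \<longlonglongrightarrow> t" for a t
  proof (rule integral_dominated_convergence[where w="\<lambda>p. norm (F p)"])
    have *: "(\<lambda>p. indicator {t<..} (fst p) * F p) \<in> borel_measurable (borel \<Otimes>\<^sub>M borel)" for t by measurable
    show "(\<lambda>p. indicator {t<..} (fst p) * F p) \<in> borel_measurable lborel" using * by (simp add: borel_prod)
    show "(\<lambda>p. indicator {a n<..} (fst p) * F p) \<in> borel_measurable lborel" for n using * by (simp add: borel_prod)
    show "AE p in lborel. (\<lambda>n. indicator {a n<..} (fst p) * F p) \<longlonglongrightarrow> indicator {t<..} (fst p) * F p"
      using AE_fst_neq[of t]
    proof eventually_elim
      case (elim p)
      have "eventually (\<lambda>n. (indicator {a n<..} (fst p) :: real) = indicator {t<..} (fst p)) sequentially"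
      proof (cases "t < fst p")
        case True
        then have "eventually (\<lambda>n. a n < fst p) sequentially" using order_tendstoD(2)[OF a] by blast
        then show ?thesis using True by (auto elim: eventually_mono)
      next
        case False
        then have "fst p < t" using elim by simp
        then have "eventually (\<lambda>n. fst p < a n) sequentially" using order_tendstoD(1)[OF a] by blast
        then show ?thesis using False by (auto elim: eventually_mono)
      qed
      then have "(\<lambda>n. indicator {a n<..} (fst p) :: real) \<longlonglongrightarrow> indicator {t<..} (fst p)"
        by (rule tendsto_eventually)
      then show ?case by (intro tendsto_mult tendsto_const)
    qed
    show "AE p in lborel. norm (indicator {a n<..} (fst p) * F p) \<le> norm (F p)" for n
      by (intro AE_I2) (simp split: split_indicator)
  qed (use F in auto)
  then have "continuous_on UNIV (\<lambda>t. \<integral>p. indicator {t<..} (fst p) * F p \<partial>lborel)"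
    by (intro continuous_on_sequentiallyI) auto
  then have "continuous_on UNIV (pairing \<psi>)"
    unfolding pairing_def F_def by (intro continuous_intros)
  then show ?thesis using continuous_on_subset by blast
qed

text \<open>Subtracting the initial slice makes the test function vanish at time 0, as
  \<open>\<rho>_weak\<close> requires. The subtracted function is static, and its final pairing and
  its advection combine to \<open>pairing\<close> at time 0.\<close>

lemma weak_formulation:
  assumes \<Phi>: "test_function \<Phi>"
  shows "(\<integral>p. \<rho> p * (frechet_derivative \<Phi> (at p) (1, 0) + advection (\<lambda>t x. \<Phi> (t, x)) p) \<partial>lborel) =
    (\<integral>x. indicator unit_square x * (f x * \<Phi> (1, x)) \<partial>lborel) - pairing (\<lambda>x. \<Phi> (0, x)) 0"
proof -
  have s: "smooth \<Phi>" by (rule test_function_smooth[OF \<Phi>])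
  define \<psi> where "\<psi> x = \<Phi> (0, x)" for x
  define \<phi>' where "\<phi>' t x = frechet_derivative \<Phi> (at (t, x)) (1, 0)" for t x
  have nc: "near_constant (\<lambda>x. \<Phi> (t, x))" for t by (intro near_constant_test test_function_slice \<Phi>)
  then have \<psi>: "near_constant \<psi>" by (simp add: \<psi>_def[abs_def])
  have nm: "near_constant (\<lambda>x. -1 * \<psi> x)" by (rule near_constant_cmult[OF \<psi>])
  have sr\<Phi>: "space_regular (\<lambda>t x. \<Phi> (t, x))" by (rule space_regular_test[OF \<Phi>])
  have sr: "space_regular (\<lambda>t x. \<Phi> (t, x) + -1 * \<psi> x)"
    by (intro space_regular_add space_regular_static nm sr\<Phi>)
  have tr: "time_regular (\<lambda>t x. \<Phi> (t, x) + -1 * \<psi> x) \<phi>'"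
  proof -
    have "(\<lambda>p. frechet_derivative \<Phi> (at p) (1, 0)) \<in> borel_measurable borel"
      by (rule smooth_borel[OF smooth_derivative[OF s]])
    moreover obtain B where B: "\<And>p. \<bar>frechet_derivative \<Phi> (at p) (1, 0)\<bar> \<le> B"
      using test_function_bounded[OF test_function_derivative[OF \<Phi>, of "(1, 0)"]] by blast
    moreover have D: "((\<lambda>t. \<Phi> (t, x) + -1 * \<psi> x) has_real_derivative \<phi>' t x) (at t)" for t x
      using DERIV_add[OF has_real_derivative_slice[OF s, of x t] DERIV_const[of "-1 * \<psi> x"]] by (simp add: \<phi>'_def)
    moreover have "continuous_on {0..1} (\<lambda>t. \<Phi> (t, x) + -1 * \<psi> x)" for x
      using D by (intro DERIV_continuous_on) (blast intro: has_field_derivative_at_within)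
    ultimately show ?thesis
      unfolding time_regular_def by (auto simp: \<phi>'_def case_prod_beta' intro!: exI[of _ B] exI[of _ "{}"])
  qed
  have adv: "advection (\<lambda>t x. \<Phi> (t, x) + -1 * \<psi> x) p = advection (\<lambda>t x. \<Phi> (t, x)) p - advection (\<lambda>_. \<psi>) p" for p
    using advection_add[OF sr\<Phi> space_regular_static[OF nm]]
      advection_cmult[OF space_regular_static[OF \<psi>], of "\<lambda>_. -1"] by simp
  define X where "X p = \<rho> p * (\<phi>' (fst p) (snd p) + advection (\<lambda>t x. \<Phi> (t, x)) p)" for p
  define Y where "Y p = \<rho> p * advection (\<lambda>_. \<psi>) p" for p
  have Y: "integrable lborel Y"
    unfolding Y_def by (rule \<rho>_advection_integrable[OF space_regular_static[OF \<psi>]])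
  have XY: "\<rho> p * (\<phi>' (fst p) (snd p) + advection (\<lambda>t x. \<Phi> (t, x) + -1 * \<psi> x) p) = X p - Y p" for p
    unfolding adv X_def Y_def by (simp add: algebra_simps)
  have "integrable lborel (\<lambda>p. X p - Y p)"
    unfolding XY[symmetric] using energy_estimate(1)[OF sr tr] by (intro \<rho>_mult_integrable) (simp add: \<psi>_def)
  from Bochner_Integration.integrable_add[OF this Y] have X: "integrable lborel X" by simp
  have sq: "integrable lborel (\<lambda>x. indicator unit_square x * (f x * \<Phi> (t, x)))" for t
  proof -
    obtain B where B: "\<And>p. \<bar>\<Phi> p\<bar> \<le> B" using test_function_bounded[OF \<Phi>] by blast
    have [measurable]: "(\<lambda>x. \<Phi> (t, x)) \<in> borel_measurable borel" by (rule near_constant_borel[OF nc])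
    show ?thesis
    proof (rule Bochner_Integration.integrable_bound[of _ "\<lambda>x. B * indicator unit_square x"])
      show "AE x in lborel. norm (indicat_real unit_square x * (f x * \<Phi> (t, x))) \<le> norm (B * indicat_real unit_square x)"
      proof (rule AE_I2)
        fix x
        have "\<bar>f x\<bar> * \<bar>\<Phi> (t, x)\<bar> \<le> 1 * \<bar>B\<bar>" using B[of "(t, x)"] by (intro mult_mono f_bound) auto
        then show "norm (indicat_real unit_square x * (f x * \<Phi> (t, x))) \<le> norm (B * indicat_real unit_square x)"
          by (simp add: abs_mult split: split_indicator)
      qed
    qed (use unit_square_finite in auto)
  qed
  have "(\<integral>p. X p \<partial>lborel) - (\<integral>p. Y p \<partial>lborel) = (\<integral>p. X p - Y p \<partial>lborel)" using X Y by simp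
  also have "\<dots> = (\<integral>x. indicator unit_square x * (f x * (\<Phi> (1, x) + -1 * \<psi> x)) \<partial>lborel)"
    unfolding XY[symmetric] by (rule \<rho>_weak[OF sr tr]) (simp add: \<psi>_def)
  also have "\<dots> = (\<integral>x. indicator unit_square x * (f x * \<Phi> (1, x)) \<partial>lborel) - (\<integral>x. indicator unit_square x * (f x * \<psi> x) \<partial>lborel)"
    using sq[of 1] sq[of 0] by (simp add: right_diff_distrib \<psi>_def)
  finally have "(\<integral>p. X p \<partial>lborel) = (\<integral>x. indicator unit_square x * (f x * \<Phi> (1, x)) \<partial>lborel) -
      ((\<integral>x. indicator unit_square x * (f x * \<psi> x) \<partial>lborel) - (\<integral>p. Y p \<partial>lborel))" by simp
  \<comment> \<open>\<open>\<rho>\<close> vanishes before time 0, and the slice at time 0 is a null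
    set.\<close>
  moreover have "(\<integral>p. indicator {0<..} (fst p) * Y p \<partial>lborel) = (\<integral>p. Y p \<partial>lborel)"
  proof (rule integral_cong_AE)
    have "Y \<in> borel_measurable (borel \<Otimes>\<^sub>M borel)" using Y by (simp add: borel_prod)
    then have "(\<lambda>p. indicator {0<..} (fst p) * Y p) \<in> borel_measurable (borel \<Otimes>\<^sub>M borel)" by measurable
    then show "(\<lambda>p. indicator {0<..} (fst p) * Y p) \<in> borel_measurable lborel" by (simp add: borel_prod)
    show "AE p in lborel. indicator {0<..} (fst p) * Y p = Y p"
      using AE_fst_neq[of 0]
    proof eventually_elim
      case (elim p)
      then show ?case using \<rho>_outside[of p] by (cases "p \<in> slab") (auto simp: Y_def slab_def)
    qed
  qed (use Y in auto)
  ultimately show ?thesis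
    by (simp add: pairing_def X_def \<phi>'_def \<psi>_def[abs_def] Y_def)
qed

end

section \<open>Evolutions that become stationary\<close>

lemma time_interval_infinity: "time_interval \<infinity> = {0..}"
  by (auto simp: time_interval_def)

text \<open>Confines tests on the half-line to a bounded time interval, on which the field is
  integrable.\<close>

lemma test_function_time_horizon:
  fixes \<Phi> :: "real \<times> (real^2) \<Rightarrow> real"
  assumes \<Phi>: "test_function \<Phi>"
  obtains N where "1 < N" "\<And>t x. N \<le> t \<Longrightarrow> \<Phi> (t, x) = 0" "\<And>t x v. N \<le> t \<Longrightarrow> frechet_derivative \<Phi> (at (t, x)) v = 0"
proof -
  have "bounded (tsupport \<Phi>)" using \<Phi> by (simp add: test_function_def compact_imp_bounded)
  then obtain B where B: "\<And>p. p \<in> tsupport \<Phi> \<Longrightarrow> norm p \<le> B" by (auto simp: bounded_iff)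
  define N where "N = max B 1 + 1"
  have out: "(t, x) \<notin> tsupport \<Phi>" if "N \<le> t" for t x
  proof
    assume "(t, x) \<in> tsupport \<Phi>"
    then have "norm (t, x) \<le> B" by (rule B)
    then have "\<bar>t\<bar> \<le> B" using norm_fst_le[of t x] by simp
    then show False using that by (simp add: N_def)
  qed
  show thesis
  proof (rule that)
    show "1 < N" by (simp add: N_def)
    show "\<Phi> (t, x) = 0" if "N \<le> t" for t x
      using out[OF that, of x] closure_subset[of "{x. \<Phi> x \<noteq> 0}"] by (auto simp: tsupport_def)
    show "frechet_derivative \<Phi> (at (t, x)) v = 0" if "N \<le> t" for t x v
      by (rule frechet_derivative_outside_support[OF out[OF that]])
  qed
qed

text \<open>\<open>B\<close> splits into a time part, which the fundamental theorem of calculus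
  integrates to the boundary term at time 1, and an advection part, whose space integral is zero at
  almost every time by stationarity.\<close>

lemma stationary_weak_formulation:
  fixes f :: "real^2 \<Rightarrow> real" and u :: "real \<Rightarrow> real^2 \<Rightarrow> real^2" and \<Phi> :: "real \<times> (real^2) \<Rightarrow> real"
  assumes u: "\<And>N. set_integrable lborel ({0..N} \<times> UNIV) (\<lambda>(t, x). u t x)"
    and [measurable]: "f \<in> borel_measurable borel" and f1: "\<And>x. \<bar>f x\<bar> \<le> 1"
    and f0: "\<And>x. x \<notin> unit_square \<Longrightarrow> f x = 0"
    and stat: "AE t in lborel. 1 \<le> t \<longrightarrow> (\<forall>\<psi>. test_function \<psi> \<longrightarrow>
      (\<integral>x. f x * frechet_derivative \<psi> (at x) (u t x) \<partial>lborel) = 0)"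
    and \<Phi>: "test_function \<Phi>"
  defines "B \<equiv> \<lambda>p. indicator {1..} (fst p) * (f (snd p) * frechet_derivative \<Phi> (at p) (1, u (fst p) (snd p)))"
  shows "integrable lborel B" and "(\<integral>p. B p \<partial>lborel) = - (\<integral>x. f x * \<Phi> (1, x) \<partial>lborel)"
proof -
  have s: "smooth \<Phi>" by (rule test_function_smooth[OF \<Phi>])
  obtain N where N: "1 < N" "\<And>t x. N \<le> t \<Longrightarrow> \<Phi> (t, x) = 0"
    "\<And>t x v. N \<le> t \<Longrightarrow> frechet_derivative \<Phi> (at (t, x)) v = 0"
    using test_function_time_horizon[OF \<Phi>] by blast
  have Dm[measurable]: "(\<lambda>p. frechet_derivative \<Phi> (at p) v) \<in> borel_measurable (borel \<Otimes>\<^sub>M borel)" for v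
    using smooth_borel[OF smooth_derivative[OF s, of v]] by (simp add: borel_prod)
  define A where "A p = indicator {1..N} (fst p) * (f (snd p) * frechet_derivative \<Phi> (at p) (1, 0))" for p
  define C where "C p = indicator {1..N} (fst p) * (f (snd p) * frechet_derivative (\<lambda>x. \<Phi> (fst p, x)) (at (snd p)) (u (fst p) (snd p)))" for p
  have slice: "frechet_derivative (\<lambda>x. \<Phi> (t, x)) (at x) v = frechet_derivative \<Phi> (at (t, x)) (0, v)" for t x v
    using frechet_derivative_eqI[OF has_derivative_slice[OF s]] by simp
  have BAC: "B p = A p + C p" for p
    using N(3)[of "fst p" "snd p"] frechet_derivative_space_time[OF s, of "fst p" "snd p" "u (fst p) (snd p)"]
    by (cases "fst p \<le> N") (auto simp: B_def A_def C_def slice algebra_simps split: split_indicator)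
  have box_fin: "emeasure lborel ({1..N} \<times> unit_square) < \<infinity>"
  proof (rule emeasure_bounded_finite)
    show "bounded ({1..N} \<times> unit_square)" unfolding unit_square_box by (intro bounded_Times) auto
  qed
  have box_sets: "{1..N} \<times> unit_square \<in> sets borel" by (intro borel_Times) auto
  have A_int: "integrable lborel A"
  proof -
    obtain K where K: "\<And>p. \<bar>frechet_derivative \<Phi> (at p) (1, 0)\<bar> \<le> K"
      using test_function_bounded[OF test_function_derivative[OF \<Phi>, of "(1, 0)"]] by blast
    show ?thesis
    proof (rule Bochner_Integration.integrable_bound[of _ "\<lambda>p. K * indicator ({1..N} \<times> unit_square) p"])
      have "A \<in> borel_measurable (borel \<Otimes>\<^sub>M borel)" unfolding A_def by measurable
      then show "A \<in> borel_measurable lborel" by (simp add: borel_prod)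
      show "AE p in lborel. norm (A p) \<le> norm (K * indicat_real ({1..N} \<times> unit_square) p)"
      proof (rule AE_I2)
        fix p :: "real \<times> (real^2)"
        have "\<bar>f (snd p)\<bar> * \<bar>frechet_derivative \<Phi> (at p) (1, 0)\<bar> \<le> 1 * \<bar>K\<bar>"
          using K[of p] by (intro mult_mono f1) auto
        then show "norm (A p) \<le> norm (K * indicat_real ({1..N} \<times> unit_square) p)"
          using f0[of "snd p"] by (cases p) (auto simp: A_def abs_mult indicator_times split: split_indicator)
      qed
    qed (use box_fin box_sets in auto)
  qed
  \<comment> \<open>The cut-off makes the field integrable over space-time; after \<open>N\<close>
    the test function is gone.\<close>
  define w where "w p = indicator ({0..N} \<times> UNIV) p *\<^sub>R u (fst p) (snd p)" for p :: "real \<times> (real^2)"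
  have w_int: "integrable lborel w"
    using u[of N] by (simp add: set_integrable_def w_def[abs_def] case_prod_beta')
  then have [measurable]: "w \<in> borel_measurable (borel \<Otimes>\<^sub>M borel)" by (simp add: borel_prod)
  have C_eq: "C p = (\<Sum>b\<in>Basis. (w p \<bullet> b) * (indicator {1..N} (fst p) * (f (snd p) * frechet_derivative \<Phi> (at p) (0, b))))" for p
  proof (cases "fst p \<in> {1..N}")
    case True
    then have "w p = u (fst p) (snd p)" by (cases p) (auto simp: w_def)
    then show ?thesis
      using True frechet_derivative_expand[OF smooth_differentiable[OF smooth_slice[OF s]], of "fst p" "snd p" "u (fst p) (snd p)"]
      by (simp add: C_def slice sum_distrib_left mult_ac)
  qed (simp add: C_def)
  have C_int: "integrable lborel C"
    unfolding C_eq[abs_def]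
  proof (rule Bochner_Integration.integrable_sum)
    fix b :: "real^2" assume b: "b \<in> Basis"
    obtain K where K: "\<And>p. \<bar>frechet_derivative \<Phi> (at p) (0, b)\<bar> \<le> K"
      using test_function_bounded[OF test_function_derivative[OF \<Phi>, of "(0, b)"]] by blast
    show "integrable lborel (\<lambda>p. (w p \<bullet> b) * (indicator {1..N} (fst p) * (f (snd p) * frechet_derivative \<Phi> (at p) (0, b))))"
    proof (rule Bochner_Integration.integrable_bound[of _ "\<lambda>p. \<bar>K\<bar> * norm (w p)"])
      have "(\<lambda>p. (w p \<bullet> b) * (indicator {1..N} (fst p) * (f (snd p) * frechet_derivative \<Phi> (at p) (0, b))))
          \<in> borel_measurable (borel \<Otimes>\<^sub>M borel)" by measurable
      then show "(\<lambda>p. (w p \<bullet> b) * (indicator {1..N} (fst p) * (f (snd p) * frechet_derivative \<Phi> (at p) (0, b))))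
          \<in> borel_measurable lborel" by (simp add: borel_prod)
      show "AE p in lborel. norm ((w p \<bullet> b) * (indicator {1..N} (fst p) * (f (snd p) * frechet_derivative \<Phi> (at p) (0, b))))
          \<le> norm (\<bar>K\<bar> * norm (w p))"
      proof (rule AE_I2)
        fix p :: "real \<times> (real^2)"
        have "\<bar>f (snd p)\<bar> * \<bar>frechet_derivative \<Phi> (at p) (0, b)\<bar> \<le> 1 * \<bar>K\<bar>"
          using K[of p] by (intro mult_mono f1) auto
        then have "\<bar>indicator {1..N} (fst p) * (f (snd p) * frechet_derivative \<Phi> (at p) (0, b))\<bar> \<le> \<bar>K\<bar>"
          by (simp add: abs_mult split: split_indicator)
        then have "\<bar>w p \<bullet> b\<bar> * \<bar>indicator {1..N} (fst p) * (f (snd p) * frechet_derivative \<Phi> (at p) (0, b))\<bar> \<le> norm (w p) * \<bar>K\<bar>"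
          by (intro mult_mono Basis_le_norm b) auto
        then show "norm ((w p \<bullet> b) * (indicator {1..N} (fst p) * (f (snd p) * frechet_derivative \<Phi> (at p) (0, b))))
          \<le> norm (\<bar>K\<bar> * norm (w p))" by (simp only: real_norm_def abs_mult abs_norm_cancel abs_idempotent mult.commute)
      qed
    qed (use w_int in auto)
  qed
  show "integrable lborel B"
    using A_int C_int by (simp add: BAC[abs_def])
  have "(\<integral>p. A p \<partial>lborel) = (\<integral>x. (\<integral>t. A (t, x) \<partial>lborel) \<partial>lborel)"
    using lborel_pair.integral_snd[of "\<lambda>t x. A (t, x)"] A_int by (simp add: lborel_prod)
  also have "\<dots> = (\<integral>x. - (f x * \<Phi> (1, x)) \<partial>lborel)"
  proof (rule Bochner_Integration.integral_cong[OF refl])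
    fix x
    have hi: "((\<lambda>t. frechet_derivative \<Phi> (at (t, x)) (1, 0)) has_integral (\<Phi> (N, x) - \<Phi> (1, x))) {1..N}"
      using N(1) has_real_derivative_slice[OF s]
      by (intro fundamental_theorem_of_calculus)
        (auto simp: has_real_derivative_iff_has_vector_derivative intro: has_vector_derivative_at_within)
    have si: "set_integrable lborel {1..N} (\<lambda>t. frechet_derivative \<Phi> (at (t, x)) (1, 0))"
      unfolding set_integrable_def
    proof (rule borel_integrable_compact)
      have "continuous_on UNIV (\<lambda>p. frechet_derivative \<Phi> (at p) (1, 0))"
        by (rule smooth_continuous[OF smooth_derivative[OF s]])
      then show "continuous_on {1..N} (\<lambda>t. frechet_derivative \<Phi> (at (t, x)) (1, 0))"
        by (rule continuous_on_compose2) (auto intro!: continuous_intros)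
    qed auto
    have "(LINT t:{1..N}|lborel. frechet_derivative \<Phi> (at (t, x)) (1, 0)) = - \<Phi> (1, x)"
      unfolding set_borel_integral_eq_integral(2)[OF si] integral_unique[OF hi] using N(2)[of N x] by simp
    then have I: "(\<integral>t. indicator {1..N} t * frechet_derivative \<Phi> (at (t, x)) (1, 0) \<partial>lborel) = - \<Phi> (1, x)"
      by (simp add: set_lebesgue_integral_def)
    have "(\<integral>t. A (t, x) \<partial>lborel) = (\<integral>t. f x * (indicator {1..N} t * frechet_derivative \<Phi> (at (t, x)) (1, 0)) \<partial>lborel)"
      by (simp add: A_def mult_ac)
    then show "(\<integral>t. A (t, x) \<partial>lborel) = - (f x * \<Phi> (1, x))"
      unfolding integral_mult_right_zero I by simp
  qed
  finally have A_val: "(\<integral>p. A p \<partial>lborel) = - (\<integral>x. f x * \<Phi> (1, x) \<partial>lborel)" by simp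
  have C_int': "integrable (lborel \<Otimes>\<^sub>M lborel) C" using C_int by (simp add: lborel_prod)
  have "(\<integral>p. C p \<partial>lborel) = (\<integral>t. (\<integral>x. C (t, x) \<partial>lborel) \<partial>lborel)"
    using lborel_pair.integral_fst'[OF C_int'] by (simp add: lborel_prod)
  also have "\<dots> = (\<integral>t. (0::real) \<partial>(lborel :: real measure))"
  proof (rule integral_cong_AE)
    show "AE t in lborel. (\<integral>x. C (t, x) \<partial>lborel) = 0"
      using stat
    proof eventually_elim
      case (elim t)
      show ?case
      proof (cases "t \<in> {1..N}")
        case True
        then show ?thesis using elim test_function_slice[OF \<Phi>, of t] by (simp add: C_def)
      qed (simp add: C_def)
    qed
  qed (use lborel_pair.integrable_fst'[OF C_int'] in auto)
  finally show "(\<integral>p. B p \<partial>lborel) = - (\<integral>x. f x * \<Phi> (1, x) \<partial>lborel)"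
    using A_int C_int A_val by (simp add: BAC[abs_def])
qed

text \<open>The backward solution on [0, 1) is continued by \<open>f\<close>. In the weak
  formulation the boundary terms at time 1 from the two sides cancel, and weak continuity across
  time 1 holds because the pairings on both sides are given by the continuous function
  \<open>pairing\<close>.\<close>

lemma evolution_to_stationary_profile:
  fixes f :: "real^2 \<Rightarrow> real"
  assumes u: "velocity_field \<infinity> u"
    and f[measurable]: "f \<in> borel_measurable borel" and f1: "\<And>x. \<bar>f x\<bar> \<le> 1"
    and f0: "\<And>x. x \<notin> unit_square \<Longrightarrow> f x = 0" and mean: "(\<integral>x. f x \<partial>lborel) = 0"
    and stat: "AE t in lborel. 1 \<le> t \<longrightarrow> (\<forall>\<psi>. test_function \<psi> \<longrightarrow>
      (\<integral>x. f x * frechet_derivative \<psi> (at x) (u t x) \<partial>lborel) = 0)"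
  obtains \<rho>0 \<rho> where "initial_datum \<rho>0" "continuity_solution \<infinity> u \<rho>0 \<rho>" "\<And>t. 1 \<le> t \<Longrightarrow> \<rho> t = f"
proof -
  have u_int: "set_integrable lborel ({0..N} \<times> UNIV) (\<lambda>(t, x). u t x)" for N
  proof -
    have "{0..} \<inter> {..N} = {0..N}" by auto
    then show ?thesis using u unfolding velocity_field_def time_interval_infinity by metis
  qed
  interpret transport_field u
  proof
    show "set_integrable lborel ({0..1} \<times> UNIV) (\<lambda>(t, x). u t x)" by (rule u_int)
    show "u t x = 0" if "t \<in> {0..1}" "x \<notin> unit_square" for t x
      using u that by (auto simp: velocity_field_def time_interval_infinity)
    have "AE t in lborel. t \<in> {0..} \<longrightarrow>
      (\<forall>\<psi>. test_function \<psi> \<longrightarrow> (LINT x|lborel. frechet_derivative \<psi> (at x) (u t x)) = 0)"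
      using u unfolding velocity_field_def time_interval_infinity by blast
    then show "AE t in lborel. t \<in> {0..1} \<longrightarrow>
      (\<forall>\<psi>. test_function \<psi> \<longrightarrow> (LINT x|lborel. frechet_derivative \<psi> (at x) (u t x)) = 0)"
      by eventually_elim auto
  qed
  obtain \<rho> where \<rho>: "\<rho> \<in> borel_measurable borel" "\<And>p. \<bar>\<rho> p\<bar> \<le> 1" "\<And>p. p \<notin> slab \<Longrightarrow> \<rho> p = 0"
    "\<And>\<phi> \<phi>'. space_regular \<phi> \<Longrightarrow> time_regular \<phi> \<phi>' \<Longrightarrow> (\<And>x. \<phi> 0 x = 0) \<Longrightarrow>
      (\<integral>p. \<rho> p * (\<phi>' (fst p) (snd p) + advection \<phi> p) \<partial>lborel) =
      (\<integral>x. indicator unit_square x * (f x * \<phi> 1 x) \<partial>lborel)"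
    using backward_solution[OF f f1] by blast
  interpret backward_transport u f \<rho>
    by unfold_locales (use f f1 \<rho> in auto)
  obtain R where R: "(\<lambda>(t, x). R t x) \<in> borel_measurable borel" "\<And>t x. \<bar>R t x\<bar> \<le> 1"
    "\<And>t x. x \<notin> unit_square \<Longrightarrow> R t x = 0"
    "\<And>\<psi> t. near_constant \<psi> \<Longrightarrow> 0 \<le> t \<Longrightarrow> t < 1 \<Longrightarrow> (\<integral>x. R t x * \<psi> x \<partial>lborel) = pairing \<psi> t"
    "AE p in lborel. R (fst p) (snd p) = \<rho> p"
    using weakly_continuous_version by blast
  have Rm[measurable]: "(\<lambda>p. R (fst p) (snd p)) \<in> borel_measurable (borel \<Otimes>\<^sub>M borel)"
    using R(1) by (simp add: borel_prod case_prod_beta')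
  have f_ind: "indicator unit_square x * (f x * c) = f x * c" for x c
    using f0[of x] by (cases "x \<in> unit_square") auto
  define E where "E t x = (if t < 1 then R t x else f x)" for t x
  have E_pairing: "(\<integral>x. E t x * \<psi> x \<partial>lborel) = pairing \<psi> t" if "test_function \<psi>" "0 \<le> t" for \<psi> t
  proof (cases "t < 1")
    case True
    then show ?thesis using R(4)[OF near_constant_test[OF that(1)] that(2)] by (simp add: E_def)
  next
    case False
    then show ?thesis using pairing_end[of t \<psi>] by (simp add: E_def f_ind)
  qed
  have datum: "initial_datum (R 0)"
    unfolding initial_datum_def
  proof (intro conjI allI impI)
    show "R 0 \<in> borel_measurable borel"
      using measurable_compose_Pair1[of 0 borel, OF _ Rm] by simp
    show "\<exists>C. \<forall>x. \<bar>R 0 x\<bar> \<le> C" using R(2) by blast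
    show "R 0 x = 0" if "x \<notin> unit_square" for x using that by (rule R(3))
    \<comment> \<open>The constant 1 as a test function has no advection, so the total mass at time
      0 is that of \<open>f\<close>.\<close>
    have "(\<integral>x. R 0 x * 1 \<partial>lborel) = pairing (\<lambda>x. 1) 0"
      by (rule R(4)[OF near_constant_const]) auto
    also have "\<dots> = 0"
    proof -
      have "advection (\<lambda>_ _. 1) p = 0" for p by (simp add: advection_def case_prod_beta')
      moreover have fi: "indicator unit_square x * f x = f x" for x using f_ind[of x 1] by simp
      ultimately show ?thesis unfolding pairing_def mult_1_right fi by (simp add: mean)
    qed
    finally show "(\<integral>x. R 0 x \<partial>lborel) = 0" by simp
  qed
  have "continuity_solution \<infinity> u (R 0) E"
    unfolding continuity_solution_def time_interval_infinity
  proof (intro conjI allI impI ballI)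
    have "(\<lambda>p. (if 0 \<le> fst p then 1 else 0) *\<^sub>R (if fst p < 1 then R (fst p) (snd p) else f (snd p))) \<in> borel_measurable (borel \<Otimes>\<^sub>M borel)"
      by measurable
    moreover have "(\<lambda>p. indicator ({0..} \<times> UNIV) p *\<^sub>R (case p of (t, x) \<Rightarrow> E t x)) =
        (\<lambda>p. (if 0 \<le> fst p then 1 else 0) *\<^sub>R (if fst p < 1 then R (fst p) (snd p) else f (snd p)))"
      by (auto simp: fun_eq_iff E_def split: split_indicator)
    ultimately show "set_borel_measurable lborel ({0..} \<times> UNIV) (\<lambda>(t, x). E t x)"
      unfolding set_borel_measurable_def by (simp add: borel_prod)
    show "\<exists>C. \<forall>t\<in>{0..}. \<forall>x. \<bar>E t x\<bar> \<le> C"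
      by (rule exI[of _ 1]) (use R(2) f1 in \<open>auto simp: E_def\<close>)
    show "E t x = 0" if "x \<notin> unit_square" for t x using R(3) f0 that by (simp add: E_def)
    show "AE x in lborel. E 0 x = R 0 x" by (simp add: E_def)
    show "continuous_on {0..} (\<lambda>t. LINT x|lborel. E t x * \<psi> x)" if \<psi>: "test_function \<psi>" for \<psi>
      using pairing_continuous[OF near_constant_test[OF \<psi>], of "{0..}"]
      by (rule continuous_on_eq) (simp add: E_pairing[OF \<psi>])
    fix \<Phi> :: "real \<times> (real^2) \<Rightarrow> real" assume "test_function \<Phi> \<and> tsupport \<Phi> \<subseteq> {(t, x). ereal t < \<infinity>}"
    then have \<Phi>: "test_function \<Phi>" by blast
    have s: "smooth \<Phi>" by (rule test_function_smooth[OF \<Phi>])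
    define B where "B p = indicator {1..} (fst p) * (f (snd p) * frechet_derivative \<Phi> (at p) (1, u (fst p) (snd p)))" for p
    define A where "A p = \<rho> p * (frechet_derivative \<Phi> (at p) (1, 0) + advection (\<lambda>t x. \<Phi> (t, x)) p)" for p
    note B = stationary_weak_formulation[OF u_int f f1 f0 stat \<Phi>, folded B_def]
    have A_int: "integrable lborel A"
      unfolding A_def
    proof (rule \<rho>_mult_integrable)
      have [measurable]: "(\<lambda>p. frechet_derivative \<Phi> (at p) (1, 0)) \<in> borel_measurable borel"
        by (rule smooth_borel[OF smooth_derivative[OF s]])
      obtain K where K: "\<And>p. \<bar>frechet_derivative \<Phi> (at p) (1, 0)\<bar> \<le> K"
        using test_function_bounded[OF test_function_derivative[OF \<Phi>, of "(1, 0)"]] by blast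
      have "integrable lborel (\<lambda>p. indicator slab p * frechet_derivative \<Phi> (at p) (1, 0))"
      proof (rule Bochner_Integration.integrable_bound[of _ "\<lambda>p. \<bar>K\<bar> * indicator slab p"])
        show "AE p in lborel. norm (indicat_real slab p * frechet_derivative \<Phi> (at p) (1, 0)) \<le> norm (\<bar>K\<bar> * indicat_real slab p)"
          using order_trans[OF K abs_ge_self] by (intro AE_I2) (simp add: abs_mult split: split_indicator)
      qed (use slab_finite in auto)
      then show "integrable lborel (\<lambda>p. indicator slab p * (frechet_derivative \<Phi> (at p) (1, 0) + advection (\<lambda>t x. \<Phi> (t, x)) p))"
        using advection_integrable[OF space_regular_test[OF \<Phi>]] by (simp add: distrib_left)
    qed
    have A_val: "(\<integral>p. A p \<partial>lborel) = (\<integral>x. f x * \<Phi> (1, x) \<partial>lborel) - (\<integral>x. R 0 x * \<Phi> (0, x) \<partial>lborel)"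
      using weak_formulation[OF \<Phi>] R(4)[OF near_constant_test[OF test_function_slice[OF \<Phi>]], of 0 0]
      by (simp add: A_def f_ind)
    have "(LINT (t, x):{0..} \<times> UNIV|lborel. E t x * frechet_derivative \<Phi> (at (t, x)) (1, u t x)) = (\<integral>p. A p + B p \<partial>lborel)"
      unfolding set_lebesgue_integral_def
    proof (rule integral_cong_AE)
      obtain N where N: "1 < N" "\<And>t x. N \<le> t \<Longrightarrow> \<Phi> (t, x) = 0"
        "\<And>t x v. N \<le> t \<Longrightarrow> frechet_derivative \<Phi> (at (t, x)) v = 0"
        using test_function_time_horizon[OF \<Phi>] by blast
      \<comment> \<open>The field is given as integrable only on bounded time intervals, so for
        measurability the integrand is rewritten with the field cut off at \<open>N\<close>; after
        \<open>N\<close> the derivatives of \<open>\<Phi>\<close> vanish anyway.\<close>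
      define w where "w p = indicator ({0..N} \<times> UNIV) p *\<^sub>R u (fst p) (snd p)" for p :: "real \<times> (real^2)"
      have "integrable lborel w"
        using u_int[of N] by (simp add: set_integrable_def w_def[abs_def] case_prod_beta')
      then have [measurable]: "w \<in> borel_measurable (borel \<Otimes>\<^sub>M borel)" by (simp add: borel_prod)
      have [measurable]: "(\<lambda>p. frechet_derivative \<Phi> (at p) v) \<in> borel_measurable (borel \<Otimes>\<^sub>M borel)" for v
        using smooth_borel[OF smooth_derivative[OF s, of v]] by (simp add: borel_prod)
      have "indicat_real ({0..} \<times> UNIV) p *\<^sub>R (case p of (t, x) \<Rightarrow> E t x * frechet_derivative \<Phi> (at (t, x)) (1, u t x)) =
          (if 0 \<le> fst p then 1 else 0) * ((if fst p < 1 then R (fst p) (snd p) else f (snd p)) *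
          (frechet_derivative \<Phi> (at p) (1, 0) + (\<Sum>b\<in>Basis. (w p \<bullet> b) * frechet_derivative \<Phi> (at p) (0, b))))" for p
      proof (cases "0 \<le> fst p")
        case True
        obtain t x where p: "p = (t, x)" by (cases p)
        have "frechet_derivative \<Phi> (at p) (1, u t x) =
            frechet_derivative \<Phi> (at p) (1, 0) + (\<Sum>b\<in>Basis. (w p \<bullet> b) * frechet_derivative \<Phi> (at p) (0, b))"
        proof (cases "N \<le> t")
          case True
          then show ?thesis using N(3) by (simp add: p)
        next
          case False
          then have "w p = u t x" using \<open>0 \<le> fst p\<close> by (simp add: w_def p)
          have slice: "frechet_derivative (\<lambda>x. \<Phi> (t, x)) (at x) v = frechet_derivative \<Phi> (at (t, x)) (0, v)" for v
            by (simp only: frechet_derivative_eqI[OF has_derivative_slice[OF s]])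
          show ?thesis
            unfolding \<open>w p = u t x\<close> unfolding p frechet_derivative_space_time[OF s, of t x "u t x"]
            unfolding frechet_derivative_expand[OF smooth_differentiable[OF smooth_slice[OF s]], of t x "u t x"]
            unfolding slice by (rule refl)
        qed
        then show ?thesis using True by (simp add: p E_def)
      qed (auto simp: indicator_times case_prod_beta')
      moreover have "(\<lambda>p. (if 0 \<le> fst p then 1 else 0) * ((if fst p < 1 then R (fst p) (snd p) else f (snd p)) *
          (frechet_derivative \<Phi> (at p) (1, 0) + (\<Sum>b\<in>Basis. (w p \<bullet> b) * frechet_derivative \<Phi> (at p) (0, b)))))
          \<in> borel_measurable (borel \<Otimes>\<^sub>M borel)"
        by measurable
      ultimately show "(\<lambda>p. indicat_real ({0..} \<times> UNIV) p *\<^sub>R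
          (case p of (t, x) \<Rightarrow> E t x * frechet_derivative \<Phi> (at (t, x)) (1, u t x))) \<in> borel_measurable lborel"
        by (simp add: borel_prod)
      show "AE p in lborel. indicat_real ({0..} \<times> UNIV) p *\<^sub>R
          (case p of (t, x) \<Rightarrow> E t x * frechet_derivative \<Phi> (at (t, x)) (1, u t x)) = A p + B p"
        \<comment> \<open>Replacing \<open>R\<close> by \<open>\<rho>\<close> and leaving out time
          1, where both \<open>A\<close> and \<open>B\<close> would contribute, changes only a null
          set.\<close>
        using R(5) AE_fst_neq[of 1]
      proof eventually_elim
        case (elim p)
        obtain t x where p: "p = (t, x)" by (cases p)
        have split: "frechet_derivative \<Phi> (at (t, x)) (1, u t x) = frechet_derivative \<Phi> (at p) (1, 0) + advection (\<lambda>t x. \<Phi> (t, x)) p"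
          using frechet_derivative_space_time[OF s, of t x "u t x"] by (simp add: p advection_def)
        consider "t < 0" | "0 \<le> t" "t < 1" | "1 < t" using elim p by force
        then show ?case
        proof cases
          case 1
          then show ?thesis using \<rho>_outside[of p] by (simp add: p A_def B_def slab_def)
        next
          case 2
          then show ?thesis using elim(1) split by (simp add: p A_def B_def E_def)
        next
          case 3
          then show ?thesis using \<rho>_outside[of p] by (simp add: p A_def B_def E_def slab_def)
        qed
      qed
    qed (use A_int B in auto)
    also have "\<dots> = - (\<integral>x. R 0 x * \<Phi> (0, x) \<partial>lborel)" using A_int B A_val by simp
    finally show "(LINT (t, x):{0..} \<times> UNIV|lborel. E t x * frechet_derivative \<Phi> (at (t, x)) (1, u t x)) +
        (LINT x|lborel. R 0 x * \<Phi> (0, x)) = 0" by simp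
  qed
  moreover have "E t = f" if "1 \<le> t" for t using that by (auto simp: E_def)
  ultimately show thesis using datum that by blast
qed

section \<open>Cellular fields do not cross tile boundaries\<close>

lemma AE_component_neq: "AE x in lborel. (x :: real^2) $ i \<noteq> c"
proof -
  have "negligible {x :: real^2. x \<bullet> axis i 1 = c}"
    by (rule negligible_standard_hyperplane) (auto simp: axis_in_Basis_iff)
  then have "{x :: real^2. x $ i = c} \<in> null_sets lebesgue"
    by (simp add: negligible_iff_null_sets inner_axis)
  then have "AE x in lebesgue. x \<notin> {x :: real^2. x $ i = c}" by (rule AE_not_in)
  then show ?thesis by (simp add: AE_completion_iff)
qed

lemma integral_affine:
  fixes G :: "'a::euclidean_space \<Rightarrow> real"
  assumes G: "integrable lborel G" and c: "c \<noteq> 0"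
  shows "(\<integral>x. G x \<partial>lborel) = \<bar>c\<bar> ^ DIM('a) * (\<integral>y. G (r + c *\<^sub>R y) \<partial>lborel)"
proof -
  have [measurable]: "G \<in> borel_measurable borel" using G by auto
  have "(\<integral>x. G x \<partial>lborel) = (\<integral>x. G x \<partial>density (distr lborel borel (\<lambda>x. r + c *\<^sub>R x)) (\<lambda>_. \<bar>c\<bar> ^ DIM('a)))"
    using lborel_affine[OF c, of r] by simp
  also have "\<dots> = (\<integral>x. \<bar>c\<bar> ^ DIM('a) * G x \<partial>distr lborel borel (\<lambda>x. r + c *\<^sub>R x))"
    by (subst integral_density) (auto)
  also have "\<dots> = (\<integral>y. \<bar>c\<bar> ^ DIM('a) * G (r + c *\<^sub>R y) \<partial>lborel)"
    by (subst integral_distr) auto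
  finally show ?thesis by simp
qed

lemma AE_affine_time:
  fixes P :: "real \<Rightarrow> bool"
  assumes P: "AE t in lborel. P t" and c: "0 < c"
  shows "AE t in lborel. P ((t - a) / c)"
proof -
  obtain N where N: "N \<in> null_sets lborel" "{t \<in> space lborel. \<not> P t} \<subseteq> N"
    using P by (auto simp: eventually_ae_filter)
  then have [measurable]: "N \<in> sets borel" by auto
  have "AE t in lborel. (- a / c) + (1 / c) * t \<notin> N"
    by (rule AE_borel_affine) (use c AE_not_in[OF N(1)] in auto)
  then show ?thesis
  proof eventually_elim
    case (elim t)
    have "(t - a) / c = (- a / c) + (1 / c) * t" using c by (simp add: field_simps)
    then show ?case using elim N(2) by auto
  qed
qed

lemma tile_borel[measurable]: "tile d k h \<in> sets borel"
  unfolding tile_def by measurable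

lemma tile_rescale:
  assumes "0 < d"
  shows "(x - tile_center d k h) /\<^sub>R d \<in> unit_square \<longleftrightarrow> x \<in> tile d k h"
proof -
  have "-1/2 < inverse d * (y - (-1/2 + (real m + 1/2) * d)) \<longleftrightarrow> -1/2 + real m * d < y"
    "inverse d * (y - (-1/2 + (real m + 1/2) * d)) < 1/2 \<longleftrightarrow> y < -1/2 + (real m + 1) * d" for y m
  proof -
    define X where "X = y + 1/2 - real m * d"
    have X: "inverse d * (y - (-1/2 + (real m + 1/2) * d)) = X / d - 1/2"
      using assms by (simp add: X_def field_simps)
    have "-1/2 < X / d - 1/2 \<longleftrightarrow> 0 < X" "X / d - 1/2 < 1/2 \<longleftrightarrow> X < d"
      using assms by (simp_all add: field_simps)
    then show "-1/2 < inverse d * (y - (-1/2 + (real m + 1/2) * d)) \<longleftrightarrow> -1/2 + real m * d < y"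
      "inverse d * (y - (-1/2 + (real m + 1/2) * d)) < 1/2 \<longleftrightarrow> y < -1/2 + (real m + 1) * d"
      unfolding X by (auto simp: X_def distrib_right)
  qed
  then show ?thesis
    unfolding tile_def unit_square_def tile_center_def
    by (simp only: mem_Collect_eq vector_scaleR_component vector_minus_component vector_2 real_scaleR_def)
qed

text \<open>On each tile the field is a rescaled building block, so it is divergence free across the
  boundary of the tile: no mass crosses it.\<close>

lemma tile_flux_zero:
  assumes d: "0 < d" and \<tau>: "0 < \<tau>" and u0: "velocity_field 1 u0"
    and eq: "\<And>t x. t \<in> {a ..< a + \<tau>} \<Longrightarrow> x \<in> tile d k h \<Longrightarrow>
      u t x = (d / \<tau>) *\<^sub>R u0 ((t - a) / \<tau>) ((x - tile_center d k h) /\<^sub>R d)"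
  shows "AE t in lborel. t \<in> {a ..< a + \<tau>} \<longrightarrow> (\<forall>\<psi>. test_function \<psi> \<longrightarrow>
    (\<integral>x. indicator (tile d k h) x * frechet_derivative \<psi> (at x) (u t x) \<partial>lborel) = 0)"
proof -
  have ti: "time_interval 1 = {0..1}" by (auto simp: time_interval_def)
  have "AE t in lborel. t \<in> {0..1} \<longrightarrow>
      (\<forall>\<psi>. test_function \<psi> \<longrightarrow> (\<integral>x. frechet_derivative \<psi> (at x) (u0 t x) \<partial>lborel) = 0)"
    using u0 unfolding velocity_field_def ti by blast
  from AE_affine_time[OF this \<tau>, of a] show ?thesis
  proof eventually_elim
    case (elim t)
    show ?case
    proof (intro impI allI)
      fix \<psi> :: "real^2 \<Rightarrow> real" assume t: "t \<in> {a ..< a + \<tau>}" and \<psi>: "test_function \<psi>"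
      define r where "r = tile_center d k h"
      define t' where "t' = (t - a) / \<tau>"
      have t': "t' \<in> {0..1}" using t \<tau> by (auto simp: t'_def field_simps)
      have s: "smooth \<psi>" by (rule test_function_smooth[OF \<psi>])
      have lin: "linear (frechet_derivative \<psi> (at x))" for x
        by (rule linear_frechet_derivative[OF smooth_differentiable[OF s]])
      define G where "G x = indicator (tile d k h) x * frechet_derivative \<psi> (at x) (u t x)" for x
      have G: "G x = (d / \<tau>) * frechet_derivative \<psi> (at x) (u0 t' ((x - r) /\<^sub>R d))" for x
      proof (cases "x \<in> tile d k h")
        case True
        then show ?thesis using eq[OF t True] by (simp add: G_def t'_def r_def linear_cmul[OF lin])
      next
        case False
        then have "u0 t' ((x - r) /\<^sub>R d) = 0"
          using u0 t' tile_rescale[OF d, of x k h] by (auto simp: velocity_field_def ti r_def)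
        then show ?thesis using False by (simp add: G_def linear_0[OF lin])
      qed
      have "(\<integral>x. G x \<partial>lborel) = 0"
      \<comment> \<open>Without integrability the Bochner integral is 0 by convention, which is the
        claimed value.\<close>
      proof (cases "integrable lborel G")
        case True
        have "(\<integral>x. G x \<partial>lborel) = \<bar>d\<bar> ^ DIM(real^2) * (\<integral>y. G (r + d *\<^sub>R y) \<partial>lborel)"
          using d by (intro integral_affine True) simp
        \<comment> \<open>The chain rule produces a factor \<open>d\<close>, which absorbs the one
          in the velocity scaling \<open>d / \<tau>\<close>.\<close>
        also have "(\<lambda>y. G (r + d *\<^sub>R y)) =
            (\<lambda>y. (1 / \<tau>) * frechet_derivative (\<lambda>y. \<psi> (r + d *\<^sub>R y)) (at y) (u0 t' y))"
          using d by (simp add: G frechet_derivative_eqI[OF has_derivative_affine[OF s]])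
        also have "(\<integral>y. (1 / \<tau>) * frechet_derivative (\<lambda>y. \<psi> (r + d *\<^sub>R y)) (at y) (u0 t' y) \<partial>lborel) = 0"
        proof -
          have "test_function (\<lambda>y. \<psi> (r + d *\<^sub>R y))" using d by (intro test_function_affine \<psi>) simp
          then have "(\<integral>y. frechet_derivative (\<lambda>y. \<psi> (r + d *\<^sub>R y)) (at y) (u0 t' y) \<partial>lborel) = 0"
            using elim t' by (simp add: t'_def)
          then show ?thesis by simp
        qed
        finally show ?thesis by simp
      qed (simp add: not_integrable_integral_eq)
      then show "(\<integral>x. indicator (tile d k h) x * frechet_derivative \<psi> (at x) (u t x) \<partial>lborel) = 0"
        by (simp add: G_def)
    qed
  qed
qed

section \<open>Decomposition of the first column into tiles\<close>

definition strip :: "real \<Rightarrow> (real^2) set" where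
  "strip l = {x \<in> unit_square. x $ 1 < -1/2 + l}"

lemma strip_borel[measurable]: "strip l \<in> sets borel"
proof -
  have "strip l = unit_square \<inter> {x. x $ 1 < -1/2 + l}" by (auto simp: strip_def)
  also have "\<dots> \<in> sets borel" by (intro sets.Int) (auto, measurable)
  finally show ?thesis .
qed

text \<open>The index is the integer part of \<open>(y + 1/2) / d\<close>; staying off the grid
  makes the lower inequality strict.\<close>

lemma real_interval_index:
  fixes y d :: real
  assumes d: "0 < d" and y: "-1/2 < y" "y < -1/2 + real M * d" and off: "\<And>m. m \<le> M \<Longrightarrow> y \<noteq> -1/2 + real m * d"
  shows "\<exists>!m. m < M \<and> -1/2 + real m * d < y \<and> y < -1/2 + (real m + 1) * d"
proof (rule ex_ex1I)
  define z where "z = (y + 1/2) / d"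
  have z: "0 < z" "z < real M" using y d by (simp_all add: z_def field_simps)
  define m where "m = nat \<lfloor>z\<rfloor>"
  have m: "real m \<le> z" "z < real m + 1" using z by (auto simp: m_def of_nat_nat)
  have "m < M" using m(1) z(2) by linarith
  moreover have "-1/2 + real m * d \<le> y" "y < -1/2 + (real m + 1) * d"
    using m d by (simp_all add: z_def field_simps)
  moreover have "y \<noteq> -1/2 + real m * d" using off[of m] \<open>m < M\<close> by simp
  ultimately show "\<exists>m. m < M \<and> -1/2 + real m * d < y \<and> y < -1/2 + (real m + 1) * d"
    by (intro exI[of _ m]) auto
next
  fix m n assume m: "m < M \<and> -1/2 + real m * d < y \<and> y < -1/2 + (real m + 1) * d"
    and n: "n < M \<and> -1/2 + real n * d < y \<and> y < -1/2 + (real n + 1) * d"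
  have "real m * d < (real n + 1) * d" "real n * d < (real m + 1) * d" using m n by linarith+
  then have "real m < real n + 1" "real n < real m + 1" using d by simp_all
  then show "m = n" by linarith
qed

text \<open>The width \<open>l\<close> holds \<open>M ^ n\<close> tiles of side
  \<open>l ^ Suc n\<close>, the height 1 holds \<open>M ^ Suc n\<close> of them. The open tiles miss
  the grid lines, whence an identity almost everywhere.\<close>

lemma sum_indicator_tiles:
  fixes l :: real and M :: nat
  assumes l: "l = 1 / real M" and M: "0 < M"
  shows "AE x in lborel. indicator (strip l) x =
    (\<Sum>(k, h)\<in>{..<M ^ n} \<times> {..<M ^ Suc n}. indicator (tile (l ^ Suc n) k h) x :: real)"
proof -
  define d where "d = l ^ Suc n"
  have l0: "0 < l" using l M by simp
  then have d: "0 < d" by (simp add: d_def)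
  have lM: "l * real M = 1" using l M by simp
  have Md: "real (M ^ Suc n) * d = 1"
  proof -
    have "real (M ^ Suc n) * d = (l * real M) ^ Suc n"
      by (simp only: d_def of_nat_power power_mult_distrib mult.commute)
    then show ?thesis by (simp only: lM power_one)
  qed
  have Md': "real (M ^ n) * d = l"
  proof -
    have "real (M ^ n) * d = (l * real M) ^ n * l"
      by (simp add: d_def power_mult_distrib)
    then show ?thesis by (simp only: lM power_one mult_1)
  qed
  have "AE x in lborel. \<forall>m::nat. \<forall>i::2. (x :: real^2) $ i \<noteq> -1/2 + real m * d"
    by (simp add: AE_all_countable AE_component_neq)
  then show ?thesis
  proof eventually_elim
    case (elim x)
    define Q where "Q k h \<longleftrightarrow> x \<in> tile d k h" for k h
    have tile: "x \<in> tile d k h \<longleftrightarrow> (-1/2 + real k * d < x $ 1 \<and> x $ 1 < -1/2 + (real k + 1) * d) \<and>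
        (-1/2 + real h * d < x $ 2 \<and> x $ 2 < -1/2 + (real h + 1) * d)" for k h
      by (auto simp: tile_def)
    show ?case
    proof (cases "x \<in> strip l")
      case True
      then have x: "-1/2 < x $ 1" "x $ 1 < -1/2 + l" "-1/2 < x $ 2" "x $ 2 < 1/2"
        by (auto simp: strip_def unit_square_def)
      define P where "P i K m \<longleftrightarrow> m < K \<and> -1/2 + real m * d < x $ i \<and> x $ i < -1/2 + (real m + 1) * d"
        for i :: 2 and K m
      have "x $ 1 < -1/2 + real (M ^ n) * d" unfolding Md' by (rule x)
      then have "\<exists>!m. P 1 (M ^ n) m"
        unfolding P_def by (rule real_interval_index[OF d x(1)]) (use elim in blast)
      then obtain k where k: "P 1 (M ^ n) k" "\<And>k'. P 1 (M ^ n) k' \<Longrightarrow> k' = k" by blast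
      have "x $ 2 < -1/2 + real (M ^ Suc n) * d" unfolding Md using x(4) by simp
      then have "\<exists>!m. P 2 (M ^ Suc n) m"
        unfolding P_def by (rule real_interval_index[OF d x(3)]) (use elim in blast)
      then obtain h where h: "P 2 (M ^ Suc n) h" "\<And>h'. P 2 (M ^ Suc n) h' \<Longrightarrow> h' = h" by blast
      have key: "x \<in> tile d k' h' \<longleftrightarrow> (k', h') = (k, h)" if "k' < M ^ n" "h' < M ^ Suc n" for k' h'
      proof -
        have "x \<in> tile d k' h' \<longleftrightarrow> P 1 (M ^ n) k' \<and> P 2 (M ^ Suc n) h'"
          unfolding tile P_def using that by blast
        then show ?thesis using k h by blast
      qed
      have kh: "k < M ^ n" "h < M ^ Suc n" using k(1) h(1) by (simp_all only: P_def)
      have "(\<Sum>(k', h')\<in>{..<M ^ n} \<times> {..<M ^ Suc n}. indicator (tile d k' h') x :: real) =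
          (\<Sum>p\<in>{..<M ^ n} \<times> {..<M ^ Suc n}. if p = (k, h) then 1 else 0)"
      proof (rule sum.cong[OF refl])
        fix p assume "p \<in> {..<M ^ n} \<times> {..<M ^ Suc n}"
        then have "x \<in> tile d (fst p) (snd p) \<longleftrightarrow> p = (k, h)" using key[of "fst p" "snd p"] by auto
        then show "(case p of (k', h') \<Rightarrow> (indicator (tile d k' h') x :: real)) = (if p = (k, h) then 1 else 0)"
          by (cases p) (auto split: split_indicator)
      qed
      also have "\<dots> = 1"
        using kh by (subst sum.delta) (simp_all only: finite_cartesian_product finite_lessThan mem_Times_iff fst_conv snd_conv lessThan_iff simp_thms if_True)
      finally show ?thesis using True by (simp add: d_def)
    next
      case False
      have "x \<notin> tile d k h" if "k < M ^ n" "h < M ^ Suc n" for k h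
      proof
        assume "x \<in> tile d k h"
        then have a: "-1/2 + real k * d < x $ 1" "x $ 1 < -1/2 + (real k + 1) * d"
          "-1/2 + real h * d < x $ 2" "x $ 2 < -1/2 + (real h + 1) * d" by (auto simp: tile)
        have "0 \<le> real k * d" "0 \<le> real h * d" using d by auto
        moreover have "(real k + 1) * d \<le> l"
        proof -
          have "real (Suc k) \<le> real (M ^ n)" using that(1) by (simp only: of_nat_le_iff Suc_le_eq)
          then have "real (Suc k) * d \<le> real (M ^ n) * d" using d by (intro mult_right_mono) auto
          then show ?thesis unfolding Md' by (simp add: add.commute)
        qed
        moreover have "(real h + 1) * d \<le> 1"
        proof -
          have "real (Suc h) \<le> real (M ^ Suc n)" using that(2) by (simp only: of_nat_le_iff Suc_le_eq)
          then have "real (Suc h) * d \<le> real (M ^ Suc n) * d" using d by (intro mult_right_mono) auto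
          then show ?thesis unfolding Md by (simp add: add.commute)
        qed
        moreover have "l \<le> 1" using l M by simp
        ultimately have "x \<in> strip l" using a by (auto simp: strip_def unit_square_def)
        then show False using False by blast
      qed
      then have "(\<Sum>(k, h)\<in>{..<M ^ n} \<times> {..<M ^ Suc n}. indicator (tile d k h) x :: real) = 0"
        by (intro sum.neutral) auto
      then show ?thesis using False by (simp add: d_def)
    qed
  qed
qed

text \<open>Fubini on each interval [0, N]; countably many exceptional null sets remain null.
  Integrable slices allow an integral over the strip to be split into integrals over tiles.\<close>

lemma velocity_field_slice_integrable:
  assumes u: "velocity_field \<infinity> u"
  shows "AE t in lborel. 0 \<le> t \<longrightarrow> integrable lborel (u t)"
proof -
  have "AE t in lborel. t \<in> {0..real N} \<longrightarrow> integrable lborel (u t)" for N :: nat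
  proof -
    have "{0..} \<inter> {..real N} = {0..real N}" by auto
    then have "set_integrable lborel ({0..real N} \<times> UNIV) (\<lambda>(t, x). u t x)"
      using u unfolding velocity_field_def time_interval_infinity by metis
    then have "integrable (lborel \<Otimes>\<^sub>M lborel) (\<lambda>p. indicator ({0..real N} \<times> UNIV) p *\<^sub>R u (fst p) (snd p))"
      by (simp add: set_integrable_def lborel_prod case_prod_beta')
    from lborel_pair.AE_integrable_fst'[OF this] show ?thesis
      by eventually_elim (auto simp: indicator_times)
  qed
  then have "AE t in lborel. \<forall>N::nat. t \<in> {0..real N} \<longrightarrow> integrable lborel (u t)"
    unfolding AE_all_countable by blast
  then show ?thesis
  proof eventually_elim
    case (elim t)
    obtain N :: nat where "t \<le> real N" using real_arch_simple by blast
    then show ?case using elim by auto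
  qed
qed

lemma derivative_along_field_integrable:
  fixes v :: "real^2 \<Rightarrow> real^2"
  assumes v: "integrable lborel v" and \<psi>: "test_function \<psi>"
  shows "integrable lborel (\<lambda>x. frechet_derivative \<psi> (at x) (v x))"
proof -
  have s: "smooth \<psi>" by (rule test_function_smooth[OF \<psi>])
  have [measurable]: "v \<in> borel_measurable borel" using v by auto
  show ?thesis
    unfolding frechet_derivative_expand[OF smooth_differentiable[OF s], of _ "v _"]
  proof (rule Bochner_Integration.integrable_sum)
    fix b :: "real^2" assume b: "b \<in> Basis"
    obtain K where K: "\<And>x. \<bar>frechet_derivative \<psi> (at x) b\<bar> \<le> K"
      using test_function_bounded[OF test_function_derivative[OF \<psi>, of b]] by blast
    have [measurable]: "(\<lambda>x. frechet_derivative \<psi> (at x) b) \<in> borel_measurable borel"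
      by (rule smooth_borel[OF smooth_derivative[OF s]])
    show "integrable lborel (\<lambda>x. (v x \<bullet> b) * frechet_derivative \<psi> (at x) b)"
    proof (rule Bochner_Integration.integrable_bound[of _ "\<lambda>x. norm (v x) * \<bar>K\<bar>"])
      show "AE x in lborel. norm ((v x \<bullet> b) * frechet_derivative \<psi> (at x) b) \<le> norm (norm (v x) * \<bar>K\<bar>)"
      proof (rule AE_I2)
        fix x
        have "\<bar>v x \<bullet> b\<bar> * \<bar>frechet_derivative \<psi> (at x) b\<bar> \<le> norm (v x) * \<bar>K\<bar>"
          by (intro mult_mono Basis_le_norm b order_trans[OF K abs_ge_self]) auto
        then show "norm ((v x \<bullet> b) * frechet_derivative \<psi> (at x) b) \<le> norm (norm (v x) * \<bar>K\<bar>)"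
          by (simp add: abs_mult)
      qed
    qed (use v in auto)
  qed
qed

lemma stage_time_Suc: "stage_time \<tau> (Suc n) = stage_time \<tau> n + \<tau> ^ n"
  by (simp add: stage_time_def)

text \<open>Because \<open>stage_time \<tau> 1\<close> is 1, the first stage time beyond
  \<open>t\<close> has index at least 2. So \<open>t\<close> is never in stage 0, whose only tile is
  the whole square and does not fit into the strip.\<close>

lemma stage_exists:
  assumes "1 \<le> t" "\<not> (\<forall>n. stage_time \<tau> n \<le> t)"
  shows "\<exists>n. t \<in> {stage_time \<tau> (Suc n) ..< stage_time \<tau> (Suc (Suc n))}"
proof -
  obtain n where n: "t < stage_time \<tau> n" using assms(2) by (auto simp: not_le)
  define m where "m = (LEAST n. t < stage_time \<tau> n)"
  have m: "t < stage_time \<tau> m" unfolding m_def by (rule LeastI[of "\<lambda>n. t < stage_time \<tau> n", OF n])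
  have "m \<noteq> 0"
  proof
    assume "m = 0"
    then show False using m assms(1) by (simp add: stage_time_def)
  qed
  moreover have "m \<noteq> 1"
  proof
    assume "m = 1"
    then show False using m assms(1) by (simp add: stage_time_def)
  qed
  ultimately obtain k where k: "m = Suc (Suc k)" by (metis One_nat_def not0_implies_Suc)
  have "\<not> t < stage_time \<tau> (Suc k)" by (rule not_less_Least) (use k in \<open>simp add: m_def\<close>)
  then show ?thesis using m k by (intro exI[of _ k]) auto
qed

text \<open>In every stage after stage 0 the strip is, up to a null set, a finite disjoint union of
  tiles, each with zero flux. After all stages the field itself is zero.\<close>

lemma cellular_strip_flux_zero:
  assumes \<tau>: "0 < \<tau>" and l: "l = 1 / real M" and M: "0 < M"
    and cell: "cellular_type \<kappa> sbar \<tau> l a p \<theta> s u \<rho>"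
  shows "AE t in lborel. 1 \<le> t \<longrightarrow> (\<forall>\<psi>. test_function \<psi> \<longrightarrow>
    (\<integral>x. indicator (strip l) x * frechet_derivative \<psi> (at x) (u t x) \<partial>lborel) = 0)"
proof -
  have l0: "0 < l" using l M by simp
  have vf: "velocity_field \<infinity> u" using cell by (simp add: cellular_type_def)
  have idx: "(k, h) \<in> tile_indices (l ^ n)" if "k < M ^ n" "h < M ^ n" for k h n
  proof -
    have "1 / l ^ n = real (M ^ n)" using l M by (simp add: power_one_over)
    then show ?thesis using that by (auto simp: tile_indices_def simp flip: of_nat_Suc simp del: of_nat_power)
  qed
  have tile_zero: "AE t in lborel. t \<in> {stage_time \<tau> n ..< stage_time \<tau> (Suc n)} \<longrightarrow> (\<forall>\<psi>. test_function \<psi> \<longrightarrow>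
      (\<integral>x. indicator (tile (l ^ n) k h) x * frechet_derivative \<psi> (at x) (u t x) \<partial>lborel) = 0)"
    if kh: "k < M ^ n" "h < M ^ n" for k h n
  proof -
    have "\<exists>(u0, \<rho>0) \<in> building_blocks \<kappa> sbar l a p \<theta> s.
        \<forall>t \<in> {stage_time \<tau> n ..< stage_time \<tau> (Suc n)}. \<forall>x \<in> tile (l ^ n) k h.
          u t x = (l ^ n / \<tau> ^ n) *\<^sub>R
             u0 ((t - stage_time \<tau> n) / \<tau> ^ n) ((x - tile_center (l ^ n) k h) /\<^sub>R l ^ n) \<and>
          \<rho> t x = \<rho>0 ((t - stage_time \<tau> n) / \<tau> ^ n) ((x - tile_center (l ^ n) k h) /\<^sub>R l ^ n)"
    proof -
      have "\<forall>n. \<forall>(k, h) \<in> tile_indices (l ^ n). \<exists>(u0, \<rho>0) \<in> building_blocks \<kappa> sbar l a p \<theta> s.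
        \<forall>t \<in> {stage_time \<tau> n ..< stage_time \<tau> (Suc n)}. \<forall>x \<in> tile (l ^ n) k h.
          u t x = (l ^ n / \<tau> ^ n) *\<^sub>R
             u0 ((t - stage_time \<tau> n) / \<tau> ^ n) ((x - tile_center (l ^ n) k h) /\<^sub>R l ^ n) \<and>
          \<rho> t x = \<rho>0 ((t - stage_time \<tau> n) / \<tau> ^ n) ((x - tile_center (l ^ n) k h) /\<^sub>R l ^ n)"
        using cell unfolding cellular_type_def by (elim conjE)
      from bspec[OF spec[OF this] idx[OF kh]] show ?thesis by (simp only: prod.case)
    qed
    then obtain z where z: "z \<in> building_blocks \<kappa> sbar l a p \<theta> s" and z_eq: "case z of (u0, \<rho>0) \<Rightarrow>
        \<forall>t \<in> {stage_time \<tau> n ..< stage_time \<tau> (Suc n)}. \<forall>x \<in> tile (l ^ n) k h.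
          u t x = (l ^ n / \<tau> ^ n) *\<^sub>R
             u0 ((t - stage_time \<tau> n) / \<tau> ^ n) ((x - tile_center (l ^ n) k h) /\<^sub>R l ^ n) \<and>
          \<rho> t x = \<rho>0 ((t - stage_time \<tau> n) / \<tau> ^ n) ((x - tile_center (l ^ n) k h) /\<^sub>R l ^ n)"
      by (elim bexE)
    define u0 where "u0 = fst z"
    have u0: "(u0, snd z) \<in> building_blocks \<kappa> sbar l a p \<theta> s" using z by (simp add: u0_def)
    have eq: "u t x = (l ^ n / \<tau> ^ n) *\<^sub>R
             u0 ((t - stage_time \<tau> n) / \<tau> ^ n) ((x - tile_center (l ^ n) k h) /\<^sub>R l ^ n)"
      if "t \<in> {stage_time \<tau> n ..< stage_time \<tau> (Suc n)}" "x \<in> tile (l ^ n) k h" for t x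
      using z_eq that unfolding case_prod_beta' u0_def by blast
    have "velocity_field 1 u0" using u0 by (simp add: building_blocks_def)
    from tile_flux_zero[OF _ _ this eq[unfolded stage_time_Suc]] show ?thesis
      unfolding stage_time_Suc using l0 \<tau> by auto
  qed
  \<comment> \<open>There are countably many stages and tiles, so one null set of times serves them
    all, still uniformly in \<open>\<psi>\<close>.\<close>
  have "AE t in lborel. \<forall>n k h. k < M ^ n \<longrightarrow> h < M ^ n \<longrightarrow> t \<in> {stage_time \<tau> n ..< stage_time \<tau> (Suc n)} \<longrightarrow>
      (\<forall>\<psi>. test_function \<psi> \<longrightarrow>
        (\<integral>x. indicator (tile (l ^ n) k h) x * frechet_derivative \<psi> (at x) (u t x) \<partial>lborel) = 0)"
    unfolding AE_all_countable
  proof (intro allI)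
    fix n k h
    show "AE t in lborel. k < M ^ n \<longrightarrow> h < M ^ n \<longrightarrow> t \<in> {stage_time \<tau> n ..< stage_time \<tau> (Suc n)} \<longrightarrow>
      (\<forall>\<psi>. test_function \<psi> \<longrightarrow>
        (\<integral>x. indicator (tile (l ^ n) k h) x * frechet_derivative \<psi> (at x) (u t x) \<partial>lborel) = 0)"
      using tile_zero[of k n h] by (cases "k < M ^ n \<and> h < M ^ n") auto
  qed
  then show ?thesis
    using velocity_field_slice_integrable[OF vf]
  proof eventually_elim
    case (elim t)
    show ?case
    proof (intro impI allI)
      fix \<psi> :: "real^2 \<Rightarrow> real" assume t: "1 \<le> t" and \<psi>: "test_function \<psi>"
      define D where "D x = frechet_derivative \<psi> (at x) (u t x)" for x
      show "(\<integral>x. indicator (strip l) x * frechet_derivative \<psi> (at x) (u t x) \<partial>lborel) = 0"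
      proof (cases "\<forall>n. stage_time \<tau> n \<le> t")
        \<comment> \<open>The stages accumulate at a finite time, as happens for
          \<open>\<tau> < 1\<close>, and \<open>t\<close> is beyond all of them, where the field is
          extended by zero.\<close>
        case True
        then have "u t x = 0" for x using cell by (simp add: cellular_type_def)
        moreover have "linear (frechet_derivative \<psi> (at x))" for x
          by (rule linear_frechet_derivative[OF smooth_differentiable[OF test_function_smooth[OF \<psi>]]])
        ultimately show ?thesis by (simp add: linear_0)
      next
        case False
        obtain n where n: "t \<in> {stage_time \<tau> (Suc n) ..< stage_time \<tau> (Suc (Suc n))}"
          using stage_exists[OF t False] by blast
        have "integrable lborel (u t)" using elim(2) t by simp
        then have D: "integrable lborel D"
          unfolding D_def by (rule derivative_along_field_integrable[OF _ \<psi>])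
        define I where "I = {..<M ^ n} \<times> {..<M ^ Suc n}"
        have int: "integrable lborel (\<lambda>x. indicator (tile (l ^ Suc n) k h) x * D x)" for k h
          using integrable_mult_indicator[OF _ D, of "tile (l ^ Suc n) k h"] tile_borel by simp
        have zero: "(\<integral>x. indicator (tile (l ^ Suc n) k h) x * D x \<partial>lborel) = 0" if "(k, h) \<in> I" for k h
        proof -
          have "k < M ^ Suc n"
            using that M by (auto simp: I_def intro: less_le_trans)
          moreover have "h < M ^ Suc n" using that by (simp add: I_def)
          ultimately show ?thesis using elim(1) n \<psi> unfolding D_def by blast
        qed
        have "(\<integral>x. indicator (strip l) x * D x \<partial>lborel) =
            (\<integral>x. (\<Sum>(k, h)\<in>I. indicator (tile (l ^ Suc n) k h) x * D x) \<partial>lborel)"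
        proof (rule integral_cong_AE)
          have [measurable]: "D \<in> borel_measurable borel" using D by auto
          show "(\<lambda>x. indicat_real (strip l) x * D x) \<in> borel_measurable lborel" by measurable
          show "(\<lambda>x. \<Sum>(k, h)\<in>I. indicat_real (tile (l ^ Suc n) k h) x * D x) \<in> borel_measurable lborel"
            unfolding case_prod_beta' by measurable
          show "AE x in lborel. indicat_real (strip l) x * D x = (\<Sum>(k, h)\<in>I. indicat_real (tile (l ^ Suc n) k h) x * D x)"
            using sum_indicator_tiles[OF l M, of n]
            by eventually_elim (simp add: I_def sum_distrib_right case_prod_beta')
        qed
        also have "\<dots> = (\<Sum>(k, h)\<in>I. \<integral>x. indicator (tile (l ^ Suc n) k h) x * D x \<partial>lborel)"
          unfolding case_prod_beta' by (rule Bochner_Integration.integral_sum) (rule int)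
        also have "\<dots> = 0" by (rule sum.neutral) (use zero in auto)
        finally show ?thesis by (simp add: D_def)
      qed
    qed
  qed
qed

section \<open>The unmixed profile\<close>

text \<open>Equal to \<open>1 - l\<close> on the strip and to \<open>- l\<close> on the rest of the
  square. For \<open>0 < l\<close> and \<open>l \<le> 1/2\<close> the weight \<open>l\<close> is the
  area of the strip, which makes the mean zero.\<close>

definition strip_profile :: "real \<Rightarrow> real^2 \<Rightarrow> real" where
  "strip_profile l x = indicator (strip l) x - l * indicator unit_square x"

lemma strip_subset: "strip l \<subseteq> unit_square"
  by (auto simp: strip_def)

lemma strip_profile_borel[measurable]: "strip_profile l \<in> borel_measurable borel"
  unfolding strip_profile_def by measurable

lemma strip_profile_outside: "x \<notin> unit_square \<Longrightarrow> strip_profile l x = 0"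
  using strip_subset[of l] by (auto simp: strip_profile_def split: split_indicator)

text \<open>Since \<open>l \<le> 1/2\<close>, the larger of the two moduli is \<open>1 - l\<close>,
  the value on the strip.\<close>

lemma strip_profile_bound:
  assumes "0 < l" "l \<le> 1/2" shows "\<bar>strip_profile l x\<bar> \<le> 1 - l"
  using assms strip_subset[of l] by (auto simp: strip_profile_def split: split_indicator)

lemma measure_box2:
  fixes a b c d :: real
  assumes "a \<le> b" "c \<le> d"
  shows "measure lborel (box (vector [a, c]) (vector [b, d] :: real^2)) = (b - a) * (d - c)"
proof -
  have "measure lborel (box (vector [a, c]) (vector [b, d] :: real^2)) = measure lborel (cbox (vector [a, c]) (vector [b, d] :: real^2))"
    by (simp add: measure_lborel_box_eq measure_lborel_cbox_eq)
  also have "\<dots> = (b - a) * (d - c)"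
    using assms by (subst content_cbox_cart) (auto simp: interval_ne_empty_cart forall_2 UNIV_2)
  finally show ?thesis .
qed

lemma strip_profile_mean:
  assumes "0 < l" "l \<le> 1/2" shows "(\<integral>x. strip_profile l x \<partial>lborel) = 0"
proof -
  have "strip l = box (vector [-1/2, -1/2]) (vector [-1/2 + l, 1/2])"
    using assms by (auto simp: strip_def unit_square_def mem_box_cart forall_2)
  then have s: "measure lborel (strip l) = l"
    using measure_box2[of "-1/2" "-1/2 + l" "-1/2" "1/2"] assms by simp
  have q: "measure lborel unit_square = 1"
    unfolding unit_square_box using measure_box2[of "-1/2" "1/2" "-1/2" "1/2"] by simp
  have "emeasure lborel (strip l) < \<infinity>"
    using emeasure_mono[OF strip_subset, of lborel l] unit_square_finite by (auto intro: le_less_trans)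
  then have "(\<integral>x. strip_profile l x \<partial>lborel) = measure lborel (strip l) - l * measure lborel unit_square"
    unfolding strip_profile_def using unit_square_finite
    by (subst Bochner_Integration.integral_diff) auto
  then show ?thesis by (simp add: s q)
qed

text \<open>A ball of radius below \<open>l / 2\<close> about the center of the strip stays inside
  the strip, where the profile has its maximal modulus. The average over the ball thus equals the
  supremum and exceeds \<open>\<kappa>\<close> times it.\<close>

lemma strip_profile_mixing_scale:
  assumes \<kappa>: "0 < \<kappa>" "\<kappa> < 1" and l: "0 < l" "l \<le> 1/2"
  shows "ereal (l / 2) \<le> geometric_mixing_scale \<kappa> (strip_profile l)"
  unfolding geometric_mixing_scale_def
proof (rule INF_greatest, clarify)
  fix \<epsilon> :: real
  assume \<epsilon>: "0 < \<epsilon>" and avg: "\<forall>x. ereal \<bar>(LINT y:ball x \<epsilon>|lborel. strip_profile l y) / measure lborel (ball x \<epsilon>)\<bar>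
              \<le> ereal \<kappa> * esssup lborel (\<lambda>y. ereal \<bar>strip_profile l y\<bar>)"
  show "ereal (l / 2) \<le> ereal \<epsilon>"
  proof (rule ccontr)
    assume "\<not> ereal (l / 2) \<le> ereal \<epsilon>"
    then have small: "\<epsilon> < l / 2" by simp
    define x :: "real^2" where "x = vector [-1/2 + l / 2, 0]"
    have in_strip: "y \<in> strip l" if "y \<in> ball x \<epsilon>" for y
    proof -
      have "\<bar>x $ i - y $ i\<bar> < \<epsilon>" for i
        using that component_le_norm_cart[of "x - y" i] by (simp add: dist_norm)
      from this[of 1] this[of 2] show ?thesis
        using small l by (auto simp: x_def strip_def unit_square_def abs_less_iff)
    qed
    then have val: "strip_profile l y = 1 - l" if "y \<in> ball x \<epsilon>" for y
      using that strip_subset[of l] by (auto simp: strip_profile_def split: split_indicator)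
    have "(LINT y:ball x \<epsilon>|lborel. strip_profile l y) = (\<integral>y. (1 - l) * indicator (ball x \<epsilon>) y \<partial>lborel)"
      unfolding set_lebesgue_integral_def
      by (rule Bochner_Integration.integral_cong) (auto simp: val split: split_indicator)
    also have "\<dots> = (1 - l) * measure lborel (ball x \<epsilon>)" by simp
    finally have int: "(LINT y:ball x \<epsilon>|lborel. strip_profile l y) = (1 - l) * measure lborel (ball x \<epsilon>)" .
    have "0 < measure lborel (ball x \<epsilon>)" using content_ball_pos[OF \<epsilon>, of x] by simp
    then have "ereal (1 - l) \<le> ereal \<kappa> * esssup lborel (\<lambda>y. ereal \<bar>strip_profile l y\<bar>)"
      using spec[OF avg, of x] l by (simp add: int)
    also have "\<dots> \<le> ereal \<kappa> * ereal (1 - l)"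
    proof (rule ereal_mult_left_mono)
      show "esssup lborel (\<lambda>y. ereal \<bar>strip_profile l y\<bar>) \<le> ereal (1 - l)"
        using strip_profile_bound[OF l] by (intro esssup_I) auto
    qed (use \<kappa> in simp)
    finally have "1 - l \<le> \<kappa> * (1 - l)" by simp
    moreover have "\<kappa> * (1 - l) < 1 * (1 - l)" using \<kappa> l by (intro mult_strict_right_mono) auto
    ultimately show False by simp
  qed
qed

text \<open>The strip part of the profile has zero flux because of the tiles, the part constant on
  the square because the field is divergence free on the plane and vanishes off the square.\<close>

lemma cellular_strip_profile_stationary:
  assumes \<tau>: "0 < \<tau>" and l: "l = 1 / real M" and M: "0 < M"
    and cell: "cellular_type \<kappa> sbar \<tau> l a p \<theta> s u \<rho>"
  shows "AE t in lborel. 1 \<le> t \<longrightarrow> (\<forall>\<psi>. test_function \<psi> \<longrightarrow>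
    (\<integral>x. strip_profile l x * frechet_derivative \<psi> (at x) (u t x) \<partial>lborel) = 0)"
proof -
  have vf: "velocity_field \<infinity> u" using cell by (simp add: cellular_type_def)
  then have "AE t in lborel. t \<in> {0..} \<longrightarrow> (\<forall>\<psi>. test_function \<psi> \<longrightarrow>
      (\<integral>x. frechet_derivative \<psi> (at x) (u t x) \<partial>lborel) = 0)"
    unfolding velocity_field_def time_interval_infinity by blast
  then show ?thesis
    using cellular_strip_flux_zero[OF \<tau> l M cell] velocity_field_slice_integrable[OF vf]
  proof eventually_elim
    case (elim t)
    show ?case
    proof (intro impI allI)
      fix \<psi> :: "real^2 \<Rightarrow> real" assume t: "1 \<le> t" and \<psi>: "test_function \<psi>"
      define D where "D x = frechet_derivative \<psi> (at x) (u t x)" for x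
      have "integrable lborel (u t)" using elim(3) t by simp
      then have D: "integrable lborel D"
        unfolding D_def by (rule derivative_along_field_integrable[OF _ \<psi>])
      have D0: "D x = 0" if "x \<notin> unit_square" for x
      proof -
        have "u t x = 0" using vf that t by (simp add: velocity_field_def time_interval_infinity)
        moreover have "linear (frechet_derivative \<psi> (at x))"
          by (rule linear_frechet_derivative[OF smooth_differentiable[OF test_function_smooth[OF \<psi>]]])
        ultimately show ?thesis by (simp add: D_def linear_0)
      qed
      have eq: "strip_profile l x * D x = indicator (strip l) x * D x - l * D x" for x
        using D0[of x] by (cases "x \<in> unit_square") (auto simp: strip_profile_def algebra_simps)
      have int: "integrable lborel (\<lambda>x. indicator (strip l) x * D x)"
        using integrable_mult_indicator[OF _ D, of "strip l"] strip_borel by simp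
      have "(\<integral>x. strip_profile l x * D x \<partial>lborel) = (\<integral>x. indicator (strip l) x * D x \<partial>lborel) - l * (\<integral>x. D x \<partial>lborel)"
        unfolding eq using int D by simp
      also have "\<dots> = 0"
        using elim(1,2) t \<psi> by (simp add: D_def)
      finally show "(\<integral>x. strip_profile l x * frechet_derivative \<psi> (at x) (u t x) \<partial>lborel) = 0"
        by (simp add: D_def)
    qed
  qed
qed

theorem mainTheorem2:
  fixes \<kappa> sbar \<tau> l a \<theta> s :: real and p :: ereal
    and u :: "real \<Rightarrow> real^2 \<Rightarrow> real^2" and \<rho> :: "real \<Rightarrow> real^2 \<Rightarrow> real"
  assumes "0 < \<kappa>" "\<kappa> < 1" "0 < sbar" "sbar < 1"
    and "0 < \<tau>"
    and "0 < l" "1 / l \<in> \<int>" "1 / l \<ge> 2"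
    and "0 < \<theta>" "\<theta> \<le> 1/2" "0 < a" "1 < p" "1 < s"
    and "cellular_type \<kappa> sbar \<tau> l a p \<theta> s u \<rho>"
  shows "\<not> universal_mixer \<kappa> u"
proof
  assume mixer: "universal_mixer \<kappa> u"
  have vf: "velocity_field \<infinity> u" using mixer by (simp add: universal_mixer_def)
  obtain k where k: "1 / l = of_int k" using \<open>1 / l \<in> \<int>\<close> by (auto elim: Ints_cases)
  define M where "M = nat k"
  have "2 \<le> k" using \<open>1 / l \<ge> 2\<close> k by simp
  then have M: "0 < M" and "real M = 1 / l" using k by (auto simp: M_def)
  then have l: "l = 1 / real M" using \<open>0 < l\<close> by simp
  have l2: "l \<le> 1/2" using \<open>1 / l \<ge> 2\<close> \<open>0 < l\<close> by (simp add: field_simps)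
  have bound: "\<bar>strip_profile l x\<bar> \<le> 1" for x
    using strip_profile_bound[OF \<open>0 < l\<close> l2, of x] \<open>0 < l\<close> by simp
  \<comment> \<open>The solution that refutes universality: from time 1 on it equals the profile, so
    its geometric mixing scale never drops below \<open>l / 2\<close>.\<close>
  obtain \<rho>0 E where E: "initial_datum \<rho>0" "continuity_solution \<infinity> u \<rho>0 E" "\<And>t. 1 \<le> t \<Longrightarrow> E t = strip_profile l"
  proof (rule evolution_to_stationary_profile[OF vf strip_profile_borel bound strip_profile_outside
        strip_profile_mean[OF \<open>0 < l\<close> l2] cellular_strip_profile_stationary[OF \<open>0 < \<tau>\<close> l M assms(14)]])
    fix \<rho>0 E
    assume "initial_datum \<rho>0" "continuity_solution \<infinity> u \<rho>0 E" "\<And>t. 1 \<le> t \<Longrightarrow> E t = strip_profile l"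
    then show thesis by (rule that)
  qed
  have "((\<lambda>t. geometric_mixing_scale \<kappa> (E t)) \<longlongrightarrow> 0) at_top"
    using mixer E(1,2) by (simp add: universal_mixer_def)
  then have "eventually (\<lambda>t. geometric_mixing_scale \<kappa> (E t) < ereal (l / 2)) at_top"
    by (rule order_tendstoD) (use \<open>0 < l\<close> in simp)
  then have "eventually (\<lambda>t. geometric_mixing_scale \<kappa> (E t) < ereal (l / 2) \<and> 1 \<le> t) at_top"
    by (intro eventually_conj eventually_ge_at_top)
  then obtain t where "geometric_mixing_scale \<kappa> (E t) < ereal (l / 2)" "1 \<le> t"
    using eventually_happens'[OF trivial_limit_at_top_linorder] by blast
  then show False
    using strip_profile_mixing_scale[OF \<open>0 < \<kappa>\<close> \<open>\<kappa> < 1\<close> \<open>0 < l\<close> l2] E(3) by (simp add: not_le[symmetric])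
qed

end
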